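(* Let $d\ge 1$, let $X$ be an affine building whose apartments are Coxeter complexes attached to Coxeter systems of type $\widetilde{A}_d$, equipped with a fixed orientation, and let $\mathcal{V}$ be a homological coefficient system on $X$. Let $1\le k\le d$ and suppose that $\mathcal{V}$ satisfies the condition $\mathcal{S}^*(k)$. Then $H_k(X,\mathcal{V})=0$.
   Context: Building and orientation. $X^j$ denotes the set of $j$-simplices of $X$; a simplex is identified with its set of vertices; two vertices $x,y$ are incident if $\{x,y\}\in X^1$. The fixed orientation of $X$ distinguishes for each simplex a cyclic ordering on its set of vertices. A pointed $k$-simplex is an enumeration $(x_0,\ldots,x_k)$ of the vertices of a $k$-simplex in its distinguished cyclic ordering. For every apartment $A$ of $X$ (not distinguished from its geometric realization) there is an identification of $A$ with $\mathbb{R}^{d+1}/\mathbb{R}(1,\ldots,1)$ such that, with $e_0,\ldots,e_d$ the standard basis: the set of vertices of $A$ is $\mathbb{Z}^{d+1}/\mathbb{Z}(1,\ldots,1)$; and a tuple $(x_0,\ldots,x_k)$ of vertices of $A$ is a pointed $k$-simplex if and only if there is a sequence $\emptyset\ne J_0\subsetneq\cdots\subsetneq J_{k-1}\subsetneq\{0,\ldots,d\}$ such that $\sum_{j\in J_t}e_j$ represents $x_t-x_k$ for all $0\le t\le k-1$. Stability. For a pointed $k$-simplex $(x_0,\ldots,x_k)$ let $\ell((x_0,\ldots,x_k))$ be the maximal $r$ such that there is a pointed $r$-simplex $(y_0,\ldots,y_r)$ with $y_0=x_0$ and $y_r=x_k$. For a pointed $(k-1)$-simplex $\widehat{\eta}=(x_1,\ldots,x_k)$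 let $N_{\widehat{\eta}}=\{z\in X^0 : (z,x_1,\ldots,x_k)\text{ is a pointed }k\text{-simplex}\}$; write $(z,\widehat{\eta})=(z,x_1,\ldots,x_k)$. On $N_{\widehat{\eta}}$ set $u_1\le u_2$ iff $u_1=u_2$ or $(u_1,u_2,\widehat{\eta})$ is a pointed $(k+1)$-simplex. For $u_1,u_2\in N_{\widehat{\eta}}$ let $W^{\widehat{\eta}}_{u_1,u_2}=\{u\in N_{\widehat{\eta}} : u\le u_1,\ u\le u_2\}$. If this set is nonempty, it contains a (unique) element $u$ with $\ell((u,\widehat{\eta}))<\ell((w,\widehat{\eta}))$ for all other $w\in W^{\widehat{\eta}}_{u_1,u_2}$; this element is denoted $[\widehat{\eta}|u_1,u_2]$. If $W^{\widehat{\eta}}_{u_1,u_2}=\emptyset$, then $[\widehat{\eta}|u_1,u_2]$ is undefined. A subset $M_0\subset N_{\widehat{\eta}}$ is stable with respect to $\widehat{\eta}$ if for any $u_1,u_2\in M_0$ the vertex $[\widehat{\eta}|u_1,u_2]$ is defined and belongs to $M_0$. Coefficient systems. A homological coefficient system (hcs) $\mathcal{V}$ on $X$ assigns to every simplex $\tau$ an abelian group $\mathcal{V}(\tau)$ and to every face inclusion $\sigma\subset\tau$ a homomorphism $r^\tau_\sigma:\mathcal{V}(\tau)\to\mathcal{V}(\sigma)$ such that $r^\tau_\rho\circ r^\sigma_\tau=r^\sigma_\rho$ whenever $\rho\subset\tau\subset\sigma$, and $r^\tau_\tau=\mathrm{id}$. $C_k(X,\mathcal{V})=\bigoplus_{\tau\in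 X^k}\mathcal{V}(\tau)$ (finitely supported chains), and $\partial=\partial_k:C_{k+1}(X,\mathcal{V})\to C_k(X,\mathcal{V})$ is $(\partial c)_\tau=\sum_{\tau'\supset\tau}[\tau':\tau]\,r^{\tau'}_\tau(c_{\tau'})$, where $\tau'$ runs over the $(k+1)$-simplices containing $\tau$ and $[\tau':\tau]=\pm1$ is the incidence number with respect to a fixed labelling of $X$ by vertex types. $H_k(X,\mathcal{V})$ is the $k$-th homology of the complex $(C_\bullet(X,\mathcal{V}),\partial)$. Condition $\mathcal{S}^*(k)$ (for $1\le k\le d$): for any pointed $(k-1)$-simplex $\widehat{\eta}$ with underlying $(k-1)$-simplex $\eta$ and any subset $M_0\subset N_{\widehat{\eta}}$ stable with respect to $\widehat{\eta}$, the subquotient complex of $(C_\bullet(X,\mathcal{V}),\partial)$ $$\bigoplus_{z,z'\in M_0,\ \{z,z'\}\in X^1}\mathcal{V}(\{z,z'\}\cup\eta)\xrightarrow{\partial_k}\bigoplus_{z\in M_0}\mathcal{V}(\{z\}\cup\eta)\xrightarrow{\partial_{k-1}}\mathcal{V}(\eta)$$ is exact (at the middle term). *)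

theory Defs
  imports "HOL-Algebra.Free_Abelian_Groups"
begin

section \<open>Simplicial complexes\<close>

text \<open>A complex is the set of its \<^emph>\<open>nonempty\<close> simplices, each simplex being the set of its
  vertices; thus the vertex set of \<open>X\<close> is \<open>\<Union>X\<close>, and the empty simplex is never a member.\<close>

definition simplicial_complex :: "'v set set \<Rightarrow> bool" where
  "simplicial_complex X \<longleftrightarrow>
     (\<forall>\<sigma>\<in>X. finite \<sigma> \<and> \<sigma> \<noteq> {} \<and> (\<forall>\<rho>. \<rho> \<subseteq> \<sigma> \<and> \<rho> \<noteq> {} \<longrightarrow> \<rho> \<in> X))"

definition simplices :: "'v set set \<Rightarrow> nat \<Rightarrow> 'v set set" where
  "simplices X j = {\<sigma> \<in> X. card \<sigma> = j + 1}"

definition complex_iso :: "'v set set \<Rightarrow> 'w set set \<Rightarrow> ('v \<Rightarrow> 'w) \<Rightarrow> bool" where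
  "complex_iso A B f \<longleftrightarrow> bij_betw f (\<Union>A) (\<Union>B) \<and> (\<lambda>\<sigma>. f ` \<sigma>) ` A = B"


section \<open>Coxeter complexes\<close>

text \<open>For a Coxeter matrix \<open>m\<close> on the index set \<open>S\<close> (an entry \<open>0\<close> encoding \<open>\<infinity>\<close>, i.e. no relation),
  the Coxeter group is the set of words over \<open>S\<close> modulo the congruence generated by
  \<open>(st)\<^bsup>m s t\<^esup> = 1\<close>.  No formal inverses are needed, as \<open>m s s = 1\<close> makes every generator
  an involution.\<close>

inductive cox_eq :: "'s set \<Rightarrow> ('s \<Rightarrow> 's \<Rightarrow> nat) \<Rightarrow> 's list \<Rightarrow> 's list \<Rightarrow> bool"
  for S :: "'s set" and m :: "'s \<Rightarrow> 's \<Rightarrow> nat" where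
  rel: "s \<in> S \<Longrightarrow> t \<in> S \<Longrightarrow> cox_eq S m (concat (replicate (m s t) [s, t])) []"
| refl: "cox_eq S m u u"
| sym: "cox_eq S m u v \<Longrightarrow> cox_eq S m v u"
| trans: "cox_eq S m u v \<Longrightarrow> cox_eq S m v w \<Longrightarrow> cox_eq S m u w"
| cong: "cox_eq S m u v \<Longrightarrow> cox_eq S m (a @ u @ b) (a @ v @ b)"

text \<open>The coset \<open>w W\<^bsub>S - {s}\<^esub>\<close>, as the set of all words representing one of its elements.\<close>

definition cox_coset :: "'s set \<Rightarrow> ('s \<Rightarrow> 's \<Rightarrow> nat) \<Rightarrow> 's list \<Rightarrow> 's \<Rightarrow> 's list set" where
  "cox_coset S m w s = {u \<in> lists S. \<exists>v \<in> lists (S - {s}). cox_eq S m u (w @ v)}"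

text \<open>The vertices are the cosets \<open>w W\<^bsub>S - {s}\<^esub>\<close>.  The simplex usually written \<open>w W\<^bsub>J\<^esub>\<close>, with
  \<open>J\<close> a proper subset of \<open>S\<close>, has the vertices \<open>w W\<^bsub>S - {s}\<^esub>\<close> for \<open>s \<in> S - J\<close>.\<close>

definition coxeter_complex :: "'s set \<Rightarrow> ('s \<Rightarrow> 's \<Rightarrow> nat) \<Rightarrow> 's list set set set" where
  "coxeter_complex S m = {\<sigma>. \<exists>w \<in> lists S. \<exists>J. J \<subset> S \<and> \<sigma> = cox_coset S m w ` (S - J)}"

text \<open>The Coxeter matrix of affine type \<open>A\<^sub>d\<close> on \<open>{0..d}\<close>: the diagram is a cycle of length
  \<open>d + 1\<close> for \<open>d \<ge> 2\<close>, and for \<open>d = 1\<close> it is a single edge labelled \<open>\<infinity>\<close>.\<close>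

definition affine_A_matrix :: "nat \<Rightarrow> nat \<Rightarrow> nat \<Rightarrow> nat" where
  "affine_A_matrix d i j =
     (if i = j then 1
      else if d = 1 then 0
      else if j = (i + 1) mod (d + 1) \<or> i = (j + 1) mod (d + 1) then 3
      else 2)"


section \<open>Buildings of affine type A\<close>

definition building :: "'w set set \<Rightarrow> 'v set set \<Rightarrow> 'v set set set \<Rightarrow> bool" where
  "building \<Sigma> X \<A> \<longleftrightarrow>
     simplicial_complex X \<and> \<A> \<noteq> {} \<and> X = \<Union>\<A> \<and>
     (\<forall>A\<in>\<A>. simplicial_complex A \<and> (\<exists>f. complex_iso A \<Sigma> f)) \<and>
     (\<forall>\<sigma>\<in>X. \<forall>\<tau>\<in>X. \<exists>A\<in>\<A>. \<sigma> \<in> A \<and> \<tau> \<in> A) \<and>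
     (\<forall>A\<in>\<A>. \<forall>B\<in>\<A>. \<forall>\<sigma>\<in>A \<inter> B. \<forall>\<tau>\<in>A \<inter> B.
        \<exists>f. complex_iso A B f \<and> (\<forall>x\<in>\<sigma> \<union> \<tau>. f x = x))"

definition affine_A_building :: "nat \<Rightarrow> 'v set set \<Rightarrow> 'v set set set \<Rightarrow> bool" where
  "affine_A_building d X \<A> \<longleftrightarrow> building (coxeter_complex {..d} (affine_A_matrix d)) X \<A>"

definition type_labelling :: "nat \<Rightarrow> 'v set set \<Rightarrow> ('v \<Rightarrow> nat) \<Rightarrow> bool" where
  "type_labelling d X lab \<longleftrightarrow> lab ` \<Union>X \<subseteq> {..d} \<and> (\<forall>\<sigma>\<in>X. inj_on lab \<sigma>)"


section \<open>Orientations and pointed simplices\<close>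

text \<open>A cyclic ordering on a finite set is given by all its enumerations compatible with it,
  i.e. by one orbit of enumerations under rotation.\<close>

definition cyclic_ordering :: "'v set \<Rightarrow> 'v list set \<Rightarrow> bool" where
  "cyclic_ordering \<sigma> C \<longleftrightarrow> (\<exists>xs. distinct xs \<and> set xs = \<sigma> \<and> C = {rotate n xs |n. True})"

definition pointed :: "'v set set \<Rightarrow> ('v set \<Rightarrow> 'v list set) \<Rightarrow> nat \<Rightarrow> 'v list \<Rightarrow> bool" where
  "pointed X ori k xs \<longleftrightarrow> set xs \<in> simplices X k \<and> xs \<in> ori (set xs)"

text \<open>\<open>UNIV // diag_rel d\<close> is \<open>\<int>\<^bsup>d+1\<^esup>/\<int>(1,\<dots>,1)\<close>: only the coordinates \<open>0,\<dots>,d\<close> of a function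
  \<open>nat \<Rightarrow> int\<close> matter.\<close>

definition diag_rel :: "nat \<Rightarrow> ((nat \<Rightarrow> int) \<times> (nat \<Rightarrow> int)) set" where
  "diag_rel d = {(a, b). \<exists>c. \<forall>j\<le>d. a j = b j + c}"

definition std_pointed :: "nat \<Rightarrow> nat \<Rightarrow> (nat \<Rightarrow> int) set list \<Rightarrow> bool" where
  "std_pointed d k xs \<longleftrightarrow>
     (\<exists>J. (\<forall>t<k. J t \<noteq> {} \<and> J t \<subset> {..d}) \<and> (\<forall>t. Suc t < k \<longrightarrow> J t \<subset> J (Suc t)) \<and>
          (\<forall>t<k. \<exists>a \<in> xs ! t. \<exists>b \<in> xs ! k. \<forall>j\<le>d. a j - b j = (\<Sum>i\<in>J t. if i = j then 1 else 0)))"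

definition orientation ::
  "nat \<Rightarrow> 'v set set \<Rightarrow> 'v set set set \<Rightarrow> ('v set \<Rightarrow> 'v list set) \<Rightarrow> bool" where
  "orientation d X \<A> ori \<longleftrightarrow>
     (\<forall>\<sigma>\<in>X. cyclic_ordering \<sigma> (ori \<sigma>)) \<and>
     (\<forall>A\<in>\<A>. \<exists>\<phi>. bij_betw \<phi> (\<Union>A) (UNIV // diag_rel d) \<and>
        (\<forall>k xs. set xs \<subseteq> \<Union>A \<and> length xs = k + 1 \<longrightarrow>
           (pointed X ori k xs \<longleftrightarrow> std_pointed d k (map \<phi> xs))))"


section \<open>Stability\<close>

context
  fixes X :: "'v set set" and ori :: "'v set \<Rightarrow> 'v list set"
begin

definition ell :: "'v list \<Rightarrow> nat" where
  "ell xs = (GREATEST r. \<exists>ys. pointed X ori r ys \<and> hd ys = hd xs \<and> last ys = last xs)"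

text \<open>In the following, \<open>\<eta>\<close> is a pointed \<open>(k-1)\<close>-simplex, so that \<open>k = length \<eta>\<close>.\<close>

definition nbrs :: "'v list \<Rightarrow> 'v set" where
  "nbrs \<eta> = {z. pointed X ori (length \<eta>) (z # \<eta>)}"

definition nbr_le :: "'v list \<Rightarrow> 'v \<Rightarrow> 'v \<Rightarrow> bool" where
  "nbr_le \<eta> u1 u2 \<longleftrightarrow> u1 = u2 \<or> pointed X ori (length \<eta> + 1) (u1 # u2 # \<eta>)"

definition lower_nbrs :: "'v list \<Rightarrow> 'v \<Rightarrow> 'v \<Rightarrow> 'v set" where
  "lower_nbrs \<eta> u1 u2 = {u \<in> nbrs \<eta>. nbr_le \<eta> u u1 \<and> nbr_le \<eta> u u2}"

text \<open>The partially defined vertex \<open>[\<eta>|u1,u2]\<close> is rendered as a relation: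
  \<open>is_bracket \<eta> u1 u2 u\<close> says that it is defined and equal to \<open>u\<close>.  By strictness of the
  inequality there is at most one such \<open>u\<close>.\<close>

definition is_bracket :: "'v list \<Rightarrow> 'v \<Rightarrow> 'v \<Rightarrow> 'v \<Rightarrow> bool" where
  "is_bracket \<eta> u1 u2 u \<longleftrightarrow>
     u \<in> lower_nbrs \<eta> u1 u2 \<and>
     (\<forall>w \<in> lower_nbrs \<eta> u1 u2. w \<noteq> u \<longrightarrow> ell (u # \<eta>) < ell (w # \<eta>))"

definition stable :: "'v list \<Rightarrow> 'v set \<Rightarrow> bool" where
  "stable \<eta> M \<longleftrightarrow> M \<subseteq> nbrs \<eta> \<and> (\<forall>u1\<in>M. \<forall>u2\<in>M. \<exists>u\<in>M. is_bracket \<eta> u1 u2 u)"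

end


section \<open>Homological coefficient systems\<close>

text \<open>Abelian groups are those of the HOL-Algebra library, hence written multiplicatively.
  \<open>r \<tau> \<sigma>\<close> is the restriction homomorphism from \<open>V \<tau>\<close> to the group \<open>V \<sigma>\<close> of a face \<open>\<sigma>\<close> of \<open>\<tau>\<close>.\<close>

definition hcs ::
  "'v set set \<Rightarrow> ('v set \<Rightarrow> ('a, 'm) monoid_scheme) \<Rightarrow> ('v set \<Rightarrow> 'v set \<Rightarrow> 'a \<Rightarrow> 'a) \<Rightarrow> bool" where
  "hcs X V r \<longleftrightarrow>
     (\<forall>\<tau>\<in>X. comm_group (V \<tau>)) \<and>
     (\<forall>\<tau>\<in>X. \<forall>\<sigma>\<in>X. \<sigma> \<subseteq> \<tau> \<longrightarrow> r \<tau> \<sigma> \<in> hom (V \<tau>) (V \<sigma>)) \<and>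
     (\<forall>\<sigma>\<in>X. \<forall>\<tau>\<in>X. \<forall>\<rho>\<in>X. \<rho> \<subseteq> \<tau> \<and> \<tau> \<subseteq> \<sigma> \<longrightarrow>
        (\<forall>v \<in> carrier (V \<sigma>). r \<tau> \<rho> (r \<sigma> \<tau> v) = r \<sigma> \<rho> v)) \<and>
     (\<forall>\<tau>\<in>X. \<forall>v \<in> carrier (V \<tau>). r \<tau> \<tau> v = v)"

text \<open>\<open>[\<tau>':\<tau>] = (-1)\<^bsup>i\<^esup>\<close> if \<open>\<tau>\<close> arises from \<open>\<tau>'\<close> by omitting the \<open>i\<close>-th vertex, the vertices of
  \<open>\<tau>'\<close> being numbered from \<open>0\<close> in the order of their labels.\<close>

definition incidence :: "('v \<Rightarrow> nat) \<Rightarrow> 'v set \<Rightarrow> 'v set \<Rightarrow> int" where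
  "incidence lab \<tau>' \<tau> = (-1) ^ card {y \<in> \<tau>'. lab y < lab (the_elem (\<tau>' - \<tau>))}"

context
  fixes X :: "'v set set" and lab :: "'v \<Rightarrow> nat"
    and V :: "'v set \<Rightarrow> ('a, 'm) monoid_scheme" and r :: "'v set \<Rightarrow> 'v set \<Rightarrow> 'a \<Rightarrow> 'a"
begin

text \<open>The component of the boundary operator from chains supported on the set \<open>S\<close> of simplices to
  chains on the set \<open>T\<close> of simplices of one dimension less; it is used for the chain complex itself
  and for its subquotients.  \<open>gfinprod\<close> is the product over the (finite) support.\<close>

definition bd :: "'v set set \<Rightarrow> 'v set set \<Rightarrow> ('v set \<Rightarrow> 'a) \<Rightarrow> ('v set \<Rightarrow> 'a)" where
  "bd S T c = (\<lambda>\<tau>\<in>T. gfinprod (V \<tau>)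
       (\<lambda>\<tau>'. r \<tau>' \<tau> (c \<tau>') [^]\<^bsub>V \<tau>\<^esub> incidence lab \<tau>' \<tau>) {\<tau>' \<in> S. \<tau> \<subseteq> \<tau>'})"

definition chain_grp :: "nat \<Rightarrow> ('v set \<Rightarrow> 'a) monoid" where
  "chain_grp k = sum_group (simplices X k) V"

definition boundary :: "nat \<Rightarrow> ('v set \<Rightarrow> 'a) \<Rightarrow> ('v set \<Rightarrow> 'a)" where
  "boundary k = bd (simplices X (k + 1)) (simplices X k)"

definition cycles :: "nat \<Rightarrow> ('v set \<Rightarrow> 'a) set" where
  "cycles k = (case k of 0 \<Rightarrow> carrier (chain_grp 0)
               | Suc j \<Rightarrow> kernel (chain_grp (Suc j)) (chain_grp j) (boundary j))"

definition homology_grp :: "nat \<Rightarrow> ('v set \<Rightarrow> 'a) set monoid" where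
  "homology_grp k =
     subgroup_generated (chain_grp k) (cycles k) Mod (boundary k ` carrier (chain_grp (k + 1)))"

definition condition_S_star :: "('v set \<Rightarrow> 'v list set) \<Rightarrow> nat \<Rightarrow> bool" where
  "condition_S_star ori k \<longleftrightarrow>
     (\<forall>\<eta> M. pointed X ori (k - 1) \<eta> \<and> stable X ori \<eta> M \<longrightarrow>
        (let S2 = {{z, z'} \<union> set \<eta> |z z'. z \<in> M \<and> z' \<in> M \<and> {z, z'} \<in> simplices X 1};
             S1 = {{z} \<union> set \<eta> |z. z \<in> M};
             S0 = {set \<eta>}
         in bd S2 S1 ` carrier (sum_group S2 V)
              = kernel (sum_group S1 V) (sum_group S0 V) (bd S1 S0)))"

end

end

theory Submission
  imports Defs "HOL-Library.Multiset"
begin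

text \<open>Fix a vertex \<open>b\<close> and let the height of a vertex be its directed distance from \<open>b\<close>, each step
  adding one unit vector. In an apartment with coordinates \<open>m\<close> in which \<open>b\<close> is the origin, the height
  is \<open>\<Sum>\<^sub>j (m\<^sub>j - min m)\<close>. Hence the vertices of a simplex have distinct heights, and listed by
  increasing height they form a pointed simplex. For a pointed simplex \<open>\<eta>\<close> listed in this way, the
  vertices \<open>z\<close> below \<open>\<eta>\<close> such that \<open>{z} \<union> \<eta>\<close> is a simplex form a stable set. In the lattice model
  of the building, with \<open>b = L\<^sub>0\<close> and a lattice growing with its coordinates, these \<open>z\<close> are lattices
  containing \<open>\<pi>\<^sup>-\<^sup>1 L\<^sub>0\<close>, a condition inherited by intersections; in general, retractions onto
  apartments take the place of lattices.

  Given a \<open>k\<close>-cycle, remove from each simplex of its support the lowest vertex and let \<open>\<eta>\<close> be maximal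
  among the resulting faces, comparing heights lexicographically from the top. By maximality the
  cycle condition at \<open>\<eta>\<close> only involves simplices \<open>{z} \<union> \<eta>\<close> with \<open>z\<close> below \<open>\<eta>\<close>. So condition
  \<open>\<S>\<^sup>*(k)\<close> allows us to remove these simplices by subtracting a boundary, and the simplices
  introduced in exchange have smaller faces.\<close>

section \<open>Chambers and panels of the Coxeter complex\<close>

text \<open>The orientation relates coordinates to simplices of \<open>X\<close>, whereas the axiom
  on two apartments speaks of simplices of these apartments. Galleries bridge the gap: an apartment
  contains some chamber, the Coxeter complex supplies a second chamber on each panel, and in
  coordinates only one candidate exists for it; so all coordinate chambers belong to the apartment.
  The isomorphisms of apartments are not assumed to respect the orientation either. Still, agreement
  on one chamber spreads along galleries, which makes retractions well defined and compatible with
  pointed simplices. Height and \<open>ell\<close> are a minimum and a maximum over all of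
  \<open>X\<close>. Retracting the competitors onto one apartment reduces them to counting in
  subsets of {0,...,d}. Since a retraction fixes each vertex that it sends into its centre, no
  competitor shares the image of a candidate in the centre; this gives the strict inequality in the
  bracket. Two neighbours of a simplex need not have a common lower neighbour, so the set of all
  neighbours is not stable in general. This is why a base point enters: the vertex nearest to it
  lies below all lower vertices.\<close>

text \<open>The Coxeter group acts on \<open>\<int>\<close> by affine permutations; the generator \<open>i\<close> exchanges \<open>n\<close> and
  \<open>n + 1\<close> whenever \<open>n \<equiv> i\<close> modulo \<open>d + 1\<close>.\<close>

definition gen_act :: "nat \<Rightarrow> nat \<Rightarrow> int \<Rightarrow> int" where
  "gen_act d i n =
     (if int (d + 1) dvd n - int i then n + 1
      else if int (d + 1) dvd n - int i - 1 then n - 1 else n)"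

definition word_act :: "nat \<Rightarrow> nat list \<Rightarrow> int \<Rightarrow> int" where
  "word_act d w n = foldr (gen_act d) w n"

lemma word_act_append [simp]: "word_act d (u @ v) n = word_act d u (word_act d v n)"
  by (simp add: word_act_def)

lemma word_act_Nil [simp]: "word_act d [] n = n"
  by (simp add: word_act_def)

lemma word_act_Cons [simp]: "word_act d (s # w) n = gen_act d s (word_act d w n)"
  by (simp add: word_act_def)

lemma dvd_diff_small:
  fixes N x c :: int
  assumes "N dvd x" "N dvd x - c" "0 < c" "c < N"
  shows False
proof -
  have "N dvd c" using assms(1,2) by (metis dvd_diff_right_iff)
  then show False using assms(3,4) by (simp add: zdvd_not_zless)
qed

lemma gen_act_involution:
  assumes "1 \<le> d"
  shows "gen_act d i (gen_act d i n) = n"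
proof -
  have "\<not> (int (d + 1) dvd x \<and> int (d + 1) dvd x - 1)" for x
    using dvd_diff_small[of "int (d + 1)" x 1] assms by auto
  moreover have "n + 1 - int i - 1 = n - int i" "n - 1 - int i = n - int i - 1" by simp_all
  ultimately show ?thesis
    unfolding gen_act_def by (smt (verit))
qed

text \<open>On the residues i, i+1, i+2 modulo d+1, pairwise distinct since d \<ge> 2, the two
  generators act as adjacent transpositions, whose product has order 3. Both orders of the product
  occur because a relator may start with either generator.\<close>

lemma gen_act_braid:
  assumes "2 \<le> d" and adj: "int (d + 1) dvd int j - int i - 1"
  shows "gen_act d i (gen_act d j (gen_act d i (gen_act d j (gen_act d i (gen_act d j n))))) = n"
    and "gen_act d j (gen_act d i (gen_act d j (gen_act d i (gen_act d j (gen_act d i n))))) = n"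
proof -
  define N where "N = int (d + 1)"
  define A where "A = (\<lambda>x. N dvd x - int i)"
  define B where "B = (\<lambda>x. N dvd x - int i - 1)"
  define C where "C = (\<lambda>x. N dvd x - int i - 2)"
  have N: "3 \<le> N" using assms(1) by (simp add: N_def)
  have si: "gen_act d i x = (if A x then x + 1 else if B x then x - 1 else x)" for x
    by (simp add: gen_act_def A_def B_def N_def)
  have "N dvd x - int j \<longleftrightarrow> N dvd x - int i - 1" for x
    using dvd_add_left_iff[of N "int j - int i - 1" "x - int j"] adj unfolding N_def
    by (simp add: algebra_simps)
  moreover have "N dvd x - int j - 1 \<longleftrightarrow> N dvd x - int i - 2" for x
    using dvd_add_left_iff[of N "int j - int i - 1" "x - int j - 1"] adj unfolding N_def
    by (simp add: algebra_simps)
  ultimately have sj: "gen_act d j x = (if B x then x + 1 else if C x then x - 1 else x)" for x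
    unfolding gen_act_def B_def C_def N_def by auto
  have sh: "B (x + 1) = A x" "C (x + 1) = B x" "A (x - 1) = B x" "B (x - 1) = C x" for x
    by (simp_all add: A_def B_def C_def algebra_simps)
  have AB: "A x \<Longrightarrow> \<not> B x" for x
    by (rule notI, rule dvd_diff_small[of N "x - int i" 1]) (use N in \<open>simp_all add: A_def B_def\<close>)
  have AC: "A x \<Longrightarrow> \<not> C x" for x
    by (rule notI, rule dvd_diff_small[of N "x - int i" 2]) (use N in \<open>simp_all add: A_def C_def\<close>)
  have BC: "B x \<Longrightarrow> \<not> C x" for x
    by (rule notI, rule dvd_diff_small[of N "x - int i - 1" 1]) (use N in \<open>simp_all add: B_def C_def\<close>)
  have A: "\<not> B n \<and> \<not> C n \<and> B (n + 1) \<and> \<not> A (n + 1) \<and> \<not> C (n + 1) \<and>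
      C (n + 2) \<and> \<not> A (n + 2) \<and> \<not> B (n + 2)" if "A n"
    using that AB AC BC sh(1)[of n] sh(2)[of "n + 1"] by (auto simp: add.commute)
  have B: "\<not> A n \<and> \<not> C n \<and> A (n - 1) \<and> \<not> B (n - 1) \<and> \<not> C (n - 1) \<and>
      C (n + 1) \<and> \<not> A (n + 1) \<and> \<not> B (n + 1)" if "B n"
    using that AB AC BC sh(2)[of n] sh(3)[of n] by auto
  have C: "\<not> A n \<and> \<not> B n \<and> A (n - 2) \<and> \<not> B (n - 2) \<and> \<not> C (n - 2) \<and>
      B (n - 1) \<and> \<not> A (n - 1) \<and> \<not> C (n - 1)" if "C n"
    using that AB AC BC sh(4)[of n] sh(3)[of "n - 1"] by auto
  show "gen_act d i (gen_act d j (gen_act d i (gen_act d j (gen_act d i (gen_act d j n))))) = n"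
    using A B C by (cases "A n"; cases "B n"; cases "C n") (simp_all add: si sj add.commute[of 1 n] add.commute[of 2 n])
  show "gen_act d j (gen_act d i (gen_act d j (gen_act d i (gen_act d j (gen_act d i n))))) = n"
    using A B C by (cases "A n"; cases "B n"; cases "C n") (simp_all add: si sj add.commute[of 1 n] add.commute[of 2 n])
qed

text \<open>Generators that are neither equal nor adjacent on the cycle move disjoint sets of
  integers.\<close>

lemma gen_act_commute:
  assumes "\<not> int (d + 1) dvd int j - int i" "\<not> int (d + 1) dvd int j - int i - 1"
    "\<not> int (d + 1) dvd int i - int j - 1"
  shows "gen_act d i (gen_act d j n) = gen_act d j (gen_act d i n)"
proof -
  define N where "N = int (d + 1)"
  have diff: "N dvd x \<Longrightarrow> N dvd y \<Longrightarrow> N dvd x - y" for x y by simp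
  have a: "\<not> N dvd int j - int i" "\<not> N dvd int j - int i - 1" "\<not> N dvd int i - int j - 1"
    using assms by (simp_all add: N_def)
  have a': "\<not> N dvd int i - int j" using a(1) by (metis dvd_diff_commute)
  have a'': "\<not> N dvd int i - 1 - int j" "\<not> N dvd int j - 1 - int i"
    using a(2,3) by (simp_all add: algebra_simps)
  have e1: "\<not> (N dvd x - int i \<and> N dvd x - int j)" for x
    using diff[of "x - int i" "x - int j"] a a' a'' by auto
  have e2: "\<not> (N dvd x - int i \<and> N dvd x - int j - 1)" for x
    using diff[of "x - int j - 1" "x - int i"] a a' a'' by auto
  have e3: "\<not> (N dvd x - int i - 1 \<and> N dvd x - int j)" for x
    using diff[of "x - int i - 1" "x - int j"] a a' a'' by auto
  have e4: "\<not> (N dvd x - int i - 1 \<and> N dvd x - int j - 1)" for x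
    using diff[of "x - int i - 1" "x - int j - 1"] a a' a'' by auto
  have sh: "n + 1 - x - 1 = n - x" "n - 1 - x = n - x - 1" for x :: int by simp_all
  show ?thesis
    \<comment> \<open>The instances at n+1 and n-1 show that a point just moved by one generator is
      not moved by the other.\<close>
    using e1[of n] e2[of n] e3[of n] e4[of n] e1[of "n+1"] e2[of "n+1"] e3[of "n+1"] e4[of "n+1"]
     e1[of "n-1"] e2[of "n-1"] e3[of "n-1"] e4[of "n-1"] sh
    unfolding gen_act_def N_def[symmetric] by (smt (verit))
qed

lemma dvd_diff_eq_mod:
  assumes "i \<le> d" "j \<le> d"
  shows "int (d + 1) dvd int j - int i - 1 \<longleftrightarrow> j = (i + 1) mod (d + 1)"
proof -
  have "j = (i + 1) mod (d + 1) \<longleftrightarrow> j mod (d + 1) = (i + 1) mod (d + 1)" using assms by simp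
  also have "\<dots> \<longleftrightarrow> int j mod int (d + 1) = int (i + 1) mod int (d + 1)"
    by (metis of_nat_eq_iff of_nat_mod)
  also have "\<dots> \<longleftrightarrow> int (d + 1) dvd int j - int i - 1"
    by (simp add: mod_eq_dvd_iff algebra_simps)
  finally show ?thesis by simp
qed

lemma dvd_diff_eq_self:
  assumes "i \<le> d" "j \<le> d"
  shows "int (d + 1) dvd int j - int i \<longleftrightarrow> j = i"
proof -
  have "int (d + 1) dvd int j - int i \<longleftrightarrow> int j mod int (d + 1) = int i mod int (d + 1)"
    by (simp add: mod_eq_dvd_iff)
  also have "\<dots> \<longleftrightarrow> j = i" using assms by simp
  finally show ?thesis .
qed

lemma word_act_relator:
  assumes "1 \<le> d" "s \<le> d" "t \<le> d"
  shows "word_act d (concat (replicate (affine_A_matrix d s t) [s, t])) n = n"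
proof -
  have r3: "concat (replicate 3 x) = x @ x @ x" and r2: "concat (replicate 2 x) = x @ x"
    for x :: "nat list"
    by (simp_all add: numeral_eq_Suc)
  consider "s = t" | "s \<noteq> t" "d = 1" | "s \<noteq> t" "2 \<le> d" "t = (s + 1) mod (d + 1)"
    | "s \<noteq> t" "2 \<le> d" "s = (t + 1) mod (d + 1)"
    | "s \<noteq> t" "2 \<le> d" "t \<noteq> (s + 1) mod (d + 1)" "s \<noteq> (t + 1) mod (d + 1)"
    using assms(1) by linarith
  then show ?thesis
  proof cases
    case 1
    then show ?thesis by (simp add: affine_A_matrix_def gen_act_involution[OF assms(1)])
  next
    \<comment> \<open>The matrix entry is 0, so the relator is the empty word.\<close>
    case 2
    then show ?thesis by (simp add: affine_A_matrix_def)
  next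
    case 3
    then have "affine_A_matrix d s t = 3" using assms(1) by (auto simp: affine_A_matrix_def)
    moreover have "int (d + 1) dvd int t - int s - 1" using 3 dvd_diff_eq_mod[OF assms(2,3)] by blast
    ultimately show ?thesis using gen_act_braid(1)[OF 3(2)] by (simp only: r3) simp
  next
    case 4
    then have "affine_A_matrix d s t = 3" using assms(1) by (auto simp: affine_A_matrix_def)
    moreover have "int (d + 1) dvd int s - int t - 1" using 4 dvd_diff_eq_mod[OF assms(3,2)] by blast
    ultimately show ?thesis using gen_act_braid(2)[OF 4(2)] by (simp only: r3) simp
  next
    case 5
    then have m: "affine_A_matrix d s t = 2" unfolding affine_A_matrix_def by auto
    have "\<not> int (d + 1) dvd int s - int t" "\<not> int (d + 1) dvd int s - int t - 1"
      "\<not> int (d + 1) dvd int t - int s - 1"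
      using 5 dvd_diff_eq_mod[OF assms(2,3)] dvd_diff_eq_mod[OF assms(3,2)]
        dvd_diff_eq_self[OF assms(3,2)] by blast+
    then have c: "gen_act d t (gen_act d s x) = gen_act d s (gen_act d t x)" for x
      by (rule gen_act_commute)
    show ?thesis using c gen_act_involution[OF assms(1)] by (simp only: m r2) simp
  qed
qed

lemma word_act_cox_eq:
  assumes "1 \<le> d" "cox_eq {..d} (affine_A_matrix d) u v"
  shows "word_act d u n = word_act d v n"
  using assms(2)
proof (induction arbitrary: n rule: cox_eq.induct)
  case (rel s t)
  then show ?case using word_act_relator[OF assms(1)] by simp
qed auto

lemma word_act_inj:
  assumes "1 \<le> d" "word_act d w m = word_act d w n"
  shows "m = n"
  using assms(2)
proof (induction w)
  case (Cons s w)
  then have "gen_act d s (gen_act d s (word_act d w m)) = gen_act d s (gen_act d s (word_act d w n))"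
    by simp
  then show ?case unfolding gen_act_involution[OF assms(1)] by (rule Cons.IH)
qed simp

text \<open>The half-line up to s can be left only through the exchange of s and s+1, which is the
  work of generator s alone. This detects that s lies outside the parabolic subgroup generated by
  the other generators.\<close>

lemma word_act_halfline:
  assumes "s \<le> d" "v \<in> lists ({..d} - {s})" "n \<le> int s"
  shows "word_act d v n \<le> int s"
  using assms(2)
proof (induction v)
  case Nil
  then show ?case using assms by simp
next
  case (Cons t v)
  then have IH: "word_act d v n \<le> int s" and t: "t \<le> d" "t \<noteq> s" by auto
  have "\<not> int (d + 1) dvd int s - int t" using dvd_diff_eq_self[of t d s] assms t by simp
  then have "word_act d v n = int s \<Longrightarrow> gen_act d t (word_act d v n) \<le> int s"
    by (auto simp: gen_act_def)
  moreover have "word_act d v n < int s \<Longrightarrow> gen_act d t (word_act d v n) \<le> int s"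
    by (auto simp: gen_act_def)
  ultimately show ?case using IH by force
qed

lemma generator_not_in_parabolic:
  assumes "1 \<le> d" "s \<le> d" "v \<in> lists ({..d} - {s})"
  shows "\<not> cox_eq {..d} (affine_A_matrix d) w (w @ s # v)"
    and "\<not> cox_eq {..d} (affine_A_matrix d) (w @ [s]) (w @ v)"
proof -
  \<comment> \<open>The witness is the integer s: the generator moves it to s+1, while
    \<open>v\<close> keeps it in the half-line.\<close>
  have no: "\<exists>n. word_act d v n \<noteq> gen_act d s n"
  proof
    have "gen_act d s (int s) = int s + 1" by (simp add: gen_act_def)
    then show "word_act d v (int s) \<noteq> gen_act d s (int s)"
      using word_act_halfline[OF assms(2,3), of "int s"] by simp
  qed
  show "\<not> cox_eq {..d} (affine_A_matrix d) (w @ [s]) (w @ v)"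
  proof
    assume "cox_eq {..d} (affine_A_matrix d) (w @ [s]) (w @ v)"
    from word_act_cox_eq[OF assms(1) this]
    have "word_act d w (gen_act d s n) = word_act d w (word_act d v n)" for n by simp
    then show False using no word_act_inj[OF assms(1)] by metis
  qed
  show "\<not> cox_eq {..d} (affine_A_matrix d) w (w @ s # v)"
  proof
    assume "cox_eq {..d} (affine_A_matrix d) w (w @ s # v)"
    from word_act_cox_eq[OF assms(1) this]
    have "word_act d w n = word_act d w (gen_act d s (word_act d v n))" for n by simp
    then have "n = gen_act d s (word_act d v n)" for n using word_act_inj[OF assms(1)] by blast
    then show False using no gen_act_involution[OF assms(1)] by metis
  qed
qed

section \<open>Cosets of maximal parabolic subgroups and adjacent chambers\<close>

lemma cox_coset_adjacent:
  assumes "s \<in> S" "t \<noteq> s" "m s s = 1" "w \<in> lists S"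
  shows "cox_coset S m (w @ [s]) t = cox_coset S m w t"
proof -
  have ss: "cox_eq S m [s, s] []" using cox_eq.rel[of s S s m] assms by simp
  have 1: "cox_eq S m (w @ v) ((w @ [s]) @ s # v)" for v
    using cox_eq.sym[OF cox_eq.cong[OF ss, of w v]] by simp
  show ?thesis unfolding cox_coset_def
  proof (intro Collect_cong conj_cong refl iffI)
    fix u
    assume "\<exists>v\<in>lists (S - {t}). cox_eq S m u ((w @ [s]) @ v)"
    then obtain v where "v \<in> lists (S - {t})" "cox_eq S m u (w @ (s # v))" by auto
    then show "\<exists>v\<in>lists (S - {t}). cox_eq S m u (w @ v)"
      using assms by (intro bexI[of _ "s # v"]) auto
  next
    fix u
    assume "\<exists>v\<in>lists (S - {t}). cox_eq S m u (w @ v)"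
    then obtain v where "v \<in> lists (S - {t})" "cox_eq S m u (w @ v)" by auto
    then show "\<exists>v\<in>lists (S - {t}). cox_eq S m u ((w @ [s]) @ v)"
      using assms 1[of v] by (intro bexI[of _ "s # v"]) (auto intro: cox_eq.trans)
  qed
qed

context
  fixes d :: nat
  assumes d: "1 \<le> d"
begin

lemma cox_coset_panel_neq:
  assumes "s \<le> d" "w \<in> lists {..d}"
  shows "cox_coset {..d} (affine_A_matrix d) (w @ [s]) s \<noteq> cox_coset {..d} (affine_A_matrix d) w s"
proof -
  have "w \<in> cox_coset {..d} (affine_A_matrix d) w s"
    using assms by (auto simp: cox_coset_def intro!: bexI[of _ "[]"] cox_eq.refl)
  moreover have "w \<notin> cox_coset {..d} (affine_A_matrix d) (w @ [s]) s"
    using generator_not_in_parabolic(1)[OF d assms(1)] by (auto simp: cox_coset_def)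
  ultimately show ?thesis by metis
qed

text \<open>The word \<open>w @ [t]\<close> separates the cosets of types s and t: it lies in the
  first because t differs from s, but not in the second.\<close>

lemma cox_coset_inj:
  assumes "w \<in> lists {..d}"
  shows "inj_on (cox_coset {..d} (affine_A_matrix d) w) {..d}"
proof (rule inj_onI, rule ccontr)
  fix s t assume st: "s \<in> {..d}" "t \<in> {..d}"
    "cox_coset {..d} (affine_A_matrix d) w s = cox_coset {..d} (affine_A_matrix d) w t" "s \<noteq> t"
  have "w @ [t] \<in> cox_coset {..d} (affine_A_matrix d) w s"
    using assms st(1,2,4) by (auto simp: cox_coset_def intro!: bexI[of _ "[t]"] cox_eq.refl)
  moreover have "w @ [t] \<notin> cox_coset {..d} (affine_A_matrix d) w t"
    using generator_not_in_parabolic(2)[OF d, of t] st(2) by (auto simp: cox_coset_def)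
  ultimately show False using st by simp
qed

text \<open>The second chamber is that of \<open>w @ [s]\<close>, with s the type of the omitted
  vertex: multiplication by s changes the coset of type s and no other. That the panel lies in no
  further chamber is left to the coordinates of an apartment.\<close>

lemma coxeter_complex_panel:
  assumes "\<sigma> \<in> coxeter_complex {..d} (affine_A_matrix d)" "card \<sigma> = d + 1" "v \<in> \<sigma>"
  shows "\<exists>\<tau> \<in> coxeter_complex {..d} (affine_A_matrix d). card \<tau> = d + 1 \<and> \<sigma> - {v} \<subseteq> \<tau> \<and> \<tau> \<noteq> \<sigma>"
proof -
  let ?c = "cox_coset {..d} (affine_A_matrix d)"
  obtain w J where w: "w \<in> lists {..d}" "J \<subset> {..d}" "\<sigma> = ?c w ` ({..d} - J)"
    using assms(1) by (auto simp: coxeter_complex_def)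
  have fJ: "finite J" using w(2) finite_subset by blast
  \<comment> \<open>A simplex with d+1 vertices leaves no room for a nonempty J.\<close>
  have "card ({..d} - J) \<ge> d + 1"
    using assms(2) w(3) card_image_le[of "{..d} - J" "?c w"] by simp
  then have "card J = 0" using w(2) card_Diff_subset[OF fJ, of "{..d}"] by simp
  then have "J = {}" using fJ by simp
  then have \<sigma>: "\<sigma> = ?c w ` {..d}" using w by simp
  then obtain s where s: "s \<le> d" "v = ?c w s" using assms(3) by auto
  have ws: "w @ [s] \<in> lists {..d}" using w s by simp
  define \<tau> where "\<tau> = ?c (w @ [s]) ` {..d}"
  have m: "affine_A_matrix d s s = 1" by (simp add: affine_A_matrix_def)
  have adj: "?c (w @ [s]) t = ?c w t" if "t \<noteq> s" for t
    using cox_coset_adjacent[of s "{..d}" t "affine_A_matrix d" w] s that m w by simp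
  have "\<tau> \<in> coxeter_complex {..d} (affine_A_matrix d)"
    unfolding coxeter_complex_def \<tau>_def using ws by (auto intro!: bexI[of _ "w @ [s]"] exI[of _ "{}"])
  moreover have "card \<tau> = d + 1"
    unfolding \<tau>_def using card_image[OF cox_coset_inj[OF ws]] by simp
  moreover have "\<sigma> - {v} \<subseteq> \<tau>"
    unfolding \<sigma> \<tau>_def s(2) using adj by fastforce
  moreover have "\<tau> \<noteq> \<sigma>"
  proof
    assume "\<tau> = \<sigma>"
    then have "?c (w @ [s]) s \<in> ?c w ` {..d}" using s(1) unfolding \<sigma> \<tau>_def by auto
    then obtain t where t: "t \<le> d" "?c (w @ [s]) s = ?c w t" by auto
    \<comment> \<open>The new vertex differs from the old one of its type, and from the remaining
      old ones because these are also vertices of the new chamber, whose vertices are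
      distinct.\<close>
    show False
    proof (cases "t = s")
      case True
      then show False using t cox_coset_panel_neq[OF s(1) w(1)] by simp
    next
      case False
      then have "?c (w @ [s]) s = ?c (w @ [s]) t" using adj t by simp
      then show False using inj_onD[OF cox_coset_inj[OF ws]] s t False by fastforce
    qed
  qed
  ultimately show ?thesis by blast
qed

lemma coxeter_complex_has_chamber:
  "\<exists>\<sigma> \<in> coxeter_complex {..d} (affine_A_matrix d). card \<sigma> = d + 1"
proof
  let ?\<sigma> = "cox_coset {..d} (affine_A_matrix d) [] ` {..d}"
  show "?\<sigma> \<in> coxeter_complex {..d} (affine_A_matrix d)"
    by (auto simp: coxeter_complex_def intro!: bexI[of _ "[]"] exI[of _ "{}"])
  show "card ?\<sigma> = d + 1" using card_image[OF cox_coset_inj[of "[]"]] by simp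
qed

end

section \<open>Flags and galleries in the standard apartment\<close>

definition shift :: "(nat \<Rightarrow> int) \<Rightarrow> nat set \<Rightarrow> nat \<Rightarrow> int" where
  "shift a J = (\<lambda>j. a j + (if j \<in> J then 1 else 0))"

definition flag :: "nat \<Rightarrow> nat set list \<Rightarrow> bool" where
  "flag d Js \<longleftrightarrow> sorted_wrt (\<subset>) Js \<and> (\<forall>J\<in>set Js. J \<noteq> {} \<and> J \<subset> {..d})"

definition enumerates :: "nat \<Rightarrow> nat list \<Rightarrow> bool" where
  "enumerates d p \<longleftrightarrow> distinct p \<and> set p = {..d}"

text \<open>The empty and the full prefix are left out: both would give the base vertex itself,
  since the full set shifts by the diagonal.\<close>

definition prefixes :: "nat list \<Rightarrow> nat set list" where
  "prefixes p = map (\<lambda>i. set (take i p)) [1..<length p]"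

lemma shift_empty [simp]: "shift a {} = a"
  by (simp add: shift_def)

lemma diag_rel_refl [simp]: "(a, a) \<in> diag_rel d"
  by (auto simp: diag_rel_def intro: exI[of _ 0])

lemma equiv_diag_rel: "equiv UNIV (diag_rel d)"
proof (rule equivI)
  show "refl (diag_rel d)" by (auto intro: refl_onI)
  show "sym (diag_rel d)"
  proof (rule symI)
    fix a b assume "(a, b) \<in> diag_rel d"
    then obtain c where "\<forall>j\<le>d. a j = b j + c" by (auto simp: diag_rel_def)
    then have "\<forall>j\<le>d. b j = a j + - c" by simp
    then show "(b, a) \<in> diag_rel d" unfolding diag_rel_def by blast
  qed
  show "trans (diag_rel d)"
  proof (rule transI)
    fix a b e assume "(a, b) \<in> diag_rel d" "(b, e) \<in> diag_rel d"
    then obtain c c' where "\<forall>j\<le>d. a j = b j + c" "\<forall>j\<le>d. b j = e j + c'"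
      unfolding diag_rel_def by blast
    then have "\<forall>j\<le>d. a j = e j + (c' + c)" by simp
    then show "(a, e) \<in> diag_rel d" unfolding diag_rel_def by blast
  qed
qed simp

lemma shift_diag_cong: "(a, b) \<in> diag_rel d \<Longrightarrow> (shift a J, shift b J) \<in> diag_rel d"
  by (fastforce simp: diag_rel_def shift_def)

text \<open>A coordinate outside J and one outside K bound the diagonal constant from both sides, so
  it vanishes.\<close>

lemma shift_diag_inj:
  assumes "(shift a J, shift a K) \<in> diag_rel d" "J \<subset> {..d}" "K \<subset> {..d}"
  shows "J = K"
proof -
  obtain c where "\<forall>j\<le>d. shift a J j = shift a K j + c"
    using assms(1) unfolding diag_rel_def by blast
  then have c: "(if j \<in> J then 1 else 0) = (if j \<in> K then 1 else 0) + c" if "j \<le> d" for j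
    using that by (simp add: shift_def)
  obtain i k where ik: "i \<le> d" "i \<notin> J" "k \<le> d" "k \<notin> K" using assms(2,3) by auto
  have "c = 0" using c[OF ik(1)] c[OF ik(3)] ik by (auto split: if_splits)
  then have "j \<in> J \<longleftrightarrow> j \<in> K" if "j \<le> d" for j using c[OF that] by (auto split: if_splits)
  then show ?thesis using assms(2,3) by auto
qed

abbreviation walk :: "(nat \<Rightarrow> int) \<Rightarrow> nat list \<Rightarrow> nat \<Rightarrow> nat \<Rightarrow> int" where
  "walk a p i \<equiv> shift a (set (take i p))"

lemma length_enumerates: "enumerates d p \<Longrightarrow> length p = d + 1"
  by (metis enumerates_def distinct_card card_atMost Suc_eq_plus1)

lemma length_prefixes [simp]: "length (prefixes p) = length p - 1"
  by (simp add: prefixes_def)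

lemma nth_prefixes [simp]: "i < length p - 1 \<Longrightarrow> prefixes p ! i = set (take (Suc i) p)"
  by (simp add: prefixes_def)

lemma card_set_take: "distinct p \<Longrightarrow> i \<le> length p \<Longrightarrow> card (set (take i p)) = i"
  by (simp add: distinct_card)

lemma set_take_psubset:
  assumes "distinct p" "i < j" "j \<le> length p"
  shows "set (take i p) \<subset> set (take j p)"
proof
  show "set (take i p) \<subseteq> set (take j p)" using assms(2) by (simp add: set_take_subset_set_take)
  show "set (take i p) \<noteq> set (take j p)"
    using card_set_take[of p i] card_set_take[of p j] assms by auto
qed

lemma set_take_proper: "enumerates d p \<Longrightarrow> i \<le> d \<Longrightarrow> set (take i p) \<subset> {..d}"
  using set_take_psubset[of p i "length p"] length_enumerates[of d p]
  by (simp add: enumerates_def)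

lemma card_set_take_enum: "enumerates d p \<Longrightarrow> i \<le> d \<Longrightarrow> card (set (take i p)) = i"
  using card_set_take[of p i] length_enumerates[of d p] by (simp add: enumerates_def)

lemma flag_prefixes:
  assumes "enumerates d p"
  shows "flag d (prefixes p)"
proof -
  have p: "distinct p" "set p = {..d}" "length p = d + 1"
    using assms length_enumerates by (auto simp: enumerates_def)
  have "sorted_wrt (\<subset>) (prefixes p)"
    unfolding sorted_wrt_iff_nth_less using set_take_psubset[OF p(1)] by simp
  moreover have "J \<noteq> {} \<and> J \<subset> {..d}" if J: "J \<in> set (prefixes p)" for J
  proof -
    obtain i where i: "1 \<le> i" "i < length p" "J = set (take i p)"
      using J unfolding prefixes_def by fastforce
    then show ?thesis
      using set_take_psubset[OF p(1), of 0 i] set_take_psubset[OF p(1), of i "length p"] p by auto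
  qed
  ultimately show ?thesis by (simp add: flag_def)
qed

lemma chain_refine:
  assumes "finite T" "sorted_wrt (\<subset>) Js" "\<forall>J\<in>set Js. J \<subseteq> T"
  shows "\<exists>p. distinct p \<and> set p = T \<and> (\<forall>J\<in>set Js. \<exists>i. J = set (take i p))"
  using assms
proof (induction Js arbitrary: T rule: rev_induct)
  case Nil
  then show ?case using finite_distinct_list by auto
next
  case (snoc K Js)
  have K: "finite K" "K \<subseteq> T" using snoc.prems finite_subset by auto
  have "\<exists>p. distinct p \<and> set p = K \<and> (\<forall>J\<in>set Js. \<exists>i. J = set (take i p))"
    using snoc.prems K by (intro snoc.IH) (auto simp: sorted_wrt_append)
  then obtain p where p: "distinct p" "set p = K" "\<forall>J\<in>set Js. \<exists>i. J = set (take i p)" by blast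
  obtain q where q: "distinct q" "set q = T - K"
    using finite_distinct_list[of "T - K"] snoc.prems(1) by auto
  have "\<exists>i. J = set (take i (p @ q))" if "J \<in> set (Js @ [K])" for J
  proof (cases "J = K")
    case True
    then show ?thesis using p by (intro exI[of _ "length p"]) simp
  next
    case False
    then have "J \<in> set Js" using that by simp
    then obtain i where "J = set (take i p)" using p(3) by blast
    \<comment> \<open>The cutoff keeps the prefix inside \<open>p\<close>, as \<open>take\<close>
      would otherwise run on into \<open>q\<close>.\<close>
    then show ?thesis by (intro exI[of _ "min i (length p)"]) (auto simp: min_def)
  qed
  then show ?case using p q K by (intro exI[of _ "p @ q"]) auto
qed

lemma flag_refine:
  assumes "flag d Js"
  shows "\<exists>p. enumerates d p \<and> (\<forall>J\<in>set Js. J = set (take (card J) p))"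
proof -
  obtain p where p: "distinct p" "set p = {..d}" "\<forall>J\<in>set Js. \<exists>i. J = set (take i p)"
    using chain_refine[of "{..d}" Js] assms by (auto simp: flag_def)
  have "J = set (take (card J) p)" if J: "J = set (take i p)" for J i
  proof (cases "i \<le> length p")
    case True
    then show ?thesis using J card_set_take[OF p(1)] by simp
  next
    case False
    then show ?thesis using J p(1) by (simp add: distinct_card)
  qed
  then have "\<forall>J\<in>set Js. J = set (take (card J) p)" using p(3) by metis
  then show ?thesis using p(1,2) unfolding enumerates_def by blast
qed

lemma flag_finite: "flag d Js \<Longrightarrow> J \<in> set Js \<Longrightarrow> finite J"
  by (meson finite_atMost finite_subset flag_def psubset_imp_subset)

lemma flag_card_bounds: "flag d Js \<Longrightarrow> J \<in> set Js \<Longrightarrow> 1 \<le> card J \<and> card J \<le> d"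
proof -
  assume a: "flag d Js" "J \<in> set Js"
  then have "card J < card {..d}" by (intro psubset_card_mono) (auto simp: flag_def)
  moreover have "card J \<noteq> 0" using a flag_finite[OF a] by (auto simp: flag_def)
  ultimately show ?thesis by simp
qed

lemma set_prefixes: "set (prefixes p) = (\<lambda>i. set (take i p)) ` {1..<length p}"
  by (simp add: prefixes_def)

lemma flag_subset_prefixes:
  assumes "flag d Js" "enumerates d p" "\<forall>J\<in>set Js. J = set (take (card J) p)"
  shows "set Js \<subseteq> set (prefixes p)"
proof
  fix J assume J: "J \<in> set Js"
  then have "card J \<in> {1..<length p}"
    using flag_card_bounds[OF assms(1) J] length_enumerates[OF assms(2)] by simp
  then show "J \<in> set (prefixes p)" using assms(3) J unfolding set_prefixes by blast
qed

lemma flag_distinct: "flag d Js \<Longrightarrow> distinct Js"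
  unfolding flag_def by (metis (mono_tags) psubset_eq distinct_conv_nth linorder_neqE_nat sorted_wrt_nth_less)

lemma sorted_wrt_unique:
  assumes "\<And>x y. R x y \<Longrightarrow> \<not> R y x" "sorted_wrt R xs" "sorted_wrt R ys" "set xs = set ys"
  shows "xs = ys"
  using assms(2-4)
proof (induction xs arbitrary: ys)
  case (Cons x xs)
  then obtain y ys' where y: "ys = y # ys'" by (cases ys) auto
  have "x = y"
  proof (rule ccontr)
    assume "x \<noteq> y"
    then have "x \<in> set ys'" "y \<in> set xs" using Cons.prems(3) y by auto
    then show False using Cons.prems(1,2) y assms(1)[of x y] by auto
  qed
  moreover have "x \<notin> set xs" "y \<notin> set ys'" using Cons.prems(1,2) y assms(1) by auto
  ultimately have "set xs = set ys'" using Cons.prems(3) y by auto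
  then show ?case using Cons y \<open>x = y\<close> by simp
qed simp

text \<open>The d sets of the flag lie among the d prefixes of a refining enumeration and therefore
  exhaust them.\<close>

lemma full_flag:
  assumes "flag d Js" "length Js = d"
  shows "\<exists>p. enumerates d p \<and> Js = prefixes p"
proof -
  obtain p where p: "enumerates d p" "\<forall>J\<in>set Js. J = set (take (card J) p)"
    using flag_refine[OF assms(1)] by blast
  have "set Js \<subseteq> set (prefixes p)" using flag_subset_prefixes[OF assms(1) p] .
  moreover have "card (set (prefixes p)) \<le> card (set Js)"
    using card_length[of "prefixes p"] length_enumerates[OF p(1)] distinct_card[OF flag_distinct[OF assms(1)]]
      assms(2) by simp
  ultimately have "set Js = set (prefixes p)" by (simp add: card_seteq)
  then have "Js = prefixes p"
    using sorted_wrt_unique[of "(\<subset>)" Js "prefixes p"] assms(1) flag_prefixes[OF p(1)]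
    by (auto simp: flag_def)
  then show ?thesis using p(1) by blast
qed

lemma flag_extend:
  assumes "flag d Js"
  shows "\<exists>p. enumerates d p \<and> set Js \<subseteq> set (prefixes p)"
  using flag_refine[OF assms] flag_subset_prefixes[OF assms] by blast

section \<open>Induction along galleries\<close>

lemma adjacent_swap_induct:
  assumes swap: "\<And>xs i j ys. P (xs @ i # j # ys) \<Longrightarrow> P (xs @ j # i # ys)"
    and "mset p = mset q" "P p"
  shows "P q"
proof -
  \<comment> \<open>Repeated swaps carry x to the front of a segment, as in insertion sort;
    \<open>zs\<close> holds the entries already in place.\<close>
  have move: "P (zs @ p1 @ x # p2) \<Longrightarrow> P (zs @ x # p1 @ p2)" for zs p1 x p2
  proof (induction p1 arbitrary: p2 rule: rev_induct)
    case (snoc y p1)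
    have "P ((zs @ p1) @ y # x # p2)" using snoc.prems by simp
    from swap[OF this] have "P (zs @ p1 @ x # y # p2)" by simp
    from snoc.IH[OF this] show ?case by simp
  qed simp
  have "P (zs @ p) \<Longrightarrow> mset p = mset q \<Longrightarrow> P (zs @ q)" for zs
  proof (induction q arbitrary: p zs)
    case (Cons x q)
    then have "x \<in> set p" by (metis list.set_intros(1) mset_eq_setD)
    then obtain p1 p2 where p: "p = p1 @ x # p2" by (meson split_list)
    then have "P ((zs @ [x]) @ (p1 @ p2))" using move[of zs p1 x p2] Cons.prems(1) by simp
    moreover have "mset (p1 @ p2) = mset q" using Cons.prems(2) p by simp
    ultimately have "P ((zs @ [x]) @ q)" by (rule Cons.IH)
    then show ?case by simp
  qed simp
  from this[of "[]"] show ?thesis using assms by simp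
qed

text \<open>\<open>R\<close> carries the number of unit steps, so that the same induction yields
  directed paths of a prescribed length.\<close>

lemma shift_induct_count:
  assumes start: "\<And>b. \<forall>j\<le>d. b j = a j \<Longrightarrow> R 0 b"
    and step: "\<And>n b j. R n b \<Longrightarrow> j \<le> d \<Longrightarrow> R (Suc n) (shift b {j})"
    and "\<forall>j\<le>d. a j \<le> b j" "(\<Sum>j\<le>d. b j - a j) = int n"
  shows "R n b"
  using assms(3,4)
proof (induction n arbitrary: b)
  case 0
  moreover have "(\<Sum>j\<le>d. b j - a j) = 0 \<longleftrightarrow> (\<forall>j\<in>{..d}. b j - a j = 0)"
    using 0 by (intro sum_nonneg_eq_0_iff) auto
  ultimately show ?case by (intro start) auto
next
  case (Suc n)
  have "\<exists>j\<le>d. a j < b j"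
  proof (rule ccontr)
    assume "\<not> ?thesis"
    then have "(\<Sum>j\<le>d. b j - a j) \<le> 0" by (intro sum_nonpos) auto
    then show False using Suc.prems by simp
  qed
  then obtain j where j: "j \<le> d" "a j < b j" by blast
  define b' where "b' = b(j := b j - 1)"
  have "shift b' {j} = b" by (auto simp: shift_def b'_def)
  moreover have "R n b'"
  proof (rule Suc.IH)
    show "\<forall>j\<le>d. a j \<le> b' j" using Suc.prems j by (auto simp: b'_def)
    have "(\<Sum>i\<le>d. b' i - a i) = (\<Sum>i\<le>d. (b i - a i) - (if i = j then 1 else 0))"
      by (intro sum.cong) (auto simp: b'_def)
    also have "\<dots> = (\<Sum>i\<le>d. b i - a i) - 1" using j by (simp add: sum_subtractf)
    finally show "(\<Sum>i\<le>d. b' i - a i) = int n" using Suc.prems by simp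
  qed
  ultimately show ?case using step[of n b' j] j by simp
qed

lemma shift_induct:
  assumes "R a" and step: "\<And>a j. R a \<Longrightarrow> j \<le> d \<Longrightarrow> R (shift a {j})"
    and diag: "\<And>a b. R a \<Longrightarrow> (a, b) \<in> diag_rel d \<Longrightarrow> R b"
  shows "R b"
proof -
  have *: "R b" if "\<forall>j\<le>d. a j \<le> b j" "(\<Sum>j\<le>d. b j - a j) = int n" for b n
  proof (rule shift_induct_count[where R = "\<lambda>_. R", OF _ step that])
    show "R b" if "\<forall>j\<le>d. b j = a j" for b
      by (rule diag[OF assms(1)]) (use that in \<open>auto simp: diag_rel_def intro: exI[of _ 0]\<close>)
  qed
  \<comment> \<open>Unit steps only increase coordinates, so the target is first moved along the
    diagonal until it lies above \<open>a\<close>; this amount suffices in every coordinate.\<close>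
  define c where "c = (\<Sum>j\<le>d. \<bar>a j - b j\<bar>)"
  have c: "a j - b j \<le> c" if "j \<le> d" for j
  proof -
    have "\<bar>a j - b j\<bar> \<le> c" unfolding c_def using that by (intro member_le_sum) auto
    then show ?thesis by simp
  qed
  define b' where "b' = (\<lambda>j. b j + c)"
  have "\<forall>j\<le>d. a j \<le> b' j" using c by (auto simp: b'_def algebra_simps)
  moreover from this have "(\<Sum>j\<le>d. b' j - a j) \<ge> 0" by (intro sum_nonneg) auto
  ultimately have "R b'" using *[of b' "nat (\<Sum>j\<le>d. b' j - a j)"] by simp
  moreover have "(b', b) \<in> diag_rel d" by (auto simp: diag_rel_def b'_def)
  ultimately show ?thesis using diag by blast
qed

text \<open>A pair of \<open>a\<close> and \<open>p\<close> stands for the chamber with vertices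
  \<open>walk a p i\<close>. A swap crosses the panel opposite a vertex other than the base vertex
  \<open>a\<close>, a rotation renames the same chamber with its next vertex as base, and
  \<open>diag\<close> changes the representative. All pairs are connected because a rotation after
  suitable swaps moves the base by any unit vector.\<close>

lemma gallery_induct:
  assumes base: "enumerates d p0" "Q a0 p0"
    and swap: "\<And>a xs i j ys. enumerates d (xs @ i # j # ys) \<Longrightarrow> Q a (xs @ i # j # ys)
      \<Longrightarrow> Q a (xs @ j # i # ys)"
    and rot: "\<And>a x ys. enumerates d (x # ys) \<Longrightarrow> Q a (x # ys) \<Longrightarrow> Q (shift a {x}) (ys @ [x])"
    and diag: "\<And>a b p. enumerates d p \<Longrightarrow> Q a p \<Longrightarrow> (a, b) \<in> diag_rel d \<Longrightarrow> Q b p"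
    and p: "enumerates d p"
  shows "Q a p"
proof -
  have all: "Q a q" if "enumerates d p" "Q a p" "enumerates d q" for a p q
  proof -
    have "enumerates d q \<and> Q a q"
    proof (rule adjacent_swap_induct[where P = "\<lambda>p. enumerates d p \<and> Q a p"])
      show "mset p = mset q"
        using that set_eq_iff_mset_eq_distinct[of p q] by (simp add: enumerates_def)
      show "enumerates d p \<and> Q a p" using that by simp
      show "enumerates d (xs @ j # i # ys) \<and> Q a (xs @ j # i # ys)"
        if "enumerates d (xs @ i # j # ys) \<and> Q a (xs @ i # j # ys)" for xs i j ys
        using that swap by (auto simp: enumerates_def)
    qed
    then show ?thesis ..
  qed
  have "\<forall>q. enumerates d q \<longrightarrow> Q a q"
  proof (rule shift_induct[where d = d and a = a0])
    show "\<forall>q. enumerates d q \<longrightarrow> Q a0 q" using all base by blast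
    show "\<forall>q. enumerates d q \<longrightarrow> Q b q"
      if "\<forall>q. enumerates d q \<longrightarrow> Q a q" "(a, b) \<in> diag_rel d" for a b
      using that diag by blast
    show "\<forall>q. enumerates d q \<longrightarrow> Q (shift a {j}) q"
      if "\<forall>q. enumerates d q \<longrightarrow> Q a q" "j \<le> d" for a j
    proof -
      obtain ys where ys: "distinct ys" "set ys = {..d} - {j}"
        using finite_distinct_list[of "{..d} - {j}"] by auto
      have e: "enumerates d (j # ys)" "enumerates d (ys @ [j])"
        using ys that(2) by (auto simp: enumerates_def)
      then have "Q (shift a {j}) (ys @ [j])" using rot that(1) by blast
      then show ?thesis using all e(2) by blast
    qed
  qed
  then show ?thesis using p by blast
qed

section \<open>Charts of apartments and retractions\<close>

locale oriented_building =
  fixes d :: nat and X :: "'v set set" and \<A> :: "'v set set set" and ori :: "'v set \<Rightarrow> 'v list set"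
  assumes d_pos: "1 \<le> d"
    and bld: "affine_A_building d X \<A>"
    and orient: "orientation d X \<A> ori"
begin

section \<open>Pointed simplices as rotations of one enumeration, and charts\<close>

lemma simplicial: "simplicial_complex X"
  using bld unfolding affine_A_building_def building_def by blast

lemma simplex_finite: "\<sigma> \<in> X \<Longrightarrow> finite \<sigma>"
  and simplex_nonempty: "\<sigma> \<in> X \<Longrightarrow> \<sigma> \<noteq> {}"
  and simplex_face: "\<sigma> \<in> X \<Longrightarrow> \<rho> \<subseteq> \<sigma> \<Longrightarrow> \<rho> \<noteq> {} \<Longrightarrow> \<rho> \<in> X"
  using simplicial unfolding simplicial_complex_def by blast+

lemma pointed_orbit:
  assumes "\<sigma> \<in> X"
  obtains zs where "distinct zs" "set zs = \<sigma>" "ori \<sigma> = {rotate n zs |n. True}"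
  using assms orient unfolding orientation_def cyclic_ordering_def by metis

lemma pointedD:
  assumes "pointed X ori k xs"
  shows "set xs \<in> X" "distinct xs" "length xs = k + 1"
proof -
  show X: "set xs \<in> X" using assms by (simp add: pointed_def simplices_def)
  obtain zs where zs: "distinct zs" "set zs = set xs" "ori (set xs) = {rotate n zs |n. True}"
    using pointed_orbit[OF X] by blast
  then obtain n where "xs = rotate n zs" using assms by (auto simp: pointed_def)
  then show "distinct xs" using zs by simp
  then show "length xs = k + 1" using assms distinct_card[of xs] by (simp add: pointed_def simplices_def)
qed

lemma pointed_unique:
  assumes "pointed X ori k xs" "pointed X ori l ys" "set xs = set ys" "hd xs = hd ys"
  shows "xs = ys"
proof -
  have X: "set xs \<in> X" using pointedD[OF assms(1)] by simp
  obtain zs where zs: "distinct zs" "set zs = set xs" "ori (set xs) = {rotate n zs |n. True}"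
    using pointed_orbit[OF X] by blast
  obtain n m where nm: "xs = rotate n zs" "ys = rotate m zs"
    using assms zs by (auto simp: pointed_def)
  have ne: "zs \<noteq> []" using zs simplex_nonempty[OF X] by auto
  have "zs ! (n mod length zs) = zs ! (m mod length zs)"
    using assms(4) nm ne by (simp add: hd_rotate_conv_nth)
  then have "n mod length zs = m mod length zs"
    using zs(1) ne by (simp add: nth_eq_iff_index_eq)
  then show ?thesis using nm by (metis rotate_conv_mod)
qed

lemma pointed_ending:
  assumes "\<sigma> \<in> X" "x \<in> \<sigma>"
  obtains ys where "pointed X ori (length ys) (ys @ [x])" "set (ys @ [x]) = \<sigma>"
proof -
  obtain zs where zs: "distinct zs" "set zs = \<sigma>" "ori \<sigma> = {rotate n zs |n. True}"
    using pointed_orbit[OF assms(1)] by blast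
  obtain us vs where uv: "zs = us @ x # vs" using assms(2) zs(2) by (meson split_list)
  have "rotate (length (us @ [x])) ((us @ [x]) @ vs) = vs @ us @ [x]"
    unfolding rotate_append by simp
  then have "(vs @ us) @ [x] = rotate (length (us @ [x])) zs" using uv by simp
  then have "(vs @ us) @ [x] \<in> ori \<sigma>" unfolding zs(3) by blast
  moreover have s: "set ((vs @ us) @ [x]) = \<sigma>" using zs uv by auto
  moreover have "card \<sigma> = length (vs @ us) + 1" using distinct_card[OF zs(1)] zs(2) uv by simp
  ultimately have "pointed X ori (length (vs @ us)) ((vs @ us) @ [x])"
    unfolding pointed_def simplices_def using assms by simp
  then show thesis using s that by blast
qed

abbreviation verts :: "((nat \<Rightarrow> int) \<Rightarrow> 'v) \<Rightarrow> (nat \<Rightarrow> int) \<Rightarrow> nat set list \<Rightarrow> 'v list" where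
  "verts \<psi> a Js \<equiv> map (\<lambda>J. \<psi> (shift a J)) Js"

text \<open>A chart is the inverse of the identification supplied by the orientation, extended to
  all representatives. Pointed simplices are described relative to their last vertex, as are the
  differences of vertices in the orientation.\<close>

definition chart :: "((nat \<Rightarrow> int) \<Rightarrow> 'v) \<Rightarrow> bool" where
  "chart \<psi> \<longleftrightarrow> (\<forall>a b. \<psi> a = \<psi> b \<longleftrightarrow> (a, b) \<in> diag_rel d) \<and>
     (\<forall>a ys. set ys \<subseteq> range \<psi> \<longrightarrow>
        (pointed X ori (length ys) (ys @ [\<psi> a]) \<longleftrightarrow>
         (\<exists>Js. flag d Js \<and> ys = verts \<psi> a Js)))"

definition apt_chart :: "((nat \<Rightarrow> int) \<Rightarrow> 'v) \<Rightarrow> bool" where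
  "apt_chart \<psi> \<longleftrightarrow> chart \<psi> \<and> (\<exists>A\<in>\<A>. range \<psi> = \<Union>A)"

text \<open>\<open>std_pointed\<close> admits arbitrary representatives of the two classes. The one
  of the last vertex differs from \<open>a\<close> by a diagonal vector only, so the whole flag can
  be read off at \<open>a\<close>.\<close>

lemma std_pointed_iff:
  assumes inj: "inj_on \<phi> B" and ys: "set ys \<subseteq> B" and q: "\<phi> ` B = UNIV // diag_rel d"
    and \<psi>: "\<And>a. \<psi> a = inv_into B \<phi> (diag_rel d `` {a})"
  shows "std_pointed d (length ys) (map \<phi> (ys @ [\<psi> a])) \<longleftrightarrow>
         (\<exists>Js. flag d Js \<and> ys = verts \<psi> a Js)"
proof -
  have \<phi>\<psi>: "\<phi> (\<psi> b) = diag_rel d `` {b}" for b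
    unfolding \<psi> by (rule f_inv_into_f) (auto simp: q quotientI)
  have sum: "(\<Sum>i\<in>J. if i = j then 1 else 0) = (if j \<in> J then 1 else (0 :: int))"
    if "J \<subset> {..d}" for J :: "nat set" and j
  proof -
    have "finite J" using that finite_subset by blast
    then show ?thesis by (simp add: sum.delta)
  qed
  show ?thesis
  proof
    assume "std_pointed d (length ys) (map \<phi> (ys @ [\<psi> a]))"
    then obtain J where J: "\<forall>t<length ys. J t \<noteq> {} \<and> J t \<subset> {..d}"
      "\<forall>t. Suc t < length ys \<longrightarrow> J t \<subset> J (Suc t)"
      "\<forall>t<length ys. \<exists>x\<in>map \<phi> (ys @ [\<psi> a]) ! t. \<exists>b\<in>map \<phi> (ys @ [\<psi> a]) ! length ys.
         \<forall>j\<le>d. x j - b j = (\<Sum>i\<in>J t. if i = j then 1 else 0)"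
      unfolding std_pointed_def by blast
    define Js where "Js = map J [0..<length ys]"
    have "flag d Js"
      unfolding flag_def
    proof
      show "sorted_wrt (\<subset>) Js"
        using J(2) by (subst sorted_wrt_iff_nth_Suc_transp) (auto simp: Js_def transp_def)
      show "\<forall>J\<in>set Js. J \<noteq> {} \<and> J \<subset> {..d}" using J(1) by (auto simp: Js_def)
    qed
    moreover have "ys = verts \<psi> a Js"
    proof (rule nth_equalityI)
      show "length ys = length (verts \<psi> a Js)" by (simp add: Js_def)
      fix t assume t: "t < length ys"
      then obtain x b where xb: "x \<in> \<phi> (ys ! t)" "b \<in> \<phi> (\<psi> a)"
        "\<forall>j\<le>d. x j - b j = (\<Sum>i\<in>J t. if i = j then 1 else 0)"
        using J(3)[rule_format, OF t] by (auto simp: nth_append)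
      have J': "J t \<subset> {..d}" using J(1) t by blast
      have "(a, b) \<in> diag_rel d" using xb(2) by (simp add: \<phi>\<psi>)
      then have "(shift a (J t), shift b (J t)) \<in> diag_rel d" by (rule shift_diag_cong)
      moreover have "(shift b (J t), x) \<in> diag_rel d"
        using xb(3) sum[OF J'] by (auto simp: diag_rel_def shift_def algebra_simps intro!: exI[of _ 0])
      ultimately have ax: "(shift a (J t), x) \<in> diag_rel d"
        by (meson equiv_diag_rel equivE transD)
      have yB: "ys ! t \<in> B" using ys t nth_mem by blast
      then have "\<phi> (ys ! t) \<in> UNIV // diag_rel d" using q by blast
      then have "\<phi> (ys ! t) = diag_rel d `` {x}"
        by (metis UNIV_I Image_singleton_iff equiv_class_eq equiv_diag_rel quotientE xb(1))
      also have "\<dots> = diag_rel d `` {shift a (J t)}"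
        using ax equiv_class_eq[OF equiv_diag_rel] by metis
      finally have "\<phi> (ys ! t) = \<phi> (\<psi> (shift a (J t)))" using \<phi>\<psi> by simp
      moreover have "\<psi> (shift a (J t)) \<in> B"
        unfolding \<psi> by (rule inv_into_into) (simp add: q quotientI)
      ultimately have "ys ! t = \<psi> (shift a (J t))" using inj yB by (meson inj_onD)
      then show "ys ! t = verts \<psi> a Js ! t" using t by (simp add: Js_def)
    qed
    ultimately show "\<exists>Js. flag d Js \<and> ys = verts \<psi> a Js" by blast
  next
    assume "\<exists>Js. flag d Js \<and> ys = verts \<psi> a Js"
    then obtain Js where Js: "flag d Js" "ys = verts \<psi> a Js" by blast
    have len: "length ys = length Js" using Js by simp
    have mem: "b \<in> \<phi> (\<psi> b)" for b by (simp add: \<phi>\<psi>)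
    show "std_pointed d (length ys) (map \<phi> (ys @ [\<psi> a]))"
      unfolding std_pointed_def
    proof (intro exI[of _ "\<lambda>t. Js ! t"] conjI allI impI)
      fix t assume t: "t < length ys"
      have J: "Js ! t \<noteq> {} \<and> Js ! t \<subset> {..d}" using Js(1) t len by (auto simp: flag_def)
      then show "Js ! t \<noteq> {}" "Js ! t \<subset> {..d}" by auto
      show "\<exists>x\<in>map \<phi> (ys @ [\<psi> a]) ! t. \<exists>b\<in>map \<phi> (ys @ [\<psi> a]) ! length ys.
        \<forall>j\<le>d. x j - b j = (\<Sum>i\<in>Js ! t. if i = j then 1 else 0)"
        using t len mem[of a] mem[of "shift a (Js ! t)"] J
        by (intro bexI[of _ "shift a (Js ! t)"] bexI[of _ a])
          (auto simp: nth_append Js(2) shift_def sum)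
    next
      fix t assume "Suc t < length ys"
      then show "Js ! t \<subset> Js ! Suc t"
        using Js(1) len unfolding flag_def by (simp add: sorted_wrt_nth_less)
    qed
  qed
qed

lemma apt_chart_exists:
  assumes "A \<in> \<A>"
  shows "\<exists>\<psi>. chart \<psi> \<and> range \<psi> = \<Union>A"
proof -
  obtain \<phi> where \<phi>: "bij_betw \<phi> (\<Union>A) (UNIV // diag_rel d)"
    "\<forall>k xs. set xs \<subseteq> \<Union>A \<and> length xs = k + 1 \<longrightarrow>
           (pointed X ori k xs \<longleftrightarrow> std_pointed d k (map \<phi> xs))"
    using orient assms unfolding orientation_def by blast
  define \<psi> where "\<psi> = (\<lambda>a. inv_into (\<Union>A) \<phi> (diag_rel d `` {a}))"
  have inj: "inj_on \<phi> (\<Union>A)" and q: "\<phi> ` \<Union>A = UNIV // diag_rel d"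
    using \<phi>(1) by (auto simp: bij_betw_def)
  have \<phi>\<psi>: "\<phi> (\<psi> b) = diag_rel d `` {b}" for b
    unfolding \<psi>_def by (rule f_inv_into_f) (simp add: q quotientI)
  have \<psi>A: "\<psi> b \<in> \<Union>A" for b
    unfolding \<psi>_def by (rule inv_into_into) (simp add: q quotientI)
  have range: "range \<psi> = \<Union>A"
  proof
    show "range \<psi> \<subseteq> \<Union>A" using \<psi>A by blast
    show "\<Union>A \<subseteq> range \<psi>"
    proof
      fix v assume v: "v \<in> \<Union>A"
      then have "\<phi> v \<in> UNIV // diag_rel d" using q by blast
      then obtain b where "\<phi> v = diag_rel d `` {b}" by (auto simp: quotient_def)
      then have "\<phi> v = \<phi> (\<psi> b)" using \<phi>\<psi> by simp
      then have "v = \<psi> b" using inj v \<psi>A by (meson inj_onD)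
      then show "v \<in> range \<psi>" by blast
    qed
  qed
  have "\<psi> a = \<psi> b \<longleftrightarrow> (a, b) \<in> diag_rel d" for a b
  proof -
    have "\<psi> a = \<psi> b \<longleftrightarrow> \<phi> (\<psi> a) = \<phi> (\<psi> b)" using inj \<psi>A by (metis inj_onD)
    also have "\<dots> \<longleftrightarrow> (a, b) \<in> diag_rel d"
      unfolding \<phi>\<psi> using eq_equiv_class_iff[OF equiv_diag_rel] by simp
    finally show ?thesis .
  qed
  moreover have "pointed X ori (length ys) (ys @ [\<psi> a]) \<longleftrightarrow>
         (\<exists>Js. flag d Js \<and> ys = verts \<psi> a Js)" if "set ys \<subseteq> range \<psi>" for a ys
  proof -
    have "pointed X ori (length ys) (ys @ [\<psi> a]) \<longleftrightarrow>
        std_pointed d (length ys) (map \<phi> (ys @ [\<psi> a]))"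
      using \<phi>(2) that \<psi>A[of a] unfolding range by simp
    also have "\<dots> \<longleftrightarrow> (\<exists>Js. flag d Js \<and> ys = verts \<psi> a Js)"
      using that range by (intro std_pointed_iff[OF inj _ q]) (simp_all add: \<psi>_def)
    finally show ?thesis .
  qed
  ultimately have "chart \<psi>" unfolding chart_def by blast
  then show ?thesis using range by blast
qed

lemma apt_chart_containing:
  assumes "\<sigma> \<in> X" "\<tau> \<in> X"
  obtains \<psi> where "apt_chart \<psi>" "\<sigma> \<subseteq> range \<psi>" "\<tau> \<subseteq> range \<psi>"
proof -
  obtain A where A: "A \<in> \<A>" "\<sigma> \<in> A" "\<tau> \<in> A"
    using bld assms unfolding affine_A_building_def building_def by metis
  obtain \<psi> where "chart \<psi>" "range \<psi> = \<Union>A" using apt_chart_exists[OF A(1)] by blast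
  then show thesis using A that[of \<psi>] unfolding apt_chart_def by blast
qed

lemma chart_eq_iff: "chart \<psi> \<Longrightarrow> \<psi> a = \<psi> b \<longleftrightarrow> (a, b) \<in> diag_rel d"
  by (simp add: chart_def)

lemma chart_shift_inj:
  assumes "chart \<psi>" "\<psi> (shift a J) = \<psi> (shift a K)" "J \<subset> {..d}" "K \<subset> {..d}"
  shows "J = K"
  using assms shift_diag_inj by (simp add: chart_eq_iff)

lemma chart_map_shift_inj:
  assumes "chart \<psi>" "flag d Js" "flag d Ks"
    "verts \<psi> a Js = verts \<psi> a Ks"
  shows "Js = Ks"
proof -
  have "inj_on (\<lambda>J. \<psi> (shift a J)) (set Js \<union> set Ks)"
  proof (rule inj_onI)
    fix J K assume "J \<in> set Js \<union> set Ks" "K \<in> set Js \<union> set Ks" "\<psi> (shift a J) = \<psi> (shift a K)"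
    moreover have "\<forall>L \<in> set Js \<union> set Ks. L \<subset> {..d}" using assms(2,3) by (auto simp: flag_def)
    ultimately show "J = K" using chart_shift_inj[OF assms(1)] by blast
  qed
  then show ?thesis using assms(4) by (rule map_inj_on[rotated])
qed

lemma chart_pointedI:
  assumes "chart \<psi>" "flag d Js"
  shows "pointed X ori (length Js) (verts \<psi> a Js @ [\<psi> a])"
proof -
  have "set (verts \<psi> a Js) \<subseteq> range \<psi>" by auto
  then have "pointed X ori (length (verts \<psi> a Js)) (verts \<psi> a Js @ [\<psi> a])"
    using assms unfolding chart_def by blast
  then show ?thesis by simp
qed

lemma chart_pointed_iff:
  assumes "chart \<psi>" "set ys \<subseteq> range \<psi>" "length ys = k"
  shows "pointed X ori k (ys @ [\<psi> a]) \<longleftrightarrow>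
         (\<exists>Js. flag d Js \<and> ys = verts \<psi> a Js)"
  using assms unfolding chart_def by blast

lemma chart_pointedE_last:
  assumes "chart \<psi>" "set xs \<subseteq> range \<psi>" "pointed X ori k xs" "last xs = \<psi> a"
  obtains Js where "flag d Js" "xs = verts \<psi> a Js @ [\<psi> a]" "length Js = k"
proof -
  have len: "length xs = k + 1" using pointedD[OF assms(3)] by simp
  then have "xs \<noteq> []" by auto
  then have xs: "xs = butlast xs @ [\<psi> a]" using assms(4) by (metis append_butlast_last_id)
  moreover have sub: "set (butlast xs) \<subseteq> range \<psi>" using assms(2) by (meson in_set_butlastD subset_eq)
  moreover have l: "length (butlast xs) = k" using len by simp
  ultimately obtain Js where Js: "flag d Js" "butlast xs = verts \<psi> a Js"
    using chart_pointed_iff[OF assms(1) sub l, of a] assms(3) by metis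
  have "length Js = k" using l Js(2) by simp
  then show thesis using that Js xs by metis
qed

lemma chart_pointedE:
  assumes "chart \<psi>" "set xs \<subseteq> range \<psi>" "pointed X ori k xs"
  obtains a Js where "flag d Js" "xs = verts \<psi> a Js @ [\<psi> a]" "length Js = k"
proof -
  have "xs \<noteq> []" using pointedD(3)[OF assms(3)] by auto
  then have "last xs \<in> range \<psi>" using assms(2) last_in_set by blast
  then obtain a where "last xs = \<psi> a" by blast
  then show thesis using chart_pointedE_last[OF assms] that by blast
qed

section \<open>Chambers in coordinates and thinness\<close>

definition chamber :: "((nat \<Rightarrow> int) \<Rightarrow> 'v) \<Rightarrow> (nat \<Rightarrow> int) \<Rightarrow> nat list \<Rightarrow> 'v set" where
  "chamber \<psi> a p = (\<lambda>i. \<psi> (walk a p i)) ` {..d}"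

lemma chamber_eq_set:
  assumes "enumerates d p"
  shows "chamber \<psi> a p = set (verts \<psi> a (prefixes p) @ [\<psi> a])"
proof -
  have *: "{..d} = insert 0 {1..<length p}" using length_enumerates[OF assms] by auto
  show ?thesis unfolding chamber_def * by (auto simp: set_prefixes)
qed

lemma chamber_pointed:
  assumes "chart \<psi>" "enumerates d p"
  shows "pointed X ori d (verts \<psi> a (prefixes p) @ [\<psi> a])"
  using chart_pointedI[OF assms(1) flag_prefixes[OF assms(2)], of a] length_enumerates[OF assms(2)]
  by simp

lemma chamber_simplex:
  assumes "chart \<psi>" "enumerates d p"
  shows "chamber \<psi> a p \<in> X" "card (chamber \<psi> a p) = d + 1"
  using pointedD[OF chamber_pointed[OF assms, of a]] distinct_card
  unfolding chamber_eq_set[OF assms(2)] by metis+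

lemma set_take_swap:
  assumes "t \<noteq> length xs + 1"
  shows "set (take t (xs @ i # j # ys)) = set (take t (xs @ j # i # ys))"
proof (cases "t \<le> length xs")
  case False
  define u where "u = t - length xs - 2"
  have "t - length xs = Suc (Suc u)" using False assms by (simp add: u_def)
  then show ?thesis by auto
qed simp

text \<open>The panel omits vertex number \<open>length xs + 1\<close> only. The base vertex is
  kept, so \<sigma> is a full flag at \<open>a\<close> agreeing with the given one except in one
  set. This set lies between \<open>set xs\<close> and its union with {i, j}, strictly on both
  sides, which leaves two choices.\<close>

lemma chart_thin:
  assumes \<psi>: "chart \<psi>" and p: "enumerates d (xs @ i # j # ys)"
    and \<sigma>: "\<sigma> \<in> X" "\<sigma> \<subseteq> range \<psi>" "card \<sigma> = d + 1"
    and panel: "\<And>t. t \<le> d \<Longrightarrow> t \<noteq> length xs + 1 \<Longrightarrow> \<psi> (walk a (xs @ i # j # ys) t) \<in> \<sigma>"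
  shows "\<sigma> = chamber \<psi> a (xs @ i # j # ys) \<or> \<sigma> = chamber \<psi> a (xs @ j # i # ys)"
proof -
  let ?p = "xs @ i # j # ys" and ?p' = "xs @ j # i # ys"
  let ?m = "length xs"
  have dp: "distinct ?p" "set ?p = {..d}" "length ?p = d + 1"
    using p length_enumerates[OF p] by (auto simp: enumerates_def)
  have "\<psi> a \<in> \<sigma>" using panel[of 0] by simp
  then obtain zs where zs: "pointed X ori (length zs) (zs @ [\<psi> a])" "set (zs @ [\<psi> a]) = \<sigma>"
    using pointed_ending[OF \<sigma>(1)] by blast
  have lz: "length zs = d" using zs \<sigma>(3) pointedD[OF zs(1)] distinct_card[of "zs @ [\<psi> a]"] by simp
  have "set zs \<subseteq> range \<psi>" using zs(2) \<sigma>(2) by auto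
  then obtain Ks where Ks: "flag d Ks" "zs = verts \<psi> a Ks"
    using zs(1) chart_pointed_iff[OF \<psi>] by blast
  then obtain q where q: "enumerates d q" "Ks = prefixes q" using full_flag lz by auto
  have dq: "distinct q" "length q = d + 1" using q(1) length_enumerates by (auto simp: enumerates_def)
  have \<sigma>q: "\<sigma> = chamber \<psi> a q" using zs(2) Ks(2) q chamber_eq_set by simp
  have eq: "set (take t ?p) = set (take t q)" if t: "t \<le> d" "t \<noteq> ?m + 1" for t
  proof -
    obtain u where u: "u \<le> d" "\<psi> (walk a ?p t) = \<psi> (walk a q u)"
      using panel[OF t] unfolding \<sigma>q chamber_def by auto
    have "set (take t ?p) = set (take u q)"
      using chart_shift_inj[OF \<psi> u(2)] set_take_proper[OF p t(1)] set_take_proper[OF q(1) u(1)]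
      by blast
    moreover have "u = t"
      using card_set_take_enum[OF p t(1)] card_set_take_enum[OF q(1) u(1)] calculation by simp
    ultimately show ?thesis by simp
  qed
  have m: "?m + 2 \<le> d + 1" using dp(3) by simp
  define K where "K = set (take (?m + 1) q)"
  have lo: "set xs \<subseteq> K"
  proof -
    have "set xs = set (take ?m q)" using eq[of ?m] m by simp
    also have "\<dots> \<subseteq> K" unfolding K_def by (intro set_take_subset_set_take) simp
    finally show ?thesis .
  qed
  have hi: "K \<subseteq> set xs \<union> {i, j}"
  proof (cases "?m + 2 \<le> d")
    case True
    have "K \<subseteq> set (take (?m + 2) q)" unfolding K_def by (intro set_take_subset_set_take) simp
    also have "\<dots> = set xs \<union> {i, j}" using eq[OF True] by auto
    finally show ?thesis .
  next
    \<comment> \<open>The omitted vertex is the last one; the full set {0,...,d} then serves as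
      upper bound in place of a next prefix.\<close>
    case False
    moreover have "length xs + length ys + 2 = d + 1" using dp(3) by simp
    ultimately have "length ys = 0" by linarith
    then have "{..d} = set xs \<union> {i, j}" using dp(2) by auto
    moreover have "K \<subseteq> {..d}" using set_take_proper[OF q(1), of "?m + 1"] m unfolding K_def by auto
    ultimately show ?thesis by simp
  qed
  have cK: "card K = ?m + 1" unfolding K_def using card_set_take[OF dq(1)] dq(2) m by simp
  have cx: "card (set xs) = ?m" "i \<noteq> j" "i \<notin> set xs" "j \<notin> set xs"
    using dp(1) by (auto simp: distinct_card)
  have "K = insert i (set xs) \<or> K = insert j (set xs)"
  proof -
    have "i \<in> K \<or> j \<in> K"
    proof (rule ccontr)
      assume "\<not> ?thesis"
      then have "K = set xs" using lo hi by auto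
      then show False using cK cx by simp
    qed
    moreover have "\<not> (i \<in> K \<and> j \<in> K)"
    proof
      assume "i \<in> K \<and> j \<in> K"
      then have "K = insert i (insert j (set xs))" using lo hi by auto
      then show False using cK cx by simp
    qed
    ultimately show ?thesis using lo hi by blast
  qed
  then show ?thesis
  proof
    assume K: "K = insert i (set xs)"
    have "set (take t q) = set (take t ?p)" if "t \<le> d" for t
      using eq[OF that] K unfolding K_def by (cases "t = ?m + 1") auto
    then show ?thesis unfolding \<sigma>q chamber_def by simp
  next
    assume K: "K = insert j (set xs)"
    have "set (take t q) = set (take t ?p')" if "t \<le> d" for t
      using eq[OF that] K set_take_swap[of t xs i j ys] unfolding K_def by (cases "t = ?m + 1") auto
    then show ?thesis unfolding \<sigma>q chamber_def by simp
  qed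
qed

section \<open>Apartments as full subcomplexes\<close>

lemma apartment_subcomplex:
  assumes "A \<in> \<A>"
  shows "A \<subseteq> X" "simplicial_complex A"
  using bld assms unfolding affine_A_building_def building_def by auto

lemma apartment_chambers:
  assumes "A \<in> \<A>"
  shows "\<exists>\<sigma>\<in>A. card \<sigma> = d + 1"
    and "\<sigma> \<in> A \<Longrightarrow> card \<sigma> = d + 1 \<Longrightarrow> v \<in> \<sigma> \<Longrightarrow>
      \<exists>\<tau>\<in>A. card \<tau> = d + 1 \<and> \<sigma> - {v} \<subseteq> \<tau> \<and> \<tau> \<noteq> \<sigma>"
proof -
  let ?\<Sigma> = "coxeter_complex {..d} (affine_A_matrix d)"
  obtain f where "complex_iso A ?\<Sigma> f"
    using bld assms unfolding affine_A_building_def building_def by blast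
  then have f: "inj_on f (\<Union>A)" "(\<lambda>\<sigma>. f ` \<sigma>) ` A = ?\<Sigma>"
    by (auto simp: complex_iso_def bij_betw_def)
  have card: "card (f ` \<sigma>) = card \<sigma>" if "\<sigma> \<in> A" for \<sigma>
    using that f(1) by (meson Union_upper card_image inj_on_subset)
  obtain \<tau> where "\<tau> \<in> ?\<Sigma>" "card \<tau> = d + 1" using coxeter_complex_has_chamber[OF d_pos] by blast
  then show "\<exists>\<sigma>\<in>A. card \<sigma> = d + 1" using card f(2) by (metis imageE)
  assume \<sigma>: "\<sigma> \<in> A" "card \<sigma> = d + 1" "v \<in> \<sigma>"
  have "f ` \<sigma> \<in> ?\<Sigma>" using f(2) \<sigma>(1) by blast
  moreover have "card (f ` \<sigma>) = d + 1" using card \<sigma> by simp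
  ultimately have "\<exists>\<tau>'\<in>?\<Sigma>. card \<tau>' = d + 1 \<and> f ` \<sigma> - {f v} \<subseteq> \<tau>' \<and> \<tau>' \<noteq> f ` \<sigma>"
    by (rule coxeter_complex_panel[OF d_pos _ _ imageI[OF \<sigma>(3)]])
  then obtain \<tau>' where \<tau>': "\<tau>' \<in> ?\<Sigma>" "card \<tau>' = d + 1" "f ` \<sigma> - {f v} \<subseteq> \<tau>'" "\<tau>' \<noteq> f ` \<sigma>"
    by (elim bexE conjE)
  from \<tau>'(1) have "\<tau>' \<in> (\<lambda>\<sigma>. f ` \<sigma>) ` A" by (simp only: f(2))
  then obtain \<tau> where \<tau>: "\<tau> \<in> A" "\<tau>' = f ` \<tau>" by (elim imageE)
  have "u \<in> \<tau>" if "u \<in> \<sigma>" "u \<noteq> v" for u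
  proof -
    have "f u \<noteq> f v" using inj_onD[OF f(1), of u v] that \<sigma> by blast
    then have "f u \<in> f ` \<tau>" using that \<tau>'(3) \<tau>(2) by blast
    then show ?thesis using inj_onD[OF f(1), of u] that \<sigma> \<tau>(1) by blast
  qed
  then show "\<exists>\<tau>\<in>A. card \<tau> = d + 1 \<and> \<sigma> - {v} \<subseteq> \<tau> \<and> \<tau> \<noteq> \<sigma>"
    using \<tau> \<tau>' card by (intro bexI[of _ \<tau>]) auto
qed

lemma simplex_in_chamber:
  assumes "chart \<psi>" "\<sigma> \<in> X" "\<sigma> \<subseteq> range \<psi>"
  obtains a p where "enumerates d p" "\<sigma> \<subseteq> chamber \<psi> a p"
    "card \<sigma> = d + 1 \<Longrightarrow> \<sigma> = chamber \<psi> a p"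
proof -
  obtain x where "x \<in> \<sigma>" using simplex_nonempty[OF assms(2)] by blast
  then obtain ys where xs: "pointed X ori (length ys) (ys @ [x])" "set (ys @ [x]) = \<sigma>"
    using pointed_ending[OF assms(2)] by blast
  then have sub: "set (ys @ [x]) \<subseteq> range \<psi>" using assms(3) by simp
  obtain a Js where a: "flag d Js" "ys @ [x] = verts \<psi> a Js @ [\<psi> a]"
    using chart_pointedE[OF assms(1) sub xs(1)] by blast
  obtain p where p: "enumerates d p" "set Js \<subseteq> set (prefixes p)" using flag_extend[OF a(1)] by blast
  have sub: "\<sigma> \<subseteq> chamber \<psi> a p" unfolding chamber_eq_set[OF p(1)] using a p xs(2) by auto
  moreover have "\<sigma> = chamber \<psi> a p" if "card \<sigma> = d + 1"
    using card_subset_eq[OF simplex_finite[OF chamber_simplex(1)[OF assms(1) p(1)]] sub]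
      that chamber_simplex(2)[OF assms(1) p(1), of a] by simp
  ultimately show thesis using that p(1) by blast
qed

text \<open>The last step of the rotated walk reaches \<open>a\<close> plus the diagonal vector,
  hence the old start. \<psi> need only respect the diagonal, since rigidity applies this to a chart
  followed by an isomorphism of apartments, not yet known to be a chart.\<close>

lemma chamber_rotate:
  assumes inj: "\<And>a b. (a, b) \<in> diag_rel d \<Longrightarrow> \<psi> a = \<psi> b" and p: "enumerates d (x # ys)" "i \<le> d"
  shows "\<psi> (walk (shift a {x}) (ys @ [x]) i) =
    \<psi> (walk a (x # ys) (if i = d then 0 else i + 1))"
proof -
  have l: "length ys = d" "set (x # ys) = {..d}" "x \<notin> set ys"
    using p(1) length_enumerates[OF p(1)] by (auto simp: enumerates_def)
  have x: "x \<notin> set (take i ys)" using l(3) by (meson in_set_takeD)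
  have sh: "walk (shift a {x}) ys i = walk a (x # ys) (Suc i)"
    using x by (auto simp: shift_def)
  show ?thesis
  proof (cases "i = d")
    case False
    then show ?thesis using p l sh by simp
  next
    case True
    then have "walk (shift a {x}) (ys @ [x]) i = shift a {..d}"
      using sh l by simp
    moreover have "(shift a {..d}, a) \<in> diag_rel d"
      by (auto simp: diag_rel_def shift_def intro!: exI[of _ 1])
    ultimately show ?thesis using True inj by simp
  qed
qed

text \<open>From one chamber of \<open>A\<close> every swap is forced: the Coxeter complex provides
  another chamber of \<open>A\<close> on the panel, and thinness identifies it with the coordinate
  chamber on the other side.\<close>

lemma chamber_in_apartment:
  assumes A: "A \<in> \<A>" "range \<psi> = \<Union>A" and \<psi>: "chart \<psi>" and p: "enumerates d p"
  shows "chamber \<psi> a p \<in> A"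
proof -
  obtain \<sigma> where \<sigma>: "\<sigma> \<in> A" "card \<sigma> = d + 1" using apartment_chambers(1)[OF A(1)] by blast
  have "\<sigma> \<in> X" using \<sigma> apartment_subcomplex[OF A(1)] by blast
  moreover have "\<sigma> \<subseteq> range \<psi>" using A(2) \<sigma> by blast
  ultimately obtain a0 p0 where p0: "enumerates d p0" "\<sigma> = chamber \<psi> a0 p0"
    using simplex_in_chamber[OF \<psi>] \<sigma>(2) by metis
  show ?thesis
  proof (rule gallery_induct[where Q = "\<lambda>a p. chamber \<psi> a p \<in> A", OF p0(1) _ _ _ _ p])
    show "chamber \<psi> a0 p0 \<in> A" using \<sigma> p0 by simp
  next
    fix a xs i j ys
    assume e: "enumerates d (xs @ i # j # ys)" and c: "chamber \<psi> a (xs @ i # j # ys) \<in> A"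
    define v where "v = \<psi> (walk a (xs @ i # j # ys) (length xs + 1))"
    let ?c = "chamber \<psi> a (xs @ i # j # ys)"
    have le: "length xs + 1 \<le> d" using length_enumerates[OF e] by simp
    then have v: "v \<in> ?c" unfolding v_def chamber_def by blast
    obtain \<tau> where \<tau>: "\<tau> \<in> A" "card \<tau> = d + 1" "?c - {v} \<subseteq> \<tau>" "\<tau> \<noteq> ?c"
      using apartment_chambers(2)[OF A(1) c _ v] chamber_simplex[OF \<psi> e] by blast
    have "\<psi> (walk a (xs @ i # j # ys) t) \<in> \<tau>" if t: "t \<le> d" "t \<noteq> length xs + 1" for t
    proof -
      have "\<psi> (walk a (xs @ i # j # ys) t) \<noteq> v"
      proof
        assume "\<psi> (walk a (xs @ i # j # ys) t) = v"
        then have "set (take t (xs @ i # j # ys)) = set (take (length xs + 1) (xs @ i # j # ys))"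
          unfolding v_def
          using chart_shift_inj[OF \<psi>] set_take_proper[OF e t(1)] set_take_proper[OF e le] by blast
        then show False
          using card_set_take_enum[OF e t(1)] card_set_take_enum[OF e le] t(2) by argo
      qed
      moreover have "\<psi> (walk a (xs @ i # j # ys) t) \<in> ?c"
        unfolding chamber_def using t by blast
      ultimately show ?thesis using \<tau>(3) by blast
    qed
    then have "\<tau> = chamber \<psi> a (xs @ j # i # ys)"
      using chart_thin[OF \<psi> e, of \<tau> a] \<tau> apartment_subcomplex(1)[OF A(1)] A(2) by blast
    then show "chamber \<psi> a (xs @ j # i # ys) \<in> A" using \<tau>(1) by simp
  next
    fix a x ys
    assume e: "enumerates d (x # ys)" and c: "chamber \<psi> a (x # ys) \<in> A"
    have "chamber \<psi> (shift a {x}) (ys @ [x]) \<subseteq> chamber \<psi> a (x # ys)"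
    proof
      fix v assume "v \<in> chamber \<psi> (shift a {x}) (ys @ [x])"
      then obtain i where i: "i \<le> d" "v = \<psi> (walk (shift a {x}) (ys @ [x]) i)"
        by (auto simp: chamber_def)
      then show "v \<in> chamber \<psi> a (x # ys)"
        using chamber_rotate[OF _ e i(1), of \<psi> a] \<psi> by (auto simp: chamber_def chart_eq_iff)
    qed
    moreover have "chamber \<psi> (shift a {x}) (ys @ [x]) \<noteq> {}" by (auto simp: chamber_def)
    ultimately show "chamber \<psi> (shift a {x}) (ys @ [x]) \<in> A"
      using c apartment_subcomplex(2)[OF A(1)] unfolding simplicial_complex_def by blast
  next
    fix a b p assume "chamber \<psi> a p \<in> A" and "(a, b) \<in> diag_rel d"
    moreover from this have "\<psi> (shift a J) = \<psi> (shift b J)" for J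
      using \<psi> shift_diag_cong by (simp add: chart_eq_iff)
    ultimately show "chamber \<psi> b p \<in> A" by (simp add: chamber_def)
  qed
qed

lemma apartment_full:
  assumes "A \<in> \<A>" "\<sigma> \<in> X" "\<sigma> \<subseteq> \<Union>A"
  shows "\<sigma> \<in> A"
proof -
  obtain \<psi> where \<psi>: "chart \<psi>" "range \<psi> = \<Union>A" using apt_chart_exists[OF assms(1)] by blast
  obtain a p where "enumerates d p" "\<sigma> \<subseteq> chamber \<psi> a p"
    using simplex_in_chamber[OF \<psi>(1) assms(2)] assms(3) \<psi>(2) by metis
  then show ?thesis
    using chamber_in_apartment[OF assms(1) \<psi>(2,1)] apartment_subcomplex(2)[OF assms(1)]
      simplex_nonempty[OF assms(2)] unfolding simplicial_complex_def by blast
qed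

text \<open>\<open>\<psi>1\<close> is not known to respect pointed simplices. Agreement crosses a
  panel nevertheless: the image of the chamber beyond it must be one of the two
  \<open>\<psi>2\<close>-chambers on the panel, and injectivity of \<open>\<psi>1\<close> excludes
  the one left behind.\<close>

lemma chart_rigid:
  assumes \<psi>2: "chart \<psi>2" and inj: "\<And>a b. \<psi>1 a = \<psi>1 b \<longleftrightarrow> (a, b) \<in> diag_rel d"
    and simp: "\<And>a p. enumerates d p \<Longrightarrow> chamber \<psi>1 a p \<in> X"
    and range: "range \<psi>1 \<subseteq> range \<psi>2"
    and p0: "enumerates d p0"
    and base: "\<And>i. i \<le> d \<Longrightarrow> \<psi>1 (walk a0 p0 i) = \<psi>2 (walk a0 p0 i)"
  shows "\<psi>1 a = \<psi>2 a"
proof -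
  define Q where "Q = (\<lambda>a p. \<forall>i\<le>d. \<psi>1 (walk a p i) = \<psi>2 (walk a p i))"
  have inj1: "J = K" if "\<psi>1 (shift a J) = \<psi>1 (shift a K)" "J \<subset> {..d}" "K \<subset> {..d}" for a J K
    using that inj shift_diag_inj by blast
  have "Q a p0"
  proof (rule gallery_induct[where Q = Q, OF p0 _ _ _ _ p0])
    show "Q a0 p0" using base by (simp add: Q_def)
  next
    fix a xs i j ys
    assume e: "enumerates d (xs @ i # j # ys)" and Q: "Q a (xs @ i # j # ys)"
    let ?p = "xs @ i # j # ys" and ?p' = "xs @ j # i # ys"
    let ?m = "length xs + 1"
    have e': "enumerates d ?p'" using e by (auto simp: enumerates_def)
    have m: "?m \<le> d" using length_enumerates[OF e] by simp
    note ps = set_take_proper and cp = card_set_take_enum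
    have other: "\<psi>1 (walk a ?p' t) = \<psi>2 (walk a ?p' t)"
      if "t \<le> d" "t \<noteq> ?m" for t
    proof -
      have "\<psi>1 (walk a ?p t) = \<psi>2 (walk a ?p t)"
        using Q that(1) unfolding Q_def by blast
      then show ?thesis by (simp only: set_take_swap[OF that(2)])
    qed
    define \<sigma> where "\<sigma> = chamber \<psi>1 a ?p'"
    have "\<sigma> \<in> X" using simp[OF e'] by (simp add: \<sigma>_def)
    moreover have "\<sigma> \<subseteq> range \<psi>2" using range by (auto simp: \<sigma>_def chamber_def)
    moreover have "card \<sigma> = d + 1"
    proof -
      have "inj_on (\<lambda>t. \<psi>1 (walk a ?p' t)) {..d}"
      proof (rule inj_onI)
        fix t u assume tu: "t \<in> {..d}" "u \<in> {..d}"
          "\<psi>1 (walk a ?p' t) = \<psi>1 (walk a ?p' u)"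
        have le: "t \<le> d" "u \<le> d" using tu by auto
        have "set (take t ?p') = set (take u ?p')"
          by (rule inj1[OF tu(3) ps[OF e' le(1)] ps[OF e' le(2)]])
        then show "t = u" using cp[OF e' le(1)] cp[OF e' le(2)] by argo
      qed
      then show ?thesis by (simp add: \<sigma>_def chamber_def card_image)
    qed
    moreover have "\<psi>2 (walk a ?p t) \<in> \<sigma>" if "t \<le> d" "t \<noteq> ?m" for t
    proof -
      have "\<psi>2 (walk a ?p t) = \<psi>1 (walk a ?p' t)"
        using other[OF that] by (simp only: set_take_swap[OF that(2)])
      then show ?thesis using that(1) unfolding \<sigma>_def chamber_def by blast
    qed
    ultimately have cases: "\<sigma> = chamber \<psi>2 a ?p \<or> \<sigma> = chamber \<psi>2 a ?p'"
      using chart_thin[OF \<psi>2 e, of \<sigma> a] by blast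
    have mem: "\<psi>1 (walk a ?p' ?m) \<in> \<sigma>"
      unfolding \<sigma>_def chamber_def using m by blast
    have "\<psi>1 (walk a ?p' ?m) = \<psi>2 (walk a ?p' ?m)"
      using cases
    proof
      \<comment> \<open>Here the new vertex would coincide under \<open>\<psi>1\<close> with an old
        one; comparing the sets puts j among i and the entries of \<open>xs\<close>, which is
        impossible.\<close>
      assume "\<sigma> = chamber \<psi>2 a ?p"
      then obtain t where t: "t \<le> d" "\<psi>1 (walk a ?p' ?m) = \<psi>2 (walk a ?p t)"
        using mem by (auto simp: chamber_def)
      then have "\<psi>1 (walk a ?p' ?m) = \<psi>1 (walk a ?p t)"
        using Q by (simp add: Q_def)
      then have eq: "set (take ?m ?p') = set (take t ?p)"
        using inj1 ps[OF e' m] ps[OF e t(1)] by blast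
      then have "t = ?m" using cp[OF e' m] cp[OF e t(1)] by simp
      then have "j \<in> insert i (set xs)" using eq by auto
      then show ?thesis using e by (auto simp: enumerates_def)
    next
      assume "\<sigma> = chamber \<psi>2 a ?p'"
      then obtain t where t: "t \<le> d" "\<psi>1 (walk a ?p' ?m) = \<psi>2 (walk a ?p' t)"
        using mem by (auto simp: chamber_def)
      show ?thesis
      proof (cases "t = ?m")
        case True
        then show ?thesis using t by simp
      next
        case False
        then have "\<psi>1 (walk a ?p' ?m) = \<psi>1 (walk a ?p' t)"
          using other t by simp
        then have "set (take ?m ?p') = set (take t ?p')"
          using inj1 ps[OF e' m] ps[OF e' t(1)] by blast
        then show ?thesis using cp[OF e' m] cp[OF e' t(1)] False by simp
      qed
    qed
    then show "Q a ?p'" using other unfolding Q_def by blast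
  next
    fix a x ys assume e: "enumerates d (x # ys)" and Q: "Q a (x # ys)"
    show "Q (shift a {x}) (ys @ [x])"
      unfolding Q_def
    proof (intro allI impI)
      fix i assume i: "i \<le> d"
      have "(if i = d then 0 else i + 1) \<le> d" using i by simp
      then have mid: "\<psi>1 (walk a (x # ys) (if i = d then 0 else i + 1)) =
            \<psi>2 (walk a (x # ys) (if i = d then 0 else i + 1))"
        using Q unfolding Q_def by blast
      have e1: "\<psi>1 (walk (shift a {x}) (ys @ [x]) i) =
          \<psi>1 (walk a (x # ys) (if i = d then 0 else i + 1))"
        by (rule chamber_rotate[OF _ e i]) (use inj in blast)
      have e2: "\<psi>2 (walk (shift a {x}) (ys @ [x]) i) =
          \<psi>2 (walk a (x # ys) (if i = d then 0 else i + 1))"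
        by (rule chamber_rotate[OF _ e i]) (use chart_eq_iff[OF \<psi>2] in blast)
      show "\<psi>1 (walk (shift a {x}) (ys @ [x]) i) =
            \<psi>2 (walk (shift a {x}) (ys @ [x]) i)"
        unfolding e1 e2 by (rule mid)
    qed
  next
    fix a b p assume "Q a p" and "(a, b) \<in> diag_rel d"
    moreover from this have "\<psi>1 (shift a J) = \<psi>1 (shift b J)" "\<psi>2 (shift a J) = \<psi>2 (shift b J)" for J
      using inj chart_eq_iff[OF \<psi>2] shift_diag_cong by auto
    ultimately show "Q b p" by (simp add: Q_def)
  qed
  then show ?thesis unfolding Q_def by (metis le0 set_empty shift_empty take_0)
qed

section \<open>Permutations and translations of the coordinates\<close>

lemma chart_reparam:
  fixes a :: "nat \<Rightarrow> int"
  assumes \<psi>: "chart \<psi>" and \<kappa>: "bij_betw \<kappa> {..d} {..d}"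
  defines "T \<equiv> \<lambda>v j. a j + v (\<kappa> j)"
  shows "chart (\<lambda>v. \<psi> (T v))" "range (\<lambda>v. \<psi> (T v)) = range \<psi>"
proof -
  define \<mu> where "\<mu> = inv_into {..d} \<kappa>"
  have \<kappa>d: "\<kappa> j \<le> d" if "j \<le> d" for j using \<kappa> that by (auto simp: bij_betw_def)
  have \<mu>: "\<mu> j \<le> d" "\<kappa> (\<mu> j) = j" if "j \<le> d" for j
    using \<kappa> that inv_into_into[of j \<kappa> "{..d}"] f_inv_into_f[of j \<kappa> "{..d}"]
    by (auto simp: \<mu>_def bij_betw_def)
  have \<mu>\<kappa>: "\<mu> (\<kappa> j) = j" if "j \<le> d" for j
    using \<kappa> that by (auto simp: \<mu>_def bij_betw_def)
  \<comment> \<open>\<open>pb\<close> pulls sets of coordinates back along \<kappa>. It permutes the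
    nonempty proper subsets and preserves inclusion, so it maps flags bijectively to flags.\<close>
  define pb where "pb = (\<lambda>J. {j. j \<le> d \<and> \<kappa> j \<in> J})"
  have T_shift: "\<psi> (T (shift v J)) = \<psi> (shift (T v) (pb J))" for v J
    using \<psi> by (auto simp: chart_eq_iff diag_rel_def T_def shift_def pb_def intro!: exI[of _ 0])
  have T_diag: "(T v, T w) \<in> diag_rel d \<longleftrightarrow> (v, w) \<in> diag_rel d" for v w
  proof
    assume "(T v, T w) \<in> diag_rel d"
    then obtain c where c: "\<And>j. j \<le> d \<Longrightarrow> v (\<kappa> j) = w (\<kappa> j) + c"
      by (auto simp: diag_rel_def T_def)
    have "v j = w j + c" if "j \<le> d" for j using c[of "\<mu> j"] \<mu>[OF that] by simp
    then show "(v, w) \<in> diag_rel d" by (auto simp: diag_rel_def)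
  next
    assume "(v, w) \<in> diag_rel d"
    then show "(T v, T w) \<in> diag_rel d" using \<kappa>d by (fastforce simp: diag_rel_def T_def)
  qed
  have surj: "\<exists>v. \<psi> (T v) = \<psi> w" for w
  proof
    show "\<psi> (T (\<lambda>i. w (\<mu> i) - a (\<mu> i))) = \<psi> w"
      using \<mu>\<kappa> \<psi> by (auto simp: chart_eq_iff diag_rel_def T_def intro!: exI[of _ 0])
  qed
  show range: "range (\<lambda>v. \<psi> (T v)) = range \<psi>" 
  proof (intro equalityI subsetI)
    fix y assume "y \<in> range \<psi>"
    then obtain w where "y = \<psi> w" by blast
    with surj[of w] show "y \<in> range (\<lambda>v. \<psi> (T v))" by (metis rangeI)
  qed auto
  have pb_mono: "pb J \<subset> pb K" if JK: "J \<subset> K" "K \<subseteq> {..d}" for J K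
  proof -
    obtain x where x: "x \<in> K" "x \<notin> J" using JK(1) by blast
    then have "\<mu> x \<in> pb K" "\<mu> x \<notin> pb J" using \<mu>[of x] JK by (auto simp: pb_def)
    moreover have "pb J \<subseteq> pb K" using JK by (auto simp: pb_def)
    ultimately show ?thesis by blast
  qed
  have pb_full: "pb {..d} = {..d}" using \<kappa>d by (auto simp: pb_def)
  have pb_empty: "pb {} = {}" by (simp add: pb_def)
  have pb_inv: "pb (\<kappa> ` K) = K" if "K \<subseteq> {..d}" for K
  proof -
    have "j \<in> K" if "j \<le> d" "\<kappa> j = \<kappa> k" "k \<in> K" for j k
      using that \<mu>\<kappa>[of j] \<mu>\<kappa>[of k] \<open>K \<subseteq> {..d}\<close> by auto
    then show ?thesis using that by (auto simp: pb_def)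
  qed
  have flag_pb: "flag d (map pb Js)" if "flag d Js" for Js
  proof -
    have *: "J \<noteq> {} \<and> J \<subset> {..d}" if "J \<in> set Js" for J using \<open>flag d Js\<close> that by (simp add: flag_def)
    have "sorted_wrt (\<lambda>x y. pb x \<subset> pb y) Js"
    proof (rule sorted_wrt_mono_rel[of _ "(\<subset>)"])
      show "sorted_wrt (\<subset>) Js" using \<open>flag d Js\<close> by (simp add: flag_def)
      show "pb x \<subset> pb y" if "x \<in> set Js" "y \<in> set Js" "x \<subset> y" for x y
        using pb_mono[OF that(3)] *[OF that(2)] by (meson psubset_imp_subset)
    qed
    moreover have "pb J \<noteq> {} \<and> pb J \<subset> {..d}" if "J \<in> set Js" for J
    proof -
      have "{} \<subset> J" "J \<subseteq> {..d}" "J \<subset> {..d}" using *[OF that] by auto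
      then show ?thesis using pb_mono[of "{}" J] pb_mono[of J "{..d}"] pb_full pb_empty by auto
    qed
    ultimately show ?thesis by (auto simp: flag_def sorted_wrt_map)
  qed
  have flag_im: "\<exists>Js. flag d Js \<and> map pb Js = Ks" if Ks: "flag d Ks" for Ks
  proof (intro exI conjI)
    have *: "K \<noteq> {} \<and> K \<subset> {..d}" if "K \<in> set Ks" for K using Ks that by (simp add: flag_def)
    have mono: "\<kappa> ` J \<subset> \<kappa> ` K" if "J \<subset> K" "K \<subseteq> {..d}" for J K
      using that pb_inv[of J] pb_inv[of K] by (metis image_mono psubset_eq subset_trans)
    have "sorted_wrt (\<lambda>x y. \<kappa> ` x \<subset> \<kappa> ` y) Ks"
    proof (rule sorted_wrt_mono_rel[of _ "(\<subset>)"])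
      show "sorted_wrt (\<subset>) Ks" using Ks by (simp add: flag_def)
      show "\<kappa> ` x \<subset> \<kappa> ` y" if "x \<in> set Ks" "y \<in> set Ks" "x \<subset> y" for x y
        using mono[OF that(3)] *[OF that(2)] by (meson psubset_imp_subset)
    qed
    moreover have "\<kappa> ` K \<noteq> {} \<and> \<kappa> ` K \<subset> {..d}" if "K \<in> set Ks" for K
      using mono[of K "{..d}"] *[OF that] \<kappa> by (auto simp: bij_betw_def)
    ultimately show "flag d (map (\<lambda>K. \<kappa> ` K) Ks)" by (auto simp: flag_def sorted_wrt_map)
    show "map pb (map (\<lambda>K. \<kappa> ` K) Ks) = Ks"
    proof -
      have "pb (\<kappa> ` K) = K" if "K \<in> set Ks" for K using pb_inv[of K] *[OF that] by blast
      then show ?thesis by (simp add: map_idI comp_def)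
    qed
  qed
  show "chart (\<lambda>v. \<psi> (T v))"
    unfolding chart_def range
  proof (intro conjI allI impI)
    show "\<psi> (T v) = \<psi> (T w) \<longleftrightarrow> (v, w) \<in> diag_rel d" for v w
      using \<psi> T_diag by (simp add: chart_eq_iff)
    fix v ys assume ys: "set ys \<subseteq> range \<psi>"
    have "pointed X ori (length ys) (ys @ [\<psi> (T v)]) \<longleftrightarrow>
        (\<exists>Ks. flag d Ks \<and> ys = map (\<lambda>K. \<psi> (shift (T v) K)) Ks)"
      using chart_pointed_iff[OF \<psi> ys HOL.refl] .
    also have "\<dots> \<longleftrightarrow> (\<exists>Js. flag d Js \<and> ys = map (\<lambda>K. \<psi> (shift (T v) K)) (map pb Js))"
      using flag_pb flag_im by metis
    also have "\<dots> \<longleftrightarrow> (\<exists>Js. flag d Js \<and> ys = map (\<lambda>J. \<psi> (T (shift v J))) Js)"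
      by (simp add: T_shift comp_def)
    finally show "pointed X ori (length ys) (ys @ [\<psi> (T v)]) \<longleftrightarrow>
        (\<exists>Js. flag d Js \<and> ys = map (\<lambda>J. \<psi> (T (shift v J))) Js)" .
  qed
qed

lemma chart_translate:
  assumes "chart \<psi>"
  shows "chart (\<lambda>v. \<psi> (\<lambda>j. a j + v j))" "range (\<lambda>v. \<psi> (\<lambda>j. a j + v j)) = range \<psi>"
  using chart_reparam[OF assms, of "\<lambda>j. j" a] by (simp_all add: bij_betw_def)

text \<open>The pointed enumeration of the chamber that ends in \<open>\<psi> a\<close> is a full
  flag in both charts. Two full flags differ by a permutation of the coordinates, and their base
  points by a translation.\<close>

lemma chart_normalize:
  assumes \<psi>: "chart \<psi>" and \<theta>: "chart \<theta>" and p: "enumerates d p"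
    and sub: "chamber \<psi> a p \<subseteq> range \<theta>"
  obtains \<theta>' where "chart \<theta>'" "range \<theta>' = range \<theta>"
    "\<And>i. i \<le> d \<Longrightarrow> \<theta>' (walk a p i) = \<psi> (walk a p i)"
proof -
  have "set (verts \<psi> a (prefixes p) @ [\<psi> a]) \<subseteq> range \<theta>"
    using sub unfolding chamber_eq_set[OF p] .
  then obtain e Js where Js: "flag d Js" "verts \<psi> a (prefixes p) @ [\<psi> a] = verts \<theta> e Js @ [\<theta> e]"
    "length Js = d"
    using chart_pointedE[OF \<theta> _ chamber_pointed[OF \<psi> p]] by blast
  obtain q where q: "enumerates d q" "Js = prefixes q" using full_flag[OF Js(1,3)] by blast
  have dp: "distinct p" "set p = {..d}" "length p = d + 1"
    and dq: "distinct q" "set q = {..d}" "length q = d + 1"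
    using p q(1) length_enumerates[OF p] length_enumerates[OF q(1)] by (auto simp: enumerates_def)
  have match: "\<psi> (walk a p i) = \<theta> (walk e q i)" if i: "i \<le> d" for i
  proof (cases i)
    case 0
    then show ?thesis using Js(2) by simp
  next
    case (Suc t)
    have "verts \<psi> a (prefixes p) ! t = verts \<theta> e (prefixes q) ! t" using Js(2) q(2) by simp
    then show ?thesis using Suc i dp(3) dq(3) by simp
  qed
  have bij: "bij_betw ((!) l) {..d} {..d}" if "distinct l" "set l = {..d}" "length l = d + 1" for l
    using bij_betw_nth[OF that(1), of "{..<length l}" "set l"] that by (simp add: lessThan_Suc_atMost)
  have mem: "l ! t \<in> set (take i l) \<longleftrightarrow> t < i" if "distinct l" "length l = d + 1" "t \<le> d" "i \<le> d" for l t i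
    using that by (auto simp: in_set_conv_nth nth_eq_iff_index_eq)
  define idx where "idx = inv_into {..d} ((!) q)"
  have idx: "bij_betw idx {..d} {..d}" unfolding idx_def by (rule bij_betw_inv_into[OF bij[OF dq]])
  have q_idx: "q ! idx j = j" if "j \<le> d" for j
    unfolding idx_def using bij[OF dq] that by (intro f_inv_into_f) (simp add: bij_betw_def)
  \<comment> \<open>\<kappa> sends the i-th entry of \<open>q\<close> to the i-th entry of
    \<open>p\<close>.\<close>
  define \<kappa> where "\<kappa> = (!) p \<circ> idx"
  have \<kappa>: "bij_betw \<kappa> {..d} {..d}" unfolding \<kappa>_def by (rule bij_betw_trans[OF idx bij[OF dp]])
  have \<kappa>_mem: "\<kappa> j \<in> set (take i p) \<longleftrightarrow> j \<in> set (take i q)" if "j \<le> d" "i \<le> d" for i j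
  proof -
    have "idx j \<le> d" using idx that(1) by (auto simp: bij_betw_def)
    then show ?thesis
      using mem[OF dp(1,3) _ that(2)] mem[OF dq(1,3) _ that(2)] q_idx[OF that(1)] by (metis \<kappa>_def comp_apply)
  qed
  \<comment> \<open>The translation part is chosen such that \<open>a\<close> goes to
    \<open>e\<close>.\<close>
  let ?T = "\<lambda>v j. (e j - a (\<kappa> j)) + v (\<kappa> j)"
  show thesis
  proof (rule that[of "\<lambda>v. \<theta> (?T v)"])
    show "chart (\<lambda>v. \<theta> (?T v))" "range (\<lambda>v. \<theta> (?T v)) = range \<theta>" by (rule chart_reparam[OF \<theta> \<kappa>])+
    show "\<theta> (?T (walk a p i)) = \<psi> (walk a p i)" if "i \<le> d" for i
      unfolding match[OF that] chart_eq_iff[OF \<theta>] diag_rel_def using \<kappa>_mem[OF _ that]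
      by (auto simp: shift_def intro!: exI[of _ 0])
  qed
qed

lemma simplex_in_apartment:
  assumes "\<sigma> \<in> X" "\<tau> \<in> X"
  obtains A where "A \<in> \<A>" "\<sigma> \<in> A" "\<tau> \<in> A"
  using bld assms unfolding affine_A_building_def building_def by metis

text \<open>The image of \<open>w\<close> under the retraction is read off in an apartment containing \<open>w\<close> and the
  central chamber, with the chart normalized on that chamber. By rigidity it does not depend on the
  apartment.\<close>

lemma retraction_exists:
  assumes \<psi>: "apt_chart \<psi>" and p: "enumerates d p"
  obtains \<rho> where "\<And>b. \<rho> (\<psi> b) = \<psi> b"
    "\<And>k xs. pointed X ori k xs \<Longrightarrow> pointed X ori k (map \<rho> xs) \<and> \<rho> ` set xs \<subseteq> range \<psi>"
    "\<And>w. w \<in> \<Union>X \<Longrightarrow> \<rho> w \<in> chamber \<psi> a p \<Longrightarrow> \<rho> w = w"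
proof -
  obtain A where A: "chart \<psi>" "A \<in> \<A>" "range \<psi> = \<Union>A" using \<psi> by (auto simp: apt_chart_def)
  let ?C = "chamber \<psi> a p"
  have CX: "?C \<in> X" using chamber_simplex(1)[OF A(1) p] .
  \<comment> \<open>Normalized charts: those of apartments \<open>B\<close> that agree with \<psi>
    on the central chamber, index by index.\<close>
  define NC where "NC = (\<lambda>B \<theta>. B \<in> \<A> \<and> chart \<theta> \<and> range \<theta> = \<Union>B \<and>
    (\<forall>i\<le>d. \<theta> (walk a p i) = \<psi> (walk a p i)))"
  have NC_ex: "\<exists>\<theta>. NC B \<theta>" if B: "B \<in> \<A>" "?C \<subseteq> \<Union>B" for B
  proof -
    obtain \<theta>0 where \<theta>0: "chart \<theta>0" "range \<theta>0 = \<Union>B" using apt_chart_exists[OF B(1)] by blast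
    obtain \<theta> where "chart \<theta>" "range \<theta> = range \<theta>0" "\<And>i. i \<le> d \<Longrightarrow> \<theta> (walk a p i) = \<psi> (walk a p i)"
      by (rule chart_normalize[OF A(1) \<theta>0(1) p]) (use \<theta>0 B in auto)
    then have "NC B \<theta>" unfolding NC_def using B(1) \<theta>0(2) by simp
    then show ?thesis by blast
  qed
  have NC_C: "?C \<in> B" if "NC B \<theta>" for B \<theta>
  proof -
    have "chamber \<theta> a p = ?C" using that unfolding chamber_def NC_def by (intro image_cong) auto
    then show ?thesis using chamber_in_apartment[of B \<theta> p a] that p by (simp add: NC_def)
  qed
  \<comment> \<open>An isomorphism of the apartments fixes the centre and the common vertex.
    Composed with \<theta> it agrees with \<theta>' on the centre, hence everywhere by rigidity, and
    evaluation at the vertex compares the coordinates.\<close>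
  have wd: "(b, b') \<in> diag_rel d" if N: "NC B \<theta>" "NC B' \<theta>'" and bb: "\<theta> b = \<theta>' b'" for B \<theta> B' \<theta>' b b'
  proof -
    have B: "B \<in> \<A>" "chart \<theta>" "range \<theta> = \<Union>B" "B' \<in> \<A>" "chart \<theta>'" "range \<theta>' = \<Union>B'"
      using N by (auto simp: NC_def)
    obtain \<tau> where \<tau>: "\<tau> \<in> B" "\<theta> b \<in> \<tau>" using B(3) by blast
    have wX: "{\<theta> b} \<in> X" using \<tau> apartment_subcomplex(1)[OF B(1)] simplex_face[of \<tau> "{\<theta> b}"] by blast
    have "{\<theta> b} \<in> B" using apartment_full[OF B(1) wX] B(3) by blast
    moreover have "{\<theta> b} \<in> B'" using apartment_full[OF B(4) wX] B(6) bb by blast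
    ultimately have "{\<theta> b} \<in> B \<inter> B'" "?C \<in> B \<inter> B'" using NC_C N by blast+
    then obtain f where f: "complex_iso B B' f" "\<forall>x\<in>?C \<union> {\<theta> b}. f x = x"
      using bld B(1,4) unfolding affine_A_building_def building_def by blast
    have finj: "inj_on f (\<Union>B)" and fB: "f ` \<Union>B = \<Union>B'" and fim: "(\<lambda>\<sigma>. f ` \<sigma>) ` B = B'"
      using f(1) by (auto simp: complex_iso_def bij_betw_def)
    have "f (\<theta> b) = \<theta>' b"
    proof (rule chart_rigid[OF B(5) _ _ _ p, where ?a0.0 = a])
      show "f (\<theta> v) = f (\<theta> v') \<longleftrightarrow> (v, v') \<in> diag_rel d" for v v'
      proof -
        have "f (\<theta> v) = f (\<theta> v') \<longleftrightarrow> \<theta> v = \<theta> v'"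
          using finj B(3) by (metis inj_onD rangeI)
        then show ?thesis using chart_eq_iff[OF B(2)] by simp
      qed
      show "chamber (\<lambda>v. f (\<theta> v)) v q \<in> X" if "enumerates d q" for v q
      proof -
        have "chamber (\<lambda>v. f (\<theta> v)) v q = f ` chamber \<theta> v q" by (auto simp: chamber_def)
        moreover have "f ` chamber \<theta> v q \<in> B'"
          unfolding fim[symmetric] using chamber_in_apartment[OF B(1,3,2) that] by blast
        ultimately show ?thesis using apartment_subcomplex(1)[OF B(4)] by auto
      qed
      show "range (\<lambda>v. f (\<theta> v)) \<subseteq> range \<theta>'"
        unfolding B(6) fB[symmetric] B(3)[symmetric] image_image by (rule subset_refl)
      show "f (\<theta> (walk a p i)) = \<theta>' (walk a p i)" if "i \<le> d" for i
      proof -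
        have "\<psi> (walk a p i) \<in> ?C" using that by (simp add: chamber_def)
        then show ?thesis using N that f(2) by (simp add: NC_def)
      qed
    qed
    then have "\<theta>' b = \<theta>' b'" using f(2) bb by simp
    then show ?thesis using chart_eq_iff[OF B(5)] by simp
  qed
  have NC_A: "NC A \<psi>" using A by (simp add: NC_def)
  define \<rho> where "\<rho> = (\<lambda>w. \<psi> (SOME b. \<exists>B \<theta>. NC B \<theta> \<and> \<theta> b = w))"
  have \<rho>: "\<rho> (\<theta> b) = \<psi> b" if "NC B \<theta>" for B \<theta> b
  proof -
    define b' where "b' = (SOME b'. \<exists>B \<theta>'. NC B \<theta>' \<and> \<theta>' b' = \<theta> b)"
    have "\<exists>B \<theta>'. NC B \<theta>' \<and> \<theta>' b' = \<theta> b"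
      unfolding b'_def by (rule someI[of "\<lambda>b'. \<exists>B \<theta>'. NC B \<theta>' \<and> \<theta>' b' = \<theta> b" b]) (use that in blast)
    then obtain B' \<theta>' where "NC B' \<theta>'" "\<theta>' b' = \<theta> b" by blast
    then have "(b', b) \<in> diag_rel d" using wd[OF _ that] by blast
    moreover have "\<rho> (\<theta> b) = \<psi> b'" by (simp add: \<rho>_def b'_def)
    ultimately show ?thesis using chart_eq_iff[OF A(1)] by simp
  qed
  have through: "\<exists>B \<theta>. NC B \<theta> \<and> \<sigma> \<subseteq> range \<theta>" if \<sigma>: "\<sigma> \<in> X" for \<sigma>
  proof -
    obtain B where B: "B \<in> \<A>" "?C \<in> B" "\<sigma> \<in> B" using simplex_in_apartment[OF CX \<sigma>] by blast
    then obtain \<theta> where \<theta>: "NC B \<theta>" using NC_ex[OF B(1)] by blast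
    then have "\<sigma> \<subseteq> range \<theta>" using B(3) by (auto simp: NC_def)
    then show ?thesis using \<theta> by blast
  qed
  show thesis
  proof (rule that[of \<rho>])
    show "\<rho> (\<psi> b) = \<psi> b" for b by (rule \<rho>[OF NC_A])
    show "pointed X ori k (map \<rho> xs) \<and> \<rho> ` set xs \<subseteq> range \<psi>" if xs: "pointed X ori k xs" for k xs
    proof -
      obtain B \<theta> where \<theta>: "NC B \<theta>" "set xs \<subseteq> range \<theta>" using through[OF pointedD(1)[OF xs]] by blast
      then have "chart \<theta>" by (simp add: NC_def)
      from chart_pointedE[OF this \<theta>(2) xs] obtain v Js
        where Js: "flag d Js" "xs = verts \<theta> v Js @ [\<theta> v]" "length Js = k" by blast
      have "map \<rho> xs = verts \<psi> v Js @ [\<psi> v]" "\<rho> ` set xs \<subseteq> range \<psi>"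
        using Js(2) \<rho>[OF \<theta>(1)] by auto
      then show ?thesis using chart_pointedI[OF A(1) Js(1), of v] Js(3) by simp
    qed
    \<comment> \<open>Such a vertex has the coordinates of a vertex of the centre, where all
      normalized charts coincide.\<close>
    show "\<rho> w = w" if w: "w \<in> \<Union>X" "\<rho> w \<in> ?C" for w
    proof -
      have "{w} \<in> X" using w(1) simplex_face by blast
      then obtain B \<theta> where \<theta>: "NC B \<theta>" "{w} \<subseteq> range \<theta>" using through by blast
      then obtain b where b: "w = \<theta> b" by blast
      obtain i where i: "i \<le> d" "\<rho> w = \<psi> (walk a p i)" using w(2) by (auto simp: chamber_def)
      have "\<psi> b = \<psi> (walk a p i)" using \<rho>[OF \<theta>(1)] b i(2) by simp
      then have "\<theta> b = \<theta> (walk a p i)"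
        using chart_eq_iff[OF A(1)] chart_eq_iff[of \<theta>] \<theta>(1) by (simp add: NC_def)
      then show ?thesis using b i \<theta>(1) by (simp add: NC_def)
    qed
  qed
qed

end

section \<open>Directed distance from a vertex\<close>

definition coord_height :: "nat \<Rightarrow> (nat \<Rightarrow> int) \<Rightarrow> int" where
  "coord_height d m = (\<Sum>j\<le>d. m j) - int (d + 1) * Min (m ` {..d})"

definition min_coords :: "nat \<Rightarrow> (nat \<Rightarrow> int) \<Rightarrow> nat set" where
  "min_coords d m = {j. j \<le> d \<and> m j = Min (m ` {..d})}"

lemma Min_coords_le: "j \<le> d \<Longrightarrow> Min (m ` {..d}) \<le> m j" for m :: "nat \<Rightarrow> int"
  by (intro Min_le) auto

lemma min_coords_nonempty: "min_coords d m \<noteq> {}"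
proof -
  have "Min (m ` {..d}) \<in> m ` {..d}" by (intro Min_in) auto
  then obtain j where "j \<in> {..d}" "Min (m ` {..d}) = m j" by (elim imageE)
  then have "j \<in> min_coords d m" by (simp add: min_coords_def)
  then show ?thesis by blast
qed

lemma coord_height_nonneg: "0 \<le> coord_height d m"
proof -
  have "(\<Sum>j\<le>d. Min (m ` {..d})) \<le> (\<Sum>j\<le>d. m j)" by (intro sum_mono) (auto intro: Min_coords_le)
  then show ?thesis by (simp add: coord_height_def algebra_simps)
qed

lemma coord_height_diag:
  assumes "(a, b) \<in> diag_rel d"
  shows "coord_height d a = coord_height d b"
proof -
  obtain c where c: "\<forall>j\<le>d. a j = b j + c" using assms by (auto simp: diag_rel_def)
  have "a ` {..d} = (\<lambda>x. x + c) ` (b ` {..d})" using c by (force simp: image_image)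
  moreover have "Min ((\<lambda>x. x + c) ` (b ` {..d})) = Min (b ` {..d}) + c"
    by (rule mono_Min_commute[symmetric]) (auto simp: mono_def)
  moreover have "(\<Sum>j\<le>d. a j) = (\<Sum>j\<le>d. b j) + int (d + 1) * c"
    using c by (simp add: sum.distrib)
  ultimately show ?thesis by (simp add: coord_height_def algebra_simps)
qed

text \<open>The sum grows by \<open>card J\<close>; the minimum grows, by one, exactly when no
  minimal coordinate is left behind.\<close>

lemma coord_height_shift:
  assumes "J \<subseteq> {..d}"
  shows "coord_height d (shift a J) =
    coord_height d a + int (card J) - (if min_coords d a \<subseteq> J then int (d + 1) else 0)"
proof -
  let ?m = "Min (a ` {..d})"
  have "(\<Sum>j\<le>d. if j \<in> J then 1 else 0) = int (card J)"
    using assms by (simp add: sum.If_cases Int_absorb1)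
  then have sum: "(\<Sum>j\<le>d. shift a J j) = (\<Sum>j\<le>d. a j) + int (card J)"
    by (simp add: shift_def sum.distrib)
  obtain i where i: "i \<in> min_coords d a" using min_coords_nonempty by blast
  have "Min (shift a J ` {..d}) = ?m + (if min_coords d a \<subseteq> J then 1 else 0)"
  proof (rule Min_eqI)
    show "y \<ge> ?m + (if min_coords d a \<subseteq> J then 1 else 0)" if y: "y \<in> shift a J ` {..d}" for y
    proof -
      obtain j where j: "j \<le> d" "y = shift a J j" using y by auto
      have "?m \<le> a j" using Min_coords_le[OF j(1)] .
      moreover have "a j \<noteq> ?m \<or> j \<in> J" if "min_coords d a \<subseteq> J"
        using that j by (auto simp: min_coords_def)
      ultimately show ?thesis using j(2) by (auto simp: shift_def)
    qed
    show "?m + (if min_coords d a \<subseteq> J then 1 else 0) \<in> shift a J ` {..d}"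
    proof (cases "min_coords d a \<subseteq> J")
      case True
      then have "shift a J i = ?m + 1" using i by (auto simp: shift_def min_coords_def)
      then show ?thesis using i True by (force simp: min_coords_def)
    next
      case False
      then obtain j where "j \<in> min_coords d a" "j \<notin> J" by blast
      then show ?thesis using False by (force simp: min_coords_def shift_def)
    qed
  qed simp
  then show ?thesis using sum by (simp add: coord_height_def algebra_simps)
qed

lemma coord_height_zero: "coord_height d (\<lambda>_. 0) = 0"
  by (simp add: coord_height_def image_constant_conv)

lemma flag_singleton: "flag d Js \<Longrightarrow> J \<in> set Js \<Longrightarrow> flag d [J]"
  by (simp add: flag_def)

context oriented_building
begin

text \<open>The enumeration runs through a whole chamber, so the first set of its flag in any chart
  is a singleton and the step from \<open>x\<close> to \<open>z\<close> adds a unit vector. This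
  encodes the step without reference to a chart.\<close>

definition arrow :: "'v \<Rightarrow> 'v \<Rightarrow> bool" where
  "arrow x z \<longleftrightarrow> (\<exists>ys. pointed X ori d (z # ys @ [x]))"

primrec directed_path :: "'v \<Rightarrow> nat \<Rightarrow> 'v \<Rightarrow> bool" where
  "directed_path b 0 v \<longleftrightarrow> v = b"
| "directed_path b (Suc n) v \<longleftrightarrow> (\<exists>u. directed_path b n u \<and> arrow u v)"

definition height :: "'v \<Rightarrow> 'v \<Rightarrow> nat" where
  "height b v = (LEAST n. directed_path b n v)"

definition retracts :: "('v \<Rightarrow> 'v) \<Rightarrow> ((nat \<Rightarrow> int) \<Rightarrow> 'v) \<Rightarrow> bool" where
  "retracts \<rho> \<psi> \<longleftrightarrow> (\<forall>b. \<rho> (\<psi> b) = \<psi> b) \<and>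
    (\<forall>k xs. pointed X ori k xs \<longrightarrow> pointed X ori k (map \<rho> xs) \<and> \<rho> ` set xs \<subseteq> range \<psi>)"

definition based_chart :: "'v \<Rightarrow> ((nat \<Rightarrow> int) \<Rightarrow> 'v) \<Rightarrow> bool" where
  "based_chart b \<psi> \<longleftrightarrow> apt_chart \<psi> \<and> \<psi> (\<lambda>_. 0) = b"

lemma apt_chartD: "apt_chart \<psi> \<Longrightarrow> chart \<psi>"
  by (simp add: apt_chart_def)

lemma based_chartD: "based_chart b \<psi> \<Longrightarrow> chart \<psi>" "based_chart b \<psi> \<Longrightarrow> apt_chart \<psi>"
  "based_chart b \<psi> \<Longrightarrow> \<psi> (\<lambda>_. 0) = b"
  by (simp_all add: apt_chart_def based_chart_def)

lemma retraction:
  assumes "apt_chart \<psi>" "enumerates d p"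
  obtains \<rho> where "retracts \<rho> \<psi>" "\<And>w. w \<in> \<Union>X \<Longrightarrow> \<rho> w \<in> chamber \<psi> a p \<Longrightarrow> \<rho> w = w"
proof (rule retraction_exists[OF assms, where a = a])
  fix \<rho>
  assume f: "\<And>b. \<rho> (\<psi> b) = \<psi> b"
    and r: "\<And>k xs. pointed X ori k xs \<Longrightarrow> pointed X ori k (map \<rho> xs) \<and> \<rho> ` set xs \<subseteq> range \<psi>"
    and c: "\<And>w. w \<in> \<Union>X \<Longrightarrow> \<rho> w \<in> chamber \<psi> a p \<Longrightarrow> \<rho> w = w"
  have "retracts \<rho> \<psi>"
    unfolding retracts_def by (intro conjI allI impI) (rule f, rule conjunct1[OF r], assumption,
      rule conjunct2[OF r], assumption)
  from this c show thesis by (rule that)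
qed

lemma retraction':
  assumes "apt_chart \<psi>"
  obtains \<rho> where "retracts \<rho> \<psi>"
proof -
  have "enumerates d [0..<d + 1]" by (auto simp: enumerates_def)
  then show thesis using retraction[OF assms] that by metis
qed

lemma based_chart_containing:
  assumes "{b} \<in> X" "\<sigma> \<in> X"
  obtains \<psi> where "based_chart b \<psi>" "\<sigma> \<subseteq> range \<psi>"
proof -
  obtain \<psi> where \<psi>: "apt_chart \<psi>" "\<sigma> \<subseteq> range \<psi>" "{b} \<subseteq> range \<psi>"
    using apt_chart_containing[OF assms(2,1)] by blast
  then obtain a where a: "b = \<psi> a" by blast
  have c: "chart \<psi>" using \<psi>(1) by (simp add: apt_chart_def)
  show thesis
  proof (rule that[of "\<lambda>v. \<psi> (\<lambda>j. a j + v j)"])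
    show "based_chart b (\<lambda>v. \<psi> (\<lambda>j. a j + v j))"
      using chart_translate[OF c, of a] \<psi>(1) a by (simp add: based_chart_def apt_chart_def)
    show "\<sigma> \<subseteq> range (\<lambda>v. \<psi> (\<lambda>j. a j + v j))"
      using chart_translate(2)[OF c, of a] \<psi>(2) by simp
  qed
qed

lemma retract_pointed_last:
  assumes "retracts \<rho> \<psi>" "chart \<psi>" "pointed X ori k (ys @ [x])" "\<rho> x = \<psi> a"
  obtains Js where "flag d Js" "map \<rho> ys = verts \<psi> a Js" "length Js = k"
proof -
  have 1: "pointed X ori k (map \<rho> (ys @ [x]))" "set (map \<rho> (ys @ [x])) \<subseteq> range \<psi>"
    using assms(1,3) unfolding retracts_def set_map by blast+
  have 2: "last (map \<rho> (ys @ [x])) = \<psi> a" using assms(4) by simp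
  obtain Js where Js: "flag d Js" "map \<rho> (ys @ [x]) = verts \<psi> a Js @ [\<psi> a]" "length Js = k"
    by (rule chart_pointedE_last[OF assms(2) 1(2,1) 2])
  from Js(2) have "map \<rho> ys = verts \<psi> a Js" by simp
  with Js(1) show thesis using Js(3) by (rule that)
qed

lemma arrow_chart:
  assumes "chart \<psi>" "j \<le> d"
  shows "arrow (\<psi> a) (\<psi> (shift a {j}))"
proof -
  obtain ys where ys: "distinct ys" "set ys = {..d} - {j}"
    using finite_distinct_list[of "{..d} - {j}"] by auto
  then have e: "enumerates d (j # ys)" using assms(2) by (auto simp: enumerates_def)
  have l: "length (j # ys) = d + 1" using length_enumerates[OF e] .
  define ps where "ps = prefixes (j # ys)"
  have "ps \<noteq> []" using l d_pos by (auto simp: ps_def prefixes_def)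
  moreover have "ps ! 0 = {j}" using l d_pos by (simp add: ps_def)
  ultimately have "ps = {j} # tl ps" by (cases ps) auto
  then have "verts \<psi> a ps @ [\<psi> a] =
      \<psi> (shift a {j}) # verts \<psi> a (tl ps) @ [\<psi> a]"
    by (metis append_Cons list.simps(9))
  then show ?thesis using chamber_pointed[OF assms(1) e, of a] unfolding arrow_def ps_def by metis
qed

lemma arrow_retract:
  assumes "retracts \<rho> \<psi>" "chart \<psi>" "arrow x z" "\<rho> x = \<psi> a"
  shows "\<exists>j\<le>d. \<rho> z = \<psi> (shift a {j})"
proof -
  obtain ys where ys: "pointed X ori d ((z # ys) @ [x])" using assms(3) by (auto simp: arrow_def)
  obtain Js where Js: "flag d Js" "map \<rho> (z # ys) = verts \<psi> a Js" "length Js = d"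
    using retract_pointed_last[OF assms(1,2) ys assms(4)] by blast
  obtain p where p: "enumerates d p" "Js = prefixes p" using full_flag Js by blast
  have l: "length p = d + 1" using length_enumerates[OF p(1)] .
  then obtain j p' where jp: "p = j # p'" by (cases p) auto
  have "\<rho> z = \<psi> (shift a (Js ! 0))" using Js(2,3) d_pos by (cases Js) auto
  moreover have "Js ! 0 = {j}" using p(2) l d_pos jp by simp
  moreover have "j \<le> d" using p(1) jp by (auto simp: enumerates_def)
  ultimately show ?thesis by auto
qed

text \<open>Retractions carry arrows to unit steps of the apartment, and a unit step raises
  \<open>coord_height\<close> by at most one.\<close>

lemma directed_path_retract:
  assumes "based_chart b \<psi>" "retracts \<rho> \<psi>" "directed_path b n v"
  shows "\<exists>m. \<rho> v = \<psi> m \<and> coord_height d m \<le> int n"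
  using assms(3)
proof (induction n arbitrary: v)
  case 0
  then have "\<rho> v = \<psi> (\<lambda>_. 0)"
    using based_chartD(3)[OF assms(1)] assms(2) unfolding retracts_def by auto
  then show ?case using coord_height_zero by auto
next
  case (Suc n)
  then obtain u where u: "directed_path b n u" "arrow u v" by auto
  then obtain m where m: "\<rho> u = \<psi> m" "coord_height d m \<le> int n" using Suc.IH by blast
  obtain j where j: "j \<le> d" "\<rho> v = \<psi> (shift m {j})"
    using arrow_retract[OF assms(2) based_chartD(1)[OF assms(1)] u(2) m(1)] by blast
  have "coord_height d (shift m {j}) \<le> coord_height d m + 1"
    using coord_height_shift[of "{j}" d m] j(1) by auto
  then show ?case using m j by (intro exI[of _ "shift m {j}"]) auto
qed

lemma directed_path_nonneg:
  assumes "based_chart b \<psi>" "\<forall>j\<le>d. 0 \<le> m j" "(\<Sum>j\<le>d. m j) = int n"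
  shows "directed_path b n (\<psi> m)"
proof (rule shift_induct_count[where R = "\<lambda>n m. directed_path b n (\<psi> m)" and a = "\<lambda>_. 0"])
  have c: "chart \<psi>" using based_chartD(1)[OF assms(1)] .
  show "directed_path b 0 (\<psi> m)" if "\<forall>j\<le>d. m j = 0" for m
    using based_chartD(3)[OF assms(1)] chart_eq_iff[OF c, of m "\<lambda>_. 0"] that
    by (auto simp: diag_rel_def)
  show "directed_path b (Suc n) (\<psi> (shift m {j}))" if "directed_path b n (\<psi> m)" "j \<le> d" for n m j
    using that arrow_chart[OF c] by auto
qed (use assms in auto)

lemma directed_path_coord:
  assumes "based_chart b \<psi>"
  shows "directed_path b (nat (coord_height d m)) (\<psi> m)"
proof -
  \<comment> \<open>Subtracting the minimum leaves nonnegative coordinates whose sum is the height,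
    so it can be reached by that many unit steps from the origin.\<close>
  define m' where "m' = (\<lambda>j. m j - Min (m ` {..d}))"
  have "m j = m' j + Min (m ` {..d})" for j unfolding m'_def by linarith
  then have "(m, m') \<in> diag_rel d" unfolding diag_rel_def by blast
  then have "\<psi> m = \<psi> m'" using chart_eq_iff[OF based_chartD(1)[OF assms]] by simp
  moreover have "directed_path b (nat (coord_height d m)) (\<psi> m')"
  proof (rule directed_path_nonneg[OF assms])
    show "\<forall>j\<le>d. 0 \<le> m' j" using Min_coords_le by (simp add: m'_def)
    have "(\<Sum>j\<le>d. m' j) = coord_height d m"
      by (simp add: m'_def coord_height_def sum_subtractf)
    then show "(\<Sum>j\<le>d. m' j) = int (nat (coord_height d m))" using coord_height_nonneg by simp
  qed
  ultimately show ?thesis by simp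
qed

text \<open>No detour outside the apartment is shorter: a directed path can be retracted onto the
  apartment without moving its end point.\<close>

lemma height_chart:
  assumes "based_chart b \<psi>"
  shows "int (height b (\<psi> m)) = coord_height d m"
proof -
  have "height b (\<psi> m) = nat (coord_height d m)"
    unfolding height_def
  proof (rule Least_equality)
    show "directed_path b (nat (coord_height d m)) (\<psi> m)" by (rule directed_path_coord[OF assms])
    fix n assume n: "directed_path b n (\<psi> m)"
    obtain \<rho> where \<rho>: "retracts \<rho> \<psi>" using retraction'[OF based_chartD(2)[OF assms]] by blast
    obtain m' where m': "\<rho> (\<psi> m) = \<psi> m'" "coord_height d m' \<le> int n"
      using directed_path_retract[OF assms \<rho> n] by blast
    have "\<psi> m = \<psi> m'" using m'(1) \<rho> by (simp add: retracts_def)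
    then have "coord_height d m = coord_height d m'"
      using coord_height_diag chart_eq_iff[OF based_chartD(1)[OF assms]] by simp
    then show "nat (coord_height d m) \<le> n" using m'(2) by simp
  qed
  then show ?thesis using coord_height_nonneg by simp
qed

text \<open>A shortest directed path to \<open>v\<close> is retracted and bounds the height of the
  image.\<close>

lemma height_retract:
  assumes "based_chart b \<psi>" "retracts \<rho> \<psi>" "{b} \<in> X" "v \<in> \<Union>X"
  shows "height b (\<rho> v) \<le> height b v"
proof -
  have "{v} \<in> X" using assms(4) simplex_face by blast
  then obtain \<theta> where \<theta>: "based_chart b \<theta>" "{v} \<subseteq> range \<theta>"
    using based_chart_containing[OF assms(3)] by blast
  then obtain m0 where "v = \<theta> m0" by blast
  then have "\<exists>n. directed_path b n v" using directed_path_coord[OF \<theta>(1)] by blast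
  then have "directed_path b (height b v) v" unfolding height_def by (rule LeastI_ex)
  then obtain m where "\<rho> v = \<psi> m" "coord_height d m \<le> int (height b v)"
    using directed_path_retract[OF assms(1,2)] by blast
  then show ?thesis using height_chart[OF assms(1), of m] by simp
qed

section \<open>Heights on the vertices of a simplex\<close>

lemma height_base: "height b b = 0"
  unfolding height_def by (rule Least_equality) auto

abbreviation height_sorted :: "'v \<Rightarrow> 'v list \<Rightarrow> bool" where
  "height_sorted b \<equiv> sorted_wrt (\<lambda>u v. height b u < height b v)"

text \<open>The enumeration ending in a highest vertex works. A shift by J missing a minimal
  coordinate would raise the height, so every J in the flag contains \<open>min_coords d a\<close>,
  and then the height increases with \<open>card J\<close>.\<close>

lemma height_sorted_enumeration:
  assumes b: "{b} \<in> X" and \<sigma>: "\<sigma> \<in> X"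
  obtains xs where "pointed X ori (card \<sigma> - 1) xs" "set xs = \<sigma>" "height_sorted b xs"
proof -
  have fin: "finite (height b ` \<sigma>)" "height b ` \<sigma> \<noteq> {}"
    using simplex_finite[OF \<sigma>] simplex_nonempty[OF \<sigma>] by auto
  obtain x where x: "x \<in> \<sigma>" "height b x = Max (height b ` \<sigma>)"
    using Max_in[OF fin] by (metis imageE)
  have max: "height b y \<le> height b x" if "y \<in> \<sigma>" for y
    using Max_ge[OF fin(1)] that x(2) by simp
  obtain ys where ys: "pointed X ori (length ys) (ys @ [x])" "set (ys @ [x]) = \<sigma>"
    using pointed_ending[OF \<sigma> x(1)] by blast
  obtain \<psi> where \<psi>: "based_chart b \<psi>" "\<sigma> \<subseteq> range \<psi>" using based_chart_containing[OF b \<sigma>] by blast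
  obtain a where a: "x = \<psi> a" using x(1) \<psi>(2) by blast
  have "set ys \<subseteq> range \<psi>" using ys(2) \<psi>(2) by auto
  then obtain Js where Js: "flag d Js" "ys = verts \<psi> a Js"
    using ys(1) chart_pointed_iff[OF based_chartD(1)[OF \<psi>(1)]] a by blast
  have h: "int (height b (\<psi> (shift a J))) = coord_height d a + int (card J) - int (d + 1)"
    if J: "J \<in> set Js" for J
  proof -
    have J': "J \<subseteq> {..d}" "1 \<le> card J" using J Js(1) flag_card_bounds[OF Js(1) J] by (auto simp: flag_def)
    have "\<psi> (shift a J) \<in> \<sigma>" using J Js(2) ys(2) by auto
    then have "height b (\<psi> (shift a J)) \<le> height b (\<psi> a)" using max a by simp
    then have "int (height b (\<psi> (shift a J))) \<le> coord_height d a"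
      unfolding height_chart[OF \<psi>(1), of a, symmetric] by simp
    moreover have "int (height b (\<psi> (shift a J))) = coord_height d a + int (card J) -
        (if min_coords d a \<subseteq> J then int (d + 1) else 0)"
      using coord_height_shift[OF J'(1), of a] height_chart[OF \<psi>(1), of "shift a J"] by simp
    ultimately show ?thesis using J'(2) by (cases "min_coords d a \<subseteq> J") simp_all
  qed
  have "sorted_wrt (\<lambda>J K. height b (\<psi> (shift a J)) < height b (\<psi> (shift a K))) Js"
  proof (rule sorted_wrt_mono_rel[of _ "(\<subset>)"])
    show "sorted_wrt (\<subset>) Js" using Js(1) by (simp add: flag_def)
    fix J K assume "J \<in> set Js" "K \<in> set Js" "J \<subset> K"
    moreover from this have "card J < card K" using psubset_card_mono flag_finite[OF Js(1)] by blast
    ultimately show "height b (\<psi> (shift a J)) < height b (\<psi> (shift a K))" using h[of J] h[of K] by simp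
  qed
  moreover have "height b (\<psi> (shift a J)) < height b x" if "J \<in> set Js" for J
    using h[OF that] flag_card_bounds[OF Js(1) that] height_chart[OF \<psi>(1), of a] a by simp
  ultimately have "height_sorted b (ys @ [x])"
    unfolding Js(2) by (auto simp: sorted_wrt_append sorted_wrt_map)
  moreover have "card \<sigma> - 1 = length ys"
    using pointedD(2)[OF ys(1)] ys(2) distinct_card[of "ys @ [x]"] by simp
  ultimately show thesis using that ys by metis
qed

text \<open>A pointed enumeration is determined by its first entry, so one that starts at the lowest
  vertex is the sorted one.\<close>

lemma height_sorted_from_min:
  assumes "{b} \<in> X" "pointed X ori k (v # xs)" "\<And>x. x \<in> set xs \<Longrightarrow> height b v < height b x"
  shows "height_sorted b (v # xs)"
proof -
  have X: "set (v # xs) \<in> X" using pointedD[OF assms(2)] by simp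
  obtain ws where ws: "pointed X ori (card (set (v # xs)) - 1) ws" "set ws = set (v # xs)"
    "height_sorted b ws"
    using height_sorted_enumeration[OF assms(1) X] by blast
  then obtain w ws' where w: "ws = w # ws'" by (cases ws) auto
  have "w = v"
  proof (rule ccontr)
    assume "w \<noteq> v"
    then have "height b w < height b v" using ws w by auto
    moreover have "w \<in> set xs" using \<open>w \<noteq> v\<close> ws(2) w by auto
    ultimately show False using assms(3) by fastforce
  qed
  then have "ws = v # xs" using pointed_unique[OF ws(1) assms(2) ws(2)] w by simp
  then show ?thesis using ws(3) by simp
qed

lemma pointed_edge:
  assumes "pointed X ori k (ys @ [x])" "v \<in> set ys"
  shows "pointed X ori 1 [v, x]"
proof -
  obtain \<psi> where \<psi>: "apt_chart \<psi>" "set (ys @ [x]) \<subseteq> range \<psi>"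
    using apt_chart_containing pointedD(1)[OF assms(1)] by metis
  obtain a Js where Js: "flag d Js" "ys @ [x] = verts \<psi> a Js @ [\<psi> a]"
    using chart_pointedE[OF apt_chartD[OF \<psi>(1)] \<psi>(2) assms(1)] by blast
  then obtain J where J: "J \<in> set Js" "v = \<psi> (shift a J)" using assms(2) by auto
  have "flag d [J]" using Js(1) J(1) by (auto simp: flag_def)
  from chart_pointedI[OF apt_chartD[OF \<psi>(1)] this, of a] show ?thesis using J(2) Js(2) by simp
qed

section \<open>The nearest neighbour and the bracket\<close>

definition nearest :: "'v \<Rightarrow> 'v \<Rightarrow> 'v \<Rightarrow> bool" where
  "nearest b x v \<longleftrightarrow> pointed X ori 1 [v, x] \<and> height b v < height b x \<and>
     (\<forall>w. pointed X ori 1 [w, x] \<longrightarrow> w \<noteq> v \<longrightarrow> height b v < height b w)"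

lemma nearest_unique: "nearest b x v \<Longrightarrow> nearest b x w \<Longrightarrow> v = w"
  unfolding nearest_def by (metis less_asym)

text \<open>Retracting a competing neighbour \<open>w\<close> onto the apartment does not increase its height, and
  the least height is attained only once within the apartment; so \<open>w\<close> retracts onto the candidate,
  which lies in the centre of the retraction.\<close>

lemma nearest_chart:
  assumes \<psi>: "based_chart b \<psi>" and b: "{b} \<in> X" and x: "\<psi> a \<noteq> b"
  shows "flag d [min_coords d a]" "nearest b (\<psi> a) (\<psi> (shift a (min_coords d a)))"
proof -
  let ?I = "min_coords d a"
  let ?v = "\<psi> (shift a ?I)"
  have c: "chart \<psi>" using based_chartD[OF \<psi>] by simp
  \<comment> \<open>All coordinates are minimal only on the diagonal, which represents the base
    point.\<close>
  have "?I \<noteq> {..d}"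
  proof
    assume I: "?I = {..d}"
    have "a j = (\<lambda>_. 0) j + Min (a ` {..d})" if "j \<le> d" for j
    proof -
      have "j \<in> ?I" using I that by blast
      then show ?thesis by (simp add: min_coords_def)
    qed
    then have "(a, \<lambda>_. 0) \<in> diag_rel d" unfolding diag_rel_def by blast
    then show False using x chart_eq_iff[OF c] based_chartD(3)[OF \<psi>] by metis
  qed
  then show fl: "flag d [?I]"
    using min_coords_nonempty by (auto simp: flag_def min_coords_def)
  then have I: "?I \<subset> {..d}" "?I \<noteq> {}" by (auto simp: flag_def)
  have cI: "card ?I \<le> d" using flag_card_bounds[OF fl, of ?I] by simp
  have hv: "int (height b ?v) = coord_height d a + int (card ?I) - int (d + 1)"
    using height_chart[OF \<psi>, of "shift a ?I"] coord_height_shift[of ?I d a] I by simp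
  have v: "pointed X ori 1 [?v, \<psi> a]" using chart_pointedI[OF c fl, of a] by simp
  moreover have "height b ?v < height b (\<psi> a)" using hv cI height_chart[OF \<psi>, of a] by simp
  moreover have "height b ?v < height b w" if w: "pointed X ori 1 [w, \<psi> a]" "w \<noteq> ?v" for w
  proof -
    obtain p where p: "enumerates d p" "\<forall>J\<in>set [?I]. J = set (take (card J) p)"
      using flag_refine[OF fl] by blast
    obtain \<rho> where \<rho>: "retracts \<rho> \<psi>" "\<And>w. w \<in> \<Union>X \<Longrightarrow> \<rho> w \<in> chamber \<psi> a p \<Longrightarrow> \<rho> w = w"
      using retraction[OF based_chartD(2)[OF \<psi>] p(1), of a] by blast
    have wX: "w \<in> \<Union>X" using pointedD(1)[OF w(1)] by auto
    have "\<rho> (\<psi> a) = \<psi> a" using \<rho>(1) by (simp add: retracts_def)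
    then obtain Js where Js: "flag d Js" "map \<rho> [w] = verts \<psi> a Js" "length Js = 1"
      using retract_pointed_last[OF \<rho>(1) c, of 1 "[w]" "\<psi> a" a] w(1) by auto
    then obtain J where J: "flag d [J]" "\<rho> w = \<psi> (shift a J)" by (cases Js) auto
    have J': "J \<subseteq> {..d}" "1 \<le> card J" "finite J"
      using J(1) flag_card_bounds[OF J(1), of J] flag_finite[OF J(1), of J] by (auto simp: flag_def)
    have "J \<noteq> ?I"
    proof
      assume "J = ?I"
      moreover have "?v \<in> chamber \<psi> a p"
        using p(2) cI unfolding chamber_def by (intro image_eqI[of _ _ "card ?I"]) simp_all
      ultimately show False using \<rho>(2)[OF wX] J(2) w(2) by simp
    qed
    \<comment> \<open>Proper supersets of \<open>?I\<close> give a smaller descent, and sets missing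
      a minimal coordinate give none.\<close>
    have "coord_height d (shift a ?I) < coord_height d (shift a J)"
    proof (cases "?I \<subseteq> J")
      case True
      then have "card ?I < card J" using \<open>J \<noteq> ?I\<close> J'(3) by (intro psubset_card_mono) auto
      then show ?thesis using True coord_height_shift[OF J'(1), of a] coord_height_shift[of ?I d a] I by simp
    next
      case False
      then show ?thesis using coord_height_shift[OF J'(1), of a] coord_height_shift[of ?I d a] I cI by auto
    qed
    then have "height b ?v < height b (\<rho> w)"
      using height_chart[OF \<psi>, of "shift a ?I"] height_chart[OF \<psi>, of "shift a J"] J(2) by simp
    also have "\<dots> \<le> height b w" by (rule height_retract[OF \<psi> \<rho>(1) b wX])
    finally show ?thesis .
  qed
  ultimately show "nearest b (\<psi> a) ?v" unfolding nearest_def by blast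
qed

section \<open>The length \<open>ell\<close> in coordinates\<close>

lemma flag_Cons_length:
  assumes "flag d (J # Js)"
  shows "length (J # Js) + card J \<le> d + 1"
  using assms
proof (induction Js arbitrary: J)
  case Nil
  then show ?case using flag_card_bounds[of d "[J]" J] by simp
next
  case (Cons K Js)
  have "flag d (K # Js)" using Cons.prems by (simp add: flag_def)
  moreover have "card J < card K"
    using Cons.prems flag_finite[OF Cons.prems, of K] by (intro psubset_card_mono) (auto simp: flag_def)
  ultimately show ?case using Cons.IH by fastforce
qed

text \<open>A longest flag starts at J and adds one element at a time. Pointed simplices outside the
  apartment do no better: a retraction fixes both end vertices and preserves the dimension.\<close>

lemma ell_chart:
  assumes \<psi>: "apt_chart \<psi>" and J: "flag d [J]" and xs: "hd xs = \<psi> (shift a J)" "last xs = \<psi> a"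
  shows "ell X ori xs = d + 1 - card J"
proof -
  have c: "chart \<psi>" using \<psi> by (rule apt_chartD)
  have J': "J \<subset> {..d}" "J \<noteq> {}" "1 \<le> card J" "card J \<le> d"
    using J flag_card_bounds[OF J, of J] by (auto simp: flag_def)
  obtain p where p: "enumerates d p" "J = set (take (card J) p)"
    using flag_refine[OF J] by auto
  define Ks where "Ks = drop (card J - 1) (prefixes p)"
  have lp: "length p = d + 1" using length_enumerates[OF p(1)] .
  have Ks: "flag d Ks" "length Ks = d + 1 - card J" "hd Ks = J"
  proof -
    show "flag d Ks" using flag_prefixes[OF p(1)] set_drop_subset[of "card J - 1" "prefixes p"]
      by (auto simp: flag_def Ks_def sorted_wrt_drop)
    show "length Ks = d + 1 - card J" using lp J' by (simp add: Ks_def)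
    show "hd Ks = J" using lp J' p(2) by (simp add: Ks_def hd_drop_conv_nth)
  qed
  show ?thesis unfolding ell_def
  proof (rule Greatest_equality)
    have "Ks \<noteq> []" using Ks(2) J' by auto
    then show "\<exists>ys. pointed X ori (d + 1 - card J) ys \<and> hd ys = hd xs \<and> last ys = last xs"
      using chart_pointedI[OF c Ks(1), of a] Ks(2,3) xs
      by (intro exI[of _ "verts \<psi> a Ks @ [\<psi> a]"]) (simp add: hd_map hd_append)
  next
    fix r assume "\<exists>ys. pointed X ori r ys \<and> hd ys = hd xs \<and> last ys = last xs"
    then obtain ys where ys: "pointed X ori r ys" "hd ys = \<psi> (shift a J)" "last ys = \<psi> a"
      using xs by auto
    obtain \<rho> where \<rho>: "retracts \<rho> \<psi>" using retraction'[OF \<psi>] by blast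
    have ne: "ys \<noteq> []" using pointedD(3)[OF ys(1)] by auto
    have last: "last (map \<rho> ys) = \<psi> a" using ys(3) ne \<rho> by (simp add: last_map retracts_def)
    have \<rho>ys: "pointed X ori r (map \<rho> ys)" "set (map \<rho> ys) \<subseteq> range \<psi>"
      using \<rho> ys(1) unfolding retracts_def set_map by blast+
    obtain Js where Js: "flag d Js" "map \<rho> ys = verts \<psi> a Js @ [\<psi> a]" "length Js = r"
      by (rule chart_pointedE_last[OF c \<rho>ys(2,1) last])
    have hd: "hd (map \<rho> ys) = \<psi> (shift a J)" using ys(2) ne \<rho> by (simp add: hd_map retracts_def)
    show "r \<le> d + 1 - card J"
    proof (cases Js)
      case Nil
      then show ?thesis using Js(3) by simp
    next
      case (Cons K Js')
      then have "\<psi> (shift a K) = \<psi> (shift a J)" using hd Js(2) by simp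
      then have "K = J" using chart_shift_inj[OF c] Js(1) Cons J' by (auto simp: flag_def)
      then show ?thesis using flag_Cons_length Js Cons by fastforce
    qed
  qed
qed

text \<open>The position of \<open>w\<close> in a pointed chamber ending in \<open>x\<close> gives
  the cardinality of its set, and retractions preserve positions. So \<open>ell\<close> can be read
  off from the image even when the edge lies outside the apartment.\<close>

lemma ell_retract:
  assumes \<psi>: "apt_chart \<psi>" and \<rho>: "retracts \<rho> \<psi>" "\<rho> x = \<psi> a" and w: "pointed X ori 1 [w, x]"
    and xs: "hd xs = w" "last xs = x"
  shows "\<exists>Q. flag d [Q] \<and> \<rho> w = \<psi> (shift a Q) \<and> ell X ori xs = d + 1 - card Q"
proof -
  obtain \<theta> where \<theta>: "apt_chart \<theta>" "set [w, x] \<subseteq> range \<theta>"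
    using apt_chart_containing pointedD(1)[OF w] by metis
  have c: "chart \<theta>" "chart \<psi>" using \<theta> \<psi> by (auto intro: apt_chartD)
  obtain e Ls where L: "flag d Ls" "[w, x] = verts \<theta> e Ls @ [\<theta> e]" "length Ls = 1"
    using chart_pointedE[OF c(1) \<theta>(2) w] by blast
  then obtain J where "Ls = [J]" by (cases Ls) auto
  then have J: "flag d [J]" "w = \<theta> (shift e J)" "x = \<theta> e" using L by auto
  have cJ: "1 \<le> card J" "card J \<le> d" using flag_card_bounds[OF J(1), of J] by auto
  have ell: "ell X ori xs = d + 1 - card J" using ell_chart[OF \<theta>(1) J(1)] J xs by simp
  obtain p where p: "enumerates d p" "J = set (take (card J) p)"
    using flag_refine[OF J(1)] by auto
  have lp: "length p = d + 1" using length_enumerates[OF p(1)] .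
  obtain Js where Js: "flag d Js" "map \<rho> (verts \<theta> e (prefixes p)) = verts \<psi> a Js"
      "length Js = d"
    using retract_pointed_last[OF \<rho>(1) c(2) chamber_pointed[OF c(1) p(1), of e]] \<rho>(2) J(3) by metis
  obtain q where q: "enumerates d q" "Js = prefixes q" using full_flag Js by blast
  have lq: "length q = d + 1" using length_enumerates[OF q(1)] .
  let ?i = "card J - 1"
  have i: "?i < d" "Suc ?i = card J" using cJ by auto
  have "map \<rho> (verts \<theta> e (prefixes p)) ! ?i = \<rho> w"
    using i lp p(2) J(2) by simp
  moreover have "verts \<psi> a Js ! ?i = \<psi> (walk a q (card J))"
    using i lq q(2) by simp
  ultimately have "\<rho> w = \<psi> (walk a q (card J))" using Js(2) by simp
  moreover have "flag d [set (take (card J) q)]"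
  proof -
    have "prefixes q ! ?i \<in> set (prefixes q)" using i lq by (intro nth_mem) simp
    moreover have "prefixes q ! ?i = set (take (card J) q)" using i lq by simp
    ultimately show ?thesis using flag_singleton[OF flag_prefixes[OF q(1)]] by metis
  qed
  moreover have "card (set (take (card J) q)) = card J"
    using card_set_take_enum[OF q(1) cJ(2)] .
  ultimately show ?thesis using ell by (intro exI[of _ "set (take (card J) q)"]) simp
qed

section \<open>Neighbours of a pointed simplex in one chart\<close>

lemma pointed_Cons_iff:
  assumes "chart \<psi>" "flag d Ks" "z \<in> range \<psi>"
  shows "pointed X ori (length (verts \<psi> a Ks @ [\<psi> a])) (z # verts \<psi> a Ks @ [\<psi> a]) \<longleftrightarrow>
    (\<exists>J. flag d (J # Ks) \<and> z = \<psi> (shift a J))"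
proof -
  have "set (z # verts \<psi> a Ks) \<subseteq> range \<psi>" using assms(3) by auto
  then have "pointed X ori (length Ks + 1) ((z # verts \<psi> a Ks) @ [\<psi> a]) \<longleftrightarrow>
      (\<exists>Js. flag d Js \<and> z # verts \<psi> a Ks = verts \<psi> a Js)"
    by (rule chart_pointed_iff[OF assms(1)]) simp
  also have "\<dots> \<longleftrightarrow> (\<exists>J. flag d (J # Ks) \<and> z = \<psi> (shift a J))"
  proof
    assume "\<exists>Js. flag d Js \<and> z # verts \<psi> a Ks = verts \<psi> a Js"
    then obtain J Js where J: "flag d (J # Js)" "z = \<psi> (shift a J)" "verts \<psi> a Js = verts \<psi> a Ks"
      by (auto simp: Cons_eq_map_conv)
    moreover have "flag d Js" using J(1) by (simp add: flag_def)
    ultimately have "Js = Ks" using chart_map_shift_inj[OF assms(1) _ assms(2)] by blast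
    then show "\<exists>J. flag d (J # Ks) \<and> z = \<psi> (shift a J)" using J by blast
  next
    assume "\<exists>J. flag d (J # Ks) \<and> z = \<psi> (shift a J)"
    then show "\<exists>Js. flag d Js \<and> z # verts \<psi> a Ks = verts \<psi> a Js"
      by (metis list.simps(9))
  qed
  finally show ?thesis by simp
qed

text \<open>The order on neighbours becomes inclusion of sets, which will turn the bracket into an
  intersection.\<close>

lemma pointed_Cons_Cons_iff:
  assumes "chart \<psi>" "flag d (J # Ks)" "flag d (K # Ks)"
  shows "pointed X ori (length (verts \<psi> a Ks @ [\<psi> a]) + 1)
    (\<psi> (shift a J) # \<psi> (shift a K) # verts \<psi> a Ks @ [\<psi> a]) \<longleftrightarrow> J \<subset> K"
proof -
  have "pointed X ori (length (verts \<psi> a Ks @ [\<psi> a]) + 1)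
      (\<psi> (shift a J) # \<psi> (shift a K) # verts \<psi> a Ks @ [\<psi> a]) \<longleftrightarrow>
      (\<exists>J'. flag d (J' # K # Ks) \<and> \<psi> (shift a J) = \<psi> (shift a J'))"
    using pointed_Cons_iff[OF assms(1,3), of "\<psi> (shift a J)" a] by simp
  also have "\<dots> \<longleftrightarrow> flag d (J # K # Ks)"
  proof
    assume "\<exists>J'. flag d (J' # K # Ks) \<and> \<psi> (shift a J) = \<psi> (shift a J')"
    then obtain J' where J': "flag d (J' # K # Ks)" "\<psi> (shift a J) = \<psi> (shift a J')" by blast
    have "J = J'"
      by (rule chart_shift_inj[OF assms(1) J'(2)]) (use J'(1) assms(2) in \<open>simp_all add: flag_def\<close>)
    then show "flag d (J # K # Ks)" using J'(1) by simp
  qed blast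
  also have "\<dots> \<longleftrightarrow> J \<subset> K" using assms(2,3) by (auto simp: flag_def)
  finally show ?thesis .
qed

text \<open>The step from \<open>u\<close> to \<open>v\<close> adds a set L to J, up to a diagonal
  constant c. Coordinates missing from K and from J confine c to 0 and 1; for c = 0 the set grows to
  K, and for c = 1 the step wraps around the diagonal to a smaller set.\<close>

lemma pair_chart:
  assumes "{u, v} \<in> X" "chart \<psi>" "u = \<psi> (shift a J)" "v = \<psi> (shift a K)" "u \<noteq> v"
    "J \<noteq> {}" "K \<noteq> {}" "J \<subset> {..d}" "K \<subset> {..d}"
  shows "J \<subset> K \<or> K \<subset> J"
proof -
  have "u \<in> {u, v}" by simp
  then obtain zs where zs: "pointed X ori (length zs) (zs @ [u])" "set (zs @ [u]) = {u, v}"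
    using pointed_ending[OF assms(1)] by blast
  have "set zs \<subseteq> range \<psi>" using zs(2) assms(3,4) by auto
  have "v \<in> set zs" using zs(2) assms(5) by auto
  have "set zs \<subseteq> range \<psi>" using zs(2) assms(3,4) by auto
  then obtain Ls where L: "flag d Ls" "zs = verts \<psi> (shift a J) Ls"
    using chart_pointed_iff[OF assms(2) _ HOL.refl, of zs "shift a J"] zs(1) assms(3) by blast
  then obtain L where L': "L \<in> set Ls" "v = \<psi> (shift (shift a J) L)" using \<open>v \<in> set zs\<close> by auto
  then have "\<psi> (shift (shift a J) L) = \<psi> (shift a K)" using assms(4) by simp
  then have "(shift (shift a J) L, shift a K) \<in> diag_rel d" using chart_eq_iff[OF assms(2)] by simp
  then obtain c where c0: "\<forall>j\<le>d. shift (shift a J) L j = shift a K j + c"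
    unfolding diag_rel_def by blast
  have c: "(if j \<in> J then 1 else 0) + (if j \<in> L then 1 else 0) = (if j \<in> K then 1 else 0) + c"
    if "j \<le> d" for j
    using c0[rule_format, OF that] by (simp add: shift_def)
  have "L \<noteq> {}" "L \<subset> {..d}" using L(1) L'(1) by (auto simp: flag_def)
  obtain i where i: "i \<le> d" "i \<notin> K" using assms(9) by auto
  obtain l where l: "l \<le> d" "l \<notin> J" using assms(8) by auto
  have "0 \<le> c" using c[OF i(1)] i(2) by (auto split: if_splits)
  moreover have "c \<le> 1" using c[OF l(1)] l(2) by (auto split: if_splits)
  ultimately consider "c = 0" | "c = 1" by linarith
  then have "J \<subseteq> K \<or> K \<subseteq> J"
  proof cases
    case 1
    have "j \<in> K" if "j \<in> J" for j
      using c[of j] that 1 assms(8) by (auto split: if_splits)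
    then show ?thesis by blast
  next
    case 2
    have "j \<in> J" if "j \<in> K" for j
      using c[of j] that 2 assms(9) by (auto split: if_splits)
    then show ?thesis by blast
  qed
  then show ?thesis using assms(3-5) by auto
qed

section \<open>Stability of the lower vertices\<close>

definition lower_vertices :: "'v \<Rightarrow> 'v set \<Rightarrow> 'v set" where
  "lower_vertices b \<eta> = {z. insert z \<eta> \<in> X \<and> (\<forall>v\<in>\<eta>. height b z < height b v)}"

context
  fixes b :: 'v and ys :: "'v list" and x :: 'v and \<eta> :: "'v list"
  assumes b: "{b} \<in> X"
    and \<eta>_def: "\<eta> = ys @ [x]"
    and \<eta>: "pointed X ori (length ys) \<eta>"
    and sorted: "height_sorted b \<eta>"
begin

text \<open>The simplex has a pointed enumeration sorted by height, and \<open>z # \<eta>\<close> is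
  the only sorted enumeration.\<close>

lemma lower_vertex_pointed:
  assumes "z \<in> lower_vertices b (set \<eta>)"
  shows "pointed X ori (length \<eta>) (z # \<eta>)" "height b z < height b x"
proof -
  have z: "insert z (set \<eta>) \<in> X" "\<forall>v\<in>set \<eta>. height b z < height b v"
    using assms by (auto simp: lower_vertices_def)
  obtain ws where ws: "pointed X ori (card (insert z (set \<eta>)) - 1) ws" "set ws = insert z (set \<eta>)"
    "height_sorted b ws"
    using height_sorted_enumeration[OF b z(1)] by blast
  have "height_sorted b (z # \<eta>)" using z(2) sorted by simp
  then have "ws = z # \<eta>"
    using ws(2,3) by (intro sorted_wrt_unique[of "\<lambda>u v. height b u < height b v"]) auto
  then show "pointed X ori (length \<eta>) (z # \<eta>)"
    using ws(1) distinct_card[OF pointedD(2)[OF ws(1)]] ws(2) by simp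
  show "height b z < height b x" using z(2) \<eta>_def by simp
qed

lemma link_flag:
  assumes "chart \<psi>" "set \<eta> \<subseteq> range \<psi>"
  obtains a Ks where "x = \<psi> a" "flag d Ks" "\<eta> = verts \<psi> a Ks @ [\<psi> a]"
  using chart_pointedE[OF assms \<eta>] \<eta>_def by (metis last_snoc)

text \<open>As \<open>z\<close> is lower than \<open>x\<close>, its set contains the minimal
  coordinates of \<open>x\<close>, and these define the nearest vertex. That vertex depends on
  \<open>x\<close> alone, so it is a common lower bound of all lower vertices.\<close>

lemma nearest_lower:
  assumes "z \<in> lower_vertices b (set \<eta>)"
  obtains p where "nearest b x p" "pointed X ori (length \<eta>) (p # \<eta>)"
    "p = z \<or> pointed X ori (length \<eta> + 1) (p # z # \<eta>)"
proof -
  note zp = lower_vertex_pointed[OF assms]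
  obtain \<psi> where \<psi>: "based_chart b \<psi>" "set (z # \<eta>) \<subseteq> range \<psi>"
    using based_chart_containing[OF b pointedD(1)[OF zp(1)]] by blast
  have c: "chart \<psi>" using based_chartD[OF \<psi>(1)] by simp
  have "set \<eta> \<subseteq> range \<psi>" using \<psi>(2) by simp
  then obtain a Ks where a: "x = \<psi> a" and Ks: "flag d Ks" and \<eta>K: "\<eta> = verts \<psi> a Ks @ [\<psi> a]"
    by (rule link_flag[OF c])
  note one = pointed_Cons_iff[OF c Ks, of _ a, folded \<eta>K] and two = pointed_Cons_Cons_iff[OF c, of _ Ks _ a, folded \<eta>K]
  have "x \<noteq> b" using zp(2) height_base[of b] by auto
  then have I: "flag d [min_coords d a]" "nearest b x (\<psi> (shift a (min_coords d a)))"
    using nearest_chart[OF \<psi>(1) b] a by auto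
  let ?I = "min_coords d a" and ?p = "\<psi> (shift a (min_coords d a))"
  obtain J where J: "flag d (J # Ks)" "z = \<psi> (shift a J)" using one[of z] \<psi>(2) zp(1) by auto
  have "?I \<subseteq> J"
  proof (rule ccontr)
    assume "\<not> ?I \<subseteq> J"
    then have "coord_height d a \<le> coord_height d (shift a J)"
      using coord_height_shift[of J d a] J(1) by (auto simp: flag_def)
    then show False
      using zp(2) height_chart[OF \<psi>(1), of a] height_chart[OF \<psi>(1), of "shift a J"] a J(2) by simp
  qed
  then have I': "flag d (?I # Ks)" using I(1) J(1) by (auto simp: flag_def)
  show thesis
  proof (rule that[OF I(2)])
    show "pointed X ori (length \<eta>) (?p # \<eta>)" using one[of ?p] I' by blast
    show "?p = z \<or> pointed X ori (length \<eta> + 1) (?p # z # \<eta>)"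
      using two[OF I' J(1)] J(2) \<open>?I \<subseteq> J\<close> by (cases "?I = J") auto
  qed
qed

text \<open>In a common apartment both vertices correspond to sets below the flag of \<eta>, and
  adjacency makes these sets comparable. So the top cells in the complex of the condition are indeed
  simplices of \<open>X\<close>.\<close>

lemma lower_vertices_flag:
  assumes "z \<in> lower_vertices b (set \<eta>)" "z' \<in> lower_vertices b (set \<eta>)" "{z, z'} \<in> simplices X 1"
  shows "{z, z'} \<union> set \<eta> \<in> simplices X (length \<eta> + 1)"
proof -
  note zp = lower_vertex_pointed(1)[OF assms(1)] lower_vertex_pointed(1)[OF assms(2)]
  have zz: "z \<noteq> z'" "{z, z'} \<in> X" using assms(3) by (auto simp: simplices_def)
  obtain \<psi> where \<psi>: "apt_chart \<psi>" "set (z # \<eta>) \<subseteq> range \<psi>" "set (z' # \<eta>) \<subseteq> range \<psi>"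
    using apt_chart_containing[OF pointedD(1)[OF zp(1)] pointedD(1)[OF zp(2)]] by blast
  have c: "chart \<psi>" using \<psi>(1) by (rule apt_chartD)
  have "set \<eta> \<subseteq> range \<psi>" using \<psi>(2) by simp
  then obtain a Ks where a: "x = \<psi> a" and Ks: "flag d Ks" and \<eta>K: "\<eta> = verts \<psi> a Ks @ [\<psi> a]"
    by (rule link_flag[OF c])
  note one = pointed_Cons_iff[OF c Ks, of _ a, folded \<eta>K] and two = pointed_Cons_Cons_iff[OF c, of _ Ks _ a, folded \<eta>K]
  obtain J where J: "flag d (J # Ks)" "z = \<psi> (shift a J)" using one[of z] \<psi>(2) zp(1) by auto
  obtain K where K: "flag d (K # Ks)" "z' = \<psi> (shift a K)" using one[of z'] \<psi>(3) zp(2) by auto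
  have "J \<subset> K \<or> K \<subset> J"
    by (rule pair_chart[OF zz(2) c J(2) K(2) zz(1)]) (use J(1) K(1) in \<open>auto simp: flag_def\<close>)
  then have "pointed X ori (length \<eta> + 1) (z # z' # \<eta>) \<or> pointed X ori (length \<eta> + 1) (z' # z # \<eta>)"
    using two[OF J(1) K(1)] two[OF K(1) J(1)] J(2) K(2) by blast
  moreover have "set (z # z' # \<eta>) = {z, z'} \<union> set \<eta>" "set (z' # z # \<eta>) = {z, z'} \<union> set \<eta>" by auto
  ultimately show ?thesis unfolding pointed_def by metis
qed

text \<open>The bracket is computed as an intersection in an apartment containing \<open>z\<close>, \<open>z'\<close>, \<open>\<eta>\<close> and the
  vertex nearest to the base point; the latter keeps the intersection nonempty and its height
  small.\<close>

lemma bracket_exists: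
  assumes "z \<in> lower_vertices b (set \<eta>)" "z' \<in> lower_vertices b (set \<eta>)"
  shows "\<exists>u \<in> lower_vertices b (set \<eta>). is_bracket X ori \<eta> z z' u"
proof -
  note zp = lower_vertex_pointed[OF assms(1)] and zp' = lower_vertex_pointed[OF assms(2)]
  obtain p where p: "nearest b x p" "pointed X ori (length \<eta>) (p # \<eta>)"
    "p = z \<or> pointed X ori (length \<eta> + 1) (p # z # \<eta>)"
    using nearest_lower[OF assms(1)] by blast
  obtain p' where "nearest b x p'" "p' = z' \<or> pointed X ori (length \<eta> + 1) (p' # z' # \<eta>)"
    using nearest_lower[OF assms(2)] by blast
  then have p': "p = z' \<or> pointed X ori (length \<eta> + 1) (p # z' # \<eta>)"
    using nearest_unique[OF p(1)] by blast
  \<comment> \<open>An apartment is supplied for two simplices only; attaching \<open>p\<close> to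
    them brings \<open>p\<close> into it as well.\<close>
  have X1: "set (p # z # \<eta>) \<in> X"
    using p(3) pointedD(1)[OF zp(1)] pointedD(1)[of "length \<eta> + 1" "p # z # \<eta>"] by (auto simp: insert_absorb)
  have X2: "set (p # z' # \<eta>) \<in> X"
    using p' pointedD(1)[OF zp'(1)] pointedD(1)[of "length \<eta> + 1" "p # z' # \<eta>"] by (auto simp: insert_absorb)
  obtain \<psi> where \<psi>: "apt_chart \<psi>" "set (p # z # \<eta>) \<subseteq> range \<psi>" "set (p # z' # \<eta>) \<subseteq> range \<psi>"
    using apt_chart_containing[OF X1 X2] by blast
  have c: "chart \<psi>" using \<psi>(1) by (rule apt_chartD)
  have \<eta>r: "set \<eta> \<subseteq> range \<psi>" using \<psi>(2) by simp
  obtain a Ks where a: "x = \<psi> a" and Ks: "flag d Ks" and \<eta>K: "\<eta> = verts \<psi> a Ks @ [\<psi> a]"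
    by (rule link_flag[OF c \<eta>r])
  note one = pointed_Cons_iff[OF c Ks, of _ a, folded \<eta>K] and two = pointed_Cons_Cons_iff[OF c, of _ Ks _ a, folded \<eta>K]
  have le: "nbr_le X ori \<eta> (\<psi> (shift a J)) (\<psi> (shift a K)) \<longleftrightarrow> J \<subseteq> K"
    if "flag d (J # Ks)" "flag d (K # Ks)" for J K
  proof -
    have "\<psi> (shift a J) = \<psi> (shift a K) \<longleftrightarrow> J = K"
      using chart_shift_inj[OF c, of a J K] that by (auto simp: flag_def)
    then show ?thesis unfolding nbr_le_def using two[OF that] by auto
  qed
  obtain P where P: "flag d (P # Ks)" "p = \<psi> (shift a P)" using one[of p] \<psi>(2) p(2) by auto
  obtain J where J: "flag d (J # Ks)" "z = \<psi> (shift a J)" using one[of z] \<psi>(2) zp(1) by auto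
  obtain K where K: "flag d (K # Ks)" "z' = \<psi> (shift a K)" using one[of z'] \<psi>(3) zp'(1) by auto
  have PJ: "P \<subseteq> J" using le[OF P(1) J(1)] p(3) P(2) J(2) by (auto simp: nbr_le_def)
  have PK: "P \<subseteq> K" using le[OF P(1) K(1)] p' P(2) K(2) by (auto simp: nbr_le_def)
  define U where "U = J \<inter> K"
  have U: "flag d (U # Ks)" using PJ PK P(1) J(1) by (auto simp: flag_def U_def)
  define u where "u = \<psi> (shift a U)"
  have up: "pointed X ori (length \<eta>) (u # \<eta>)" using one[of u] U by (auto simp: u_def)
  have uX: "insert u (set \<eta>) \<in> X" using pointedD(1)[OF up] by simp
  have zx: "pointed X ori 1 [z, x]"
    using pointed_edge[of "length \<eta>" "z # ys" x z] zp(1) \<eta>_def by simp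
  have pz: "height b p \<le> height b z"
    using p(1) zx unfolding nearest_def by (cases "p = z") (auto intro: less_imp_le)
  \<comment> \<open>If \<open>u\<close> differs from \<open>p\<close>, then
    \<open>p # u # \<eta>\<close> is pointed and \<open>p\<close> is its lowest vertex, since the
    others are \<open>x\<close> itself or competitors in \<open>nearest\<close>. Hence it is sorted,
    which puts \<open>u\<close> below \<eta>.\<close>
  have u_low: "height b u < height b v" if v: "v \<in> set \<eta>" for v
  proof (cases "u = p")
    case True
    have "height b z < height b v" using assms(1) v unfolding lower_vertices_def by blast
    then show ?thesis using pz True by simp
  next
    case False
    then have "P \<noteq> U" using P(2) by (auto simp: u_def)
    then have "P \<subset> U" using PJ PK by (auto simp: U_def)
    then have puX: "pointed X ori (length \<eta> + 1) (p # u # \<eta>)"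
      using two[OF P(1) U] P(2) by (simp add: u_def)
    have "height b p < height b w" if w: "w \<in> set (u # \<eta>)" for w
    proof (cases "w = x")
      case True
      then show ?thesis using p(1) by (simp add: nearest_def)
    next
      case False
      then have "w \<in> set (p # u # ys)" using w \<eta>_def by auto
      then have "pointed X ori 1 [w, x]"
        using pointed_edge[of "length \<eta> + 1" "p # u # ys" x w] puX \<eta>_def by simp
      moreover have "w \<noteq> p" using pointedD(2)[OF puX] w by auto
      ultimately show ?thesis using p(1) by (simp add: nearest_def)
    qed
    then have "height_sorted b (p # u # \<eta>)" by (rule height_sorted_from_min[OF b puX])
    then show ?thesis using v by simp
  qed
  have u_in: "u \<in> lower_vertices b (set \<eta>)" using uX u_low by (simp add: lower_vertices_def)
  have cU: "1 \<le> card U" "card U \<le> d" using flag_card_bounds[OF U, of U] by auto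
  have U1: "flag d [U]" using U by (simp add: flag_def)
  have ell_u: "ell X ori (u # \<eta>) = d + 1 - card U"
    by (rule ell_chart[OF \<psi>(1) U1]) (use \<eta>_def a in \<open>auto simp: u_def\<close>)
  have "is_bracket X ori \<eta> z z' u"
    unfolding is_bracket_def
  proof (intro conjI ballI impI)
    show "u \<in> lower_nbrs X ori \<eta> z z'"
      using up le[OF U J(1)] le[OF U K(1)] J(2) K(2)
      by (auto simp: lower_nbrs_def nbrs_def u_def U_def)
  next
    \<comment> \<open>The competitor may lie outside the apartment. Retracted with a chamber through
      \<open>u\<close> as centre, it corresponds to a subset Q of U, and Q = U would give
      \<open>w = u\<close>. As \<open>ell\<close> drops when the set grows, \<open>u\<close> has the
      smaller value.\<close>
    fix w assume w: "w \<in> lower_nbrs X ori \<eta> z z'" "w \<noteq> u"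
    then have wp: "pointed X ori (length \<eta>) (w # \<eta>)" "nbr_le X ori \<eta> w z" "nbr_le X ori \<eta> w z'"
      by (auto simp: lower_nbrs_def nbrs_def)
    obtain q where q: "enumerates d q" "\<forall>J\<in>set [U]. J = set (take (card J) q)"
      using flag_refine[OF U1] by blast
    obtain \<rho> where \<rho>: "retracts \<rho> \<psi>" "\<And>w. w \<in> \<Union>X \<Longrightarrow> \<rho> w \<in> chamber \<psi> a q \<Longrightarrow> \<rho> w = w"
      using retraction[OF \<psi>(1) q(1), of a] by blast
    have fixed: "\<rho> v = v" if "v \<in> range \<psi>" for v using \<rho>(1) that by (auto simp: retracts_def)
    have \<rho>p: "pointed X ori k (map \<rho> xs) \<and> \<rho> ` set xs \<subseteq> range \<psi>" if "pointed X ori k xs" for k xs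
      using \<rho>(1) that by (simp add: retracts_def)
    have map\<eta>: "map \<rho> \<eta> = \<eta>" using fixed \<eta>r by (intro map_idI) blast
    have \<rho>w: "pointed X ori (length \<eta>) (\<rho> w # \<eta>)" "\<rho> w \<in> range \<psi>"
      using \<rho>p[OF wp(1)] map\<eta> by auto
    obtain Q where Q: "flag d (Q # Ks)" "\<rho> w = \<psi> (shift a Q)" using one[OF \<rho>w(2)] \<rho>w(1) by blast
    have \<rho>le: "nbr_le X ori \<eta> (\<rho> w) v" if "nbr_le X ori \<eta> w v" "v \<in> range \<psi>" for v
      using that \<rho>p[of "length \<eta> + 1" "w # v # \<eta>"] fixed map\<eta> by (auto simp: nbr_le_def)
    have "Q \<subseteq> J" using \<rho>le[OF wp(2)] le[OF Q(1) J(1)] Q(2) J(2) by simp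
    moreover have "Q \<subseteq> K" using \<rho>le[OF wp(3)] le[OF Q(1) K(1)] Q(2) K(2) by simp
    ultimately have QU: "Q \<subseteq> U" by (simp add: U_def)
    have "Q \<noteq> U"
    proof
      assume "Q = U"
      then have "\<rho> w = u" using Q(2) by (simp add: u_def)
      moreover have "u \<in> chamber \<psi> a q"
        using q(2) cU unfolding chamber_def u_def by (intro image_eqI[of _ _ "card U"]) simp_all
      moreover have "w \<in> \<Union>X" using pointedD(1)[OF wp(1)] by auto
      ultimately show False using \<rho>(2)[of w] w(2) by simp
    qed
    then have card: "card Q < card U"
      using QU flag_finite[OF U, of U] by (intro psubset_card_mono) auto
    have "\<exists>Q'. flag d [Q'] \<and> \<rho> w = \<psi> (shift a Q') \<and> ell X ori (w # \<eta>) = d + 1 - card Q'"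
    proof (rule ell_retract[OF \<psi>(1) \<rho>(1)])
      show "\<rho> x = \<psi> a" using fixed a by auto
      show "pointed X ori 1 [w, x]"
        using pointed_edge[of "length \<eta>" "w # ys" x w] wp(1) \<eta>_def by simp
    qed (use \<eta>_def in auto)
    then obtain Q' where Q': "flag d [Q']" "\<rho> w = \<psi> (shift a Q')" "ell X ori (w # \<eta>) = d + 1 - card Q'"
      by blast
    have "\<psi> (shift a Q') = \<psi> (shift a Q)" using Q(2) Q'(2) by simp
    then have "Q' = Q"
      by (rule chart_shift_inj[OF c]) (use Q(1) Q'(1) in \<open>auto simp: flag_def\<close>)
    then show "ell X ori (u # \<eta>) < ell X ori (w # \<eta>)" using card Q'(3) ell_u cU by simp
  qed
  then show ?thesis using u_in by blast
qed

lemma lower_vertices_stable: "stable X ori \<eta> (lower_vertices b (set \<eta>))"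
  unfolding stable_def nbrs_def using lower_vertex_pointed(1) bracket_exists by blast

end

end

section \<open>Reduction of cycles\<close>

lemma (in comm_monoid) gfinprod_one:
  assumes "\<And>x. x \<in> A \<Longrightarrow> f x = \<one>"
  shows "gfinprod G f A = \<one>"
proof -
  have "{x \<in> A. f x \<noteq> \<one>} = {}" using assms by auto
  then show ?thesis by (simp only: gfinprod_def finite.emptyI if_True finprod_empty)
qed

lemma (in comm_monoid) gfinprod_single:
  assumes "i \<in> A" "f i \<in> carrier G" "\<And>x. x \<in> A \<Longrightarrow> x \<noteq> i \<Longrightarrow> f x = \<one>"
  shows "gfinprod G f A = f i"
proof -
  have "gfinprod G f A = gfinprod G f {i}"
  proof (rule gfinprod_mono_neutral_cong_right)
    show "f \<in> A \<rightarrow> carrier G"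
    proof
      fix x assume "x \<in> A"
      then show "f x \<in> carrier G" using assms by (cases "x = i") auto
    qed
  qed (use assms in auto)
  also have "\<dots> = f i" using assms(2) by simp
  finally show ?thesis .
qed

lemma (in comm_monoid) gfinprod_pair:
  assumes "i \<in> A" "j \<in> A" "i \<noteq> j" "f i \<in> carrier G" "f j \<in> carrier G"
    "\<And>x. x \<in> A \<Longrightarrow> x \<noteq> i \<Longrightarrow> x \<noteq> j \<Longrightarrow> f x = \<one>"
  shows "gfinprod G f A = f i \<otimes> f j"
proof -
  have "gfinprod G f A = gfinprod G f {i, j}"
  proof (rule gfinprod_mono_neutral_cong_right)
    show "f \<in> A \<rightarrow> carrier G"
    proof
      fix x assume "x \<in> A"
      then show "f x \<in> carrier G" using assms by (cases "x = i \<or> x = j") auto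
    qed
  qed (use assms in auto)
  also have "\<dots> = f i \<otimes> f j" using assms by (simp add: finprod_insert)
  finally show ?thesis .
qed

lemma trivial_group_Mod_carrier:
  assumes "group G"
  shows "trivial_group (G Mod carrier G)"
proof -
  interpret group G by (rule assms)
  have "rcosets\<^bsub>G\<^esub> carrier G = {carrier G}"
    using coset_join2[OF _ subgroup_self] one_closed by (auto simp: RCOSETS_def)
  then show ?thesis
    unfolding trivial_group_def
    using normal.factorgroup_is_group[OF normal_self] by (simp add: FactGroup_def)
qed

section \<open>Chains and components of the boundary map\<close>

locale coefficient_system =
  fixes X :: "'v set set" and lab :: "'v \<Rightarrow> nat"
    and V :: "'v set \<Rightarrow> ('a, 'm) monoid_scheme" and r :: "'v set \<Rightarrow> 'v set \<Rightarrow> 'a \<Rightarrow> 'a"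
  assumes simplicial: "simplicial_complex X"
    and lab_inj: "\<And>\<sigma>. \<sigma> \<in> X \<Longrightarrow> inj_on lab \<sigma>"
    and system: "hcs X V r"
begin

lemma simplex_finite: "\<sigma> \<in> X \<Longrightarrow> finite \<sigma>"
  and simplex_face: "\<sigma> \<in> X \<Longrightarrow> \<rho> \<subseteq> \<sigma> \<Longrightarrow> \<rho> \<noteq> {} \<Longrightarrow> \<rho> \<in> X"
  using simplicial unfolding simplicial_complex_def by blast+

lemma simplicesD: "\<sigma> \<in> simplices X k \<Longrightarrow> \<sigma> \<in> X" "\<sigma> \<in> simplices X k \<Longrightarrow> card \<sigma> = k + 1"
  by (auto simp: simplices_def)

lemma simplices_subset: "simplices X k \<subseteq> X"
  by (auto simp: simplices_def)

abbreviation unit :: "'v set \<Rightarrow> 'a" where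
  "unit \<tau> \<equiv> \<one>\<^bsub>V \<tau>\<^esub>"

abbreviation supp :: "'v set set \<Rightarrow> ('v set \<Rightarrow> 'a) \<Rightarrow> 'v set set" where
  "supp S c \<equiv> {\<tau> \<in> S. c \<tau> \<noteq> unit \<tau>}"

lemma V_comm: "\<tau> \<in> X \<Longrightarrow> comm_group (V \<tau>)"
  using system by (simp add: hcs_def)

lemma V_group: "\<tau> \<in> X \<Longrightarrow> group (V \<tau>)"
  using V_comm comm_group.axioms(2) by blast

lemma V_monoid: "\<tau> \<in> X \<Longrightarrow> comm_monoid (V \<tau>)"
  using V_comm comm_group.axioms(1) by blast

definition face_map :: "'v set \<Rightarrow> 'v set \<Rightarrow> 'a \<Rightarrow> 'a" where
  "face_map \<tau>' \<tau> v = r \<tau>' \<tau> v [^]\<^bsub>V \<tau>\<^esub> incidence lab \<tau>' \<tau>"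

lemma r_hom: "\<tau>' \<in> X \<Longrightarrow> \<tau> \<in> X \<Longrightarrow> \<tau> \<subseteq> \<tau>' \<Longrightarrow> r \<tau>' \<tau> \<in> hom (V \<tau>') (V \<tau>)"
  using system by (simp add: hcs_def)

lemma r_comp:
  "\<sigma> \<in> X \<Longrightarrow> \<tau> \<in> X \<Longrightarrow> \<rho> \<in> X \<Longrightarrow> \<rho> \<subseteq> \<tau> \<Longrightarrow> \<tau> \<subseteq> \<sigma> \<Longrightarrow> v \<in> carrier (V \<sigma>) \<Longrightarrow>
    r \<tau> \<rho> (r \<sigma> \<tau> v) = r \<sigma> \<rho> v"
  using system unfolding hcs_def by blast

lemma face_map_hom:
  assumes "\<tau>' \<in> X" "\<tau> \<in> X" "\<tau> \<subseteq> \<tau>'"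
  shows "face_map \<tau>' \<tau> \<in> hom (V \<tau>') (V \<tau>)"
proof -
  interpret comm_group "V \<tau>" by (rule V_comm[OF assms(2)])
  note h = r_hom[OF assms]
  show ?thesis
  proof (rule homI)
    fix x assume x: "x \<in> carrier (V \<tau>')"
    then show "face_map \<tau>' \<tau> x \<in> carrier (V \<tau>)"
      using h by (simp add: face_map_def hom_in_carrier)
    fix y assume y: "y \<in> carrier (V \<tau>')"
    show "face_map \<tau>' \<tau> (x \<otimes>\<^bsub>V \<tau>'\<^esub> y) = face_map \<tau>' \<tau> x \<otimes>\<^bsub>V \<tau>\<^esub> face_map \<tau>' \<tau> y"
      using x y h by (simp add: face_map_def hom_mult hom_in_carrier int_pow_distrib)
  qed
qed

lemma face_map_closed:
  "\<tau>' \<in> X \<Longrightarrow> \<tau> \<in> X \<Longrightarrow> \<tau> \<subseteq> \<tau>' \<Longrightarrow> v \<in> carrier (V \<tau>') \<Longrightarrow> face_map \<tau>' \<tau> v \<in> carrier (V \<tau>)"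
  using face_map_hom hom_in_carrier by metis

lemma face_map_one:
  "\<tau>' \<in> X \<Longrightarrow> \<tau> \<in> X \<Longrightarrow> \<tau> \<subseteq> \<tau>' \<Longrightarrow> face_map \<tau>' \<tau> (unit \<tau>') = unit \<tau>"
  using hom_one[OF face_map_hom] V_group by blast

lemma carrier_sum:
  assumes "S \<subseteq> X"
  shows "carrier (sum_group S V) =
    {c \<in> \<Pi>\<^sub>E \<tau>\<in>S. carrier (V \<tau>). finite (supp S c)}"
  by (rule carrier_sum_group) (use assms V_group in blast)

lemma sum_group_group: "S \<subseteq> X \<Longrightarrow> group (sum_group S V)"
  by (rule sum_group) (use V_group in blast)

lemma bd_eq: "\<tau> \<in> T \<Longrightarrow> bd lab V r S T c \<tau> =
    gfinprod (V \<tau>) (\<lambda>\<tau>'. face_map \<tau>' \<tau> (c \<tau>')) {\<tau>' \<in> S. \<tau> \<subseteq> \<tau>'}"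
  by (simp add: bd_def face_map_def)

lemma bd_hom:
  assumes "S \<subseteq> X" "T \<subseteq> X"
  shows "bd lab V r S T \<in> hom (sum_group S V) (sum_group T V)"
proof (rule homI)
  have closed: "(\<lambda>\<tau>'. face_map \<tau>' \<tau> (c \<tau>')) \<in> {\<tau>' \<in> S. \<tau> \<subseteq> \<tau>'} \<rightarrow> carrier (V \<tau>)"
    if "c \<in> carrier (sum_group S V)" "\<tau> \<in> T" for c \<tau>
    using that assms face_map_closed by (fastforce simp: carrier_sum PiE_iff)
  fix c assume c: "c \<in> carrier (sum_group S V)"
  then have c': "\<And>\<tau>. \<tau> \<in> S \<Longrightarrow> c \<tau> \<in> carrier (V \<tau>)" "finite (supp S c)"
    using assms by (auto simp: carrier_sum)
  \<comment> \<open>A simplex may lie in infinitely many others, as no local finiteness is assumed.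
    Finiteness comes from below: only the finitely many faces of the simplices in the support of
    \<open>c\<close> can receive a value.\<close>
  have "{\<tau> \<in> T. bd lab V r S T c \<tau> \<noteq> unit \<tau>} \<subseteq> (\<Union>\<tau>'\<in>supp S c. Pow \<tau>')"
  proof
    fix \<tau> assume "\<tau> \<in> {\<tau> \<in> T. bd lab V r S T c \<tau> \<noteq> unit \<tau>}"
    then have \<tau>: "\<tau> \<in> T" "bd lab V r S T c \<tau> \<noteq> unit \<tau>" by auto
    then have "\<exists>\<tau>'. \<tau>' \<in> S \<and> \<tau> \<subseteq> \<tau>' \<and> face_map \<tau>' \<tau> (c \<tau>') \<noteq> unit \<tau>"
      using comm_monoid.gfinprod_one[OF V_monoid, of \<tau> "{\<tau>' \<in> S. \<tau> \<subseteq> \<tau>'}" "\<lambda>\<tau>'. face_map \<tau>' \<tau> (c \<tau>')"]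
        assms(2) by (auto simp: bd_eq)
    then obtain \<tau>' where \<tau>': "\<tau>' \<in> S" "\<tau> \<subseteq> \<tau>'" "face_map \<tau>' \<tau> (c \<tau>') \<noteq> unit \<tau>" by blast
    then have "c \<tau>' \<noteq> unit \<tau>'" using face_map_one[OF subsetD[OF assms(1) \<tau>'(1)] subsetD[OF assms(2) \<tau>(1)] \<tau>'(2)] by auto
    then show "\<tau> \<in> (\<Union>\<tau>'\<in>supp S c. Pow \<tau>')" using \<tau>' by blast
  qed
  moreover have "finite (\<Union>\<tau>'\<in>supp S c. Pow \<tau>')"
    using c'(2) simplex_finite assms(1) by blast
  ultimately have "finite {\<tau> \<in> T. bd lab V r S T c \<tau> \<noteq> unit \<tau>}" by (rule finite_subset)
  moreover have "bd lab V r S T c \<tau> \<in> carrier (V \<tau>)" if "\<tau> \<in> T" for \<tau>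
    using comm_monoid.gfinprod_closed[OF V_monoid closed[OF c that]] that assms(2)
    by (auto simp: bd_eq)
  moreover have "bd lab V r S T c \<in> extensional T" by (simp add: bd_def)
  ultimately show "bd lab V r S T c \<in> carrier (sum_group T V)"
    using assms by (simp add: carrier_sum PiE_iff)
  fix e assume e: "e \<in> carrier (sum_group S V)"
  then have e': "\<And>\<tau>. \<tau> \<in> S \<Longrightarrow> e \<tau> \<in> carrier (V \<tau>)" "finite (supp S e)"
    using assms by (auto simp: carrier_sum)
  show "bd lab V r S T (c \<otimes>\<^bsub>sum_group S V\<^esub> e) =
      bd lab V r S T c \<otimes>\<^bsub>sum_group T V\<^esub> bd lab V r S T e"
  proof
    fix \<tau>
    show "bd lab V r S T (c \<otimes>\<^bsub>sum_group S V\<^esub> e) \<tau> =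
      (bd lab V r S T c \<otimes>\<^bsub>sum_group T V\<^esub> bd lab V r S T e) \<tau>"
    proof (cases "\<tau> \<in> T")
      case False
      then show ?thesis by (simp add: bd_def)
    next
      case True
      then have \<tau>: "\<tau> \<in> X" using assms by blast
      interpret comm_group "V \<tau>" by (rule V_comm[OF \<tau>])
      let ?I = "{\<tau>' \<in> S. \<tau> \<subseteq> \<tau>'}"
      have fin: "finite {\<tau>' \<in> ?I. face_map \<tau>' \<tau> (f \<tau>') \<noteq> unit \<tau>}"
        if "finite (supp S f)" for f
        by (rule finite_subset[OF _ that]) (use face_map_one[OF _ \<tau>] assms(1) in auto)
      have "bd lab V r S T (c \<otimes>\<^bsub>sum_group S V\<^esub> e) \<tau> =
          gfinprod (V \<tau>) (\<lambda>\<tau>'. face_map \<tau>' \<tau> ((c \<otimes>\<^bsub>sum_group S V\<^esub> e) \<tau>')) ?I"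
        by (rule bd_eq[OF True])
      also have "\<dots> = gfinprod (V \<tau>) (\<lambda>\<tau>'. face_map \<tau>' \<tau> (c \<tau>') \<otimes>\<^bsub>V \<tau>\<^esub> face_map \<tau>' \<tau> (e \<tau>')) ?I"
      proof (rule gfinprod_cong[OF HOL.refl, unfolded simp_implies_def, symmetric])
        show "(\<lambda>\<tau>'. face_map \<tau>' \<tau> (c \<tau>') \<otimes>\<^bsub>V \<tau>\<^esub> face_map \<tau>' \<tau> (e \<tau>')) \<in> ?I \<rightarrow> carrier (V \<tau>)"
          using closed[OF c True] closed[OF e True] by (auto simp: Pi_iff)
        fix \<tau>' assume \<tau>': "\<tau>' \<in> ?I"
        then show "face_map \<tau>' \<tau> (c \<tau>') \<otimes>\<^bsub>V \<tau>\<^esub> face_map \<tau>' \<tau> (e \<tau>') =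
            face_map \<tau>' \<tau> ((c \<otimes>\<^bsub>sum_group S V\<^esub> e) \<tau>')"
          using hom_mult[OF face_map_hom[OF _ \<tau>], of \<tau>' "c \<tau>'" "e \<tau>'"] c'(1) e'(1) assms(1)
          by auto
      qed
      also have "\<dots> = bd lab V r S T c \<tau> \<otimes>\<^bsub>V \<tau>\<^esub> bd lab V r S T e \<tau>"
        unfolding bd_eq[OF True]
        by (rule gfinprod_distrib[OF fin[OF c'(2)] fin[OF e'(2)] closed[OF c True] closed[OF e True]])
      finally show ?thesis using True by simp
    qed
  qed
qed

abbreviation Ch :: "nat \<Rightarrow> ('v set \<Rightarrow> 'a) monoid" where
  "Ch \<equiv> chain_grp X V"

abbreviation bnd :: "nat \<Rightarrow> ('v set \<Rightarrow> 'a) \<Rightarrow> 'v set \<Rightarrow> 'a" where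
  "bnd \<equiv> boundary X lab V r"

lemma chains_group: "group (Ch k)"
  unfolding chain_grp_def by (rule sum_group_group[OF simplices_subset])

lemma carrier_chains:
  "carrier (Ch k) = {c \<in> \<Pi>\<^sub>E \<tau>\<in>simplices X k. carrier (V \<tau>).
     finite (supp (simplices X k) c)}"
  unfolding chain_grp_def by (rule carrier_sum[OF simplices_subset])

lemma bnd_hom: "bnd k \<in> hom (Ch (Suc k)) (Ch k)"
  unfolding chain_grp_def boundary_def Suc_eq_plus1 by (rule bd_hom[OF simplices_subset simplices_subset])

lemma bnd_group_hom: "group_hom (Ch (Suc k)) (Ch k) (bnd k)"
  by (intro group_hom.intro chains_group group_hom_axioms.intro bnd_hom)

lemma bnd_eq: "\<tau> \<in> simplices X k \<Longrightarrow> bnd k c \<tau> =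
    gfinprod (V \<tau>) (\<lambda>\<tau>'. face_map \<tau>' \<tau> (c \<tau>')) {\<tau>' \<in> simplices X (Suc k). \<tau> \<subseteq> \<tau>'}"
  by (simp add: boundary_def bd_eq)

lemma one_chains: "\<one>\<^bsub>Ch k\<^esub> = (\<lambda>\<tau>\<in>simplices X k. unit \<tau>)"
  by (simp add: chain_grp_def)

lemma mult_chains: "c \<otimes>\<^bsub>Ch k\<^esub> e = (\<lambda>\<tau>\<in>simplices X k. c \<tau> \<otimes>\<^bsub>V \<tau>\<^esub> e \<tau>)"
  by (simp add: chain_grp_def)

section \<open>Composition of two boundary maps\<close>

lemma incidence_remove:
  assumes "y \<in> \<sigma>"
  shows "incidence lab \<sigma> (\<sigma> - {y}) = (-1) ^ card {z \<in> \<sigma>. lab z < lab y}"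
proof -
  have "\<sigma> - (\<sigma> - {y}) = {y}" using assms by auto
  then show ?thesis by (simp add: incidence_def)
qed

text \<open>Deleting \<open>x\<close> lowers the position of \<open>y\<close> by one, whereas
  deleting \<open>y\<close> leaves the position of \<open>x\<close>; so the two orders of deletion
  carry opposite signs.\<close>

lemma incidence_cancel:
  assumes "finite \<sigma>" "x \<in> \<sigma>" "y \<in> \<sigma>" "lab x < lab y"
  shows "incidence lab \<sigma> (\<sigma> - {y}) * incidence lab (\<sigma> - {y}) (\<sigma> - {y} - {x}) +
    incidence lab \<sigma> (\<sigma> - {x}) * incidence lab (\<sigma> - {x}) (\<sigma> - {x} - {y}) = 0"
proof -
  have "{z \<in> \<sigma> - {y}. lab z < lab x} = {z \<in> \<sigma>. lab z < lab x}" using assms(4) by auto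
  then have 1: "incidence lab (\<sigma> - {y}) (\<sigma> - {y} - {x}) = (-1) ^ card {z \<in> \<sigma>. lab z < lab x}"
    using incidence_remove[of x "\<sigma> - {y}"] assms by auto
  have "{z \<in> \<sigma>. lab z < lab y} = insert x {z \<in> \<sigma> - {x}. lab z < lab y}" using assms by auto
  then have "card {z \<in> \<sigma>. lab z < lab y} = Suc (card {z \<in> \<sigma> - {x}. lab z < lab y})"
    using assms(1) by simp
  moreover have "incidence lab (\<sigma> - {x}) (\<sigma> - {x} - {y}) = (-1) ^ card {z \<in> \<sigma> - {x}. lab z < lab y}"
    using incidence_remove[of y "\<sigma> - {x}"] assms by auto
  ultimately show ?thesis
    unfolding 1 incidence_remove[OF assms(2)] incidence_remove[OF assms(3)] by simp
qed

lemma face_map_comp: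
  assumes "\<sigma> \<in> X" "\<tau> \<in> X" "\<rho> \<in> X" "\<rho> \<subseteq> \<tau>" "\<tau> \<subseteq> \<sigma>" "v \<in> carrier (V \<sigma>)"
  shows "face_map \<tau> \<rho> (face_map \<sigma> \<tau> v) =
    r \<sigma> \<rho> v [^]\<^bsub>V \<rho>\<^esub> (incidence lab \<sigma> \<tau> * incidence lab \<tau> \<rho>)"
proof -
  have rv: "r \<sigma> \<tau> v \<in> carrier (V \<tau>)" using r_hom[of \<sigma> \<tau>] assms by (simp add: hom_in_carrier)
  have "\<rho> \<subseteq> \<sigma>" using assms(4,5) by simp
  then have rv': "r \<sigma> \<rho> v \<in> carrier (V \<rho>)" using r_hom[of \<sigma> \<rho>] assms by (simp add: hom_in_carrier)
  have "r \<tau> \<rho> (face_map \<sigma> \<tau> v) = r \<sigma> \<rho> v [^]\<^bsub>V \<rho>\<^esub> incidence lab \<sigma> \<tau>"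
    unfolding face_map_def
    using hom_int_pow[OF r_hom[OF assms(2,3,4)] rv V_group[OF assms(2)] V_group[OF assms(3)]]
      r_comp[OF assms] by simp
  then show ?thesis
    unfolding face_map_def[of \<tau> \<rho>] using group.int_pow_pow[OF V_group[OF assms(3)] rv'] by simp
qed

definition single :: "nat \<Rightarrow> 'v set \<Rightarrow> 'a \<Rightarrow> 'v set \<Rightarrow> 'a" where
  "single k \<sigma> v = (\<lambda>\<tau>\<in>simplices X k. if \<tau> = \<sigma> then v else unit \<tau>)"

lemma single_closed:
  assumes "\<sigma> \<in> simplices X k" "v \<in> carrier (V \<sigma>)"
  shows "single k \<sigma> v \<in> carrier (Ch k)"
proof -
  have "finite {\<tau> \<in> simplices X k. single k \<sigma> v \<tau> \<noteq> unit \<tau>}"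
    by (rule finite_subset[of _ "{\<sigma>}"]) (auto simp: single_def)
  then show ?thesis
    using assms group.is_monoid[OF V_group] simplicesD(1) unfolding carrier_chains
    by (auto simp: single_def PiE_iff intro: monoid.one_closed)
qed

lemma bnd_single:
  assumes "\<sigma> \<in> simplices X (Suc k)" "v \<in> carrier (V \<sigma>)" "\<tau> \<in> simplices X k"
  shows "bnd k (single (Suc k) \<sigma> v) \<tau> = (if \<tau> \<subseteq> \<sigma> then face_map \<sigma> \<tau> v else unit \<tau>)"
proof -
  have \<tau>: "\<tau> \<in> X" "\<sigma> \<in> X" using assms simplicesD by auto
  interpret comm_group "V \<tau>" by (rule V_comm[OF \<tau>(1)])
  let ?f = "\<lambda>\<tau>'. face_map \<tau>' \<tau> (single (Suc k) \<sigma> v \<tau>')"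
  have one: "?f \<tau>' = unit \<tau>" if "\<tau>' \<in> simplices X (Suc k)" "\<tau> \<subseteq> \<tau>'" "\<tau>' \<noteq> \<sigma>" for \<tau>'
    using face_map_one[OF simplicesD(1)[OF that(1)] \<tau>(1) that(2)] that by (simp add: single_def)
  show ?thesis
  proof (cases "\<tau> \<subseteq> \<sigma>")
    case True
    have "?f \<sigma> = face_map \<sigma> \<tau> v" using assms(1) by (simp add: single_def)
    moreover have "gfinprod (V \<tau>) ?f {\<tau>' \<in> simplices X (Suc k). \<tau> \<subseteq> \<tau>'} = ?f \<sigma>"
      by (rule gfinprod_single)
        (use assms True one face_map_closed[OF \<tau>(2,1) True assms(2)] in \<open>auto simp: single_def\<close>)
    ultimately show ?thesis using True by (simp add: bnd_eq[OF assms(3)])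
  next
    case False
    have "gfinprod (V \<tau>) ?f {\<tau>' \<in> simplices X (Suc k). \<tau> \<subseteq> \<tau>'} = unit \<tau>"
      by (rule gfinprod_one) (use one False in auto)
    then show ?thesis using False by (simp add: bnd_eq[OF assms(3)])
  qed
qed

text \<open>Exactly two simplices lie strictly between \<sigma> and a face of codimension two, and
  their contributions cancel.\<close>

lemma bnd_bnd_single:
  assumes \<sigma>: "\<sigma> \<in> simplices X (Suc (Suc k))" and v: "v \<in> carrier (V \<sigma>)"
  shows "bnd k (bnd (Suc k) (single (Suc (Suc k)) \<sigma> v)) = \<one>\<^bsub>Ch k\<^esub>"
proof
  fix \<rho>
  let ?c = "bnd (Suc k) (single (Suc (Suc k)) \<sigma> v)"
  show "bnd k ?c \<rho> = \<one>\<^bsub>Ch k\<^esub> \<rho>"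
  proof (cases "\<rho> \<in> simplices X k")
    case False
    then show ?thesis by (simp add: boundary_def bd_def one_chains)
  next
    case True
    have X: "\<rho> \<in> X" "\<sigma> \<in> X" using True \<sigma> simplicesD by auto
    interpret comm_group "V \<rho>" by (rule V_comm[OF X(1)])
    let ?f = "\<lambda>\<tau>. face_map \<tau> \<rho> (?c \<tau>)"
    let ?I = "{\<tau> \<in> simplices X (Suc k). \<rho> \<subseteq> \<tau>}"
    have one: "?f \<tau> = unit \<rho>" if "\<tau> \<in> ?I" "\<not> \<tau> \<subseteq> \<sigma>" for \<tau>
      using bnd_single[OF \<sigma> v, of \<tau>] that face_map_one[OF simplicesD(1) X(1)] by auto
    have "gfinprod (V \<rho>) ?f ?I = unit \<rho>"
    proof (cases "\<rho> \<subseteq> \<sigma>")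
      case False
      then show ?thesis using one by (intro gfinprod_one) blast
    next
      case sub: True
      have fin: "finite \<sigma>" "card \<sigma> = k + 3" "card \<rho> = k + 1" "finite \<rho>"
        using simplex_finite X simplicesD(2)[OF \<sigma>] simplicesD(2)[OF True] by auto
      have "card (\<sigma> - \<rho>) = 2" using sub fin by (simp add: card_Diff_subset)
      then obtain x y where "\<sigma> - \<rho> = {x, y}" "x \<noteq> y" by (auto simp: card_2_iff)
      moreover from this have "lab x \<noteq> lab y" using lab_inj[OF X(2)] by (auto dest: inj_onD)
      ultimately obtain x y where xy: "\<sigma> - \<rho> = {x, y}" "lab x < lab y"
        by (metis insert_commute linorder_neqE_nat)
      have xy': "x \<in> \<sigma>" "y \<in> \<sigma>" "x \<noteq> y" "x \<notin> \<rho>" "y \<notin> \<rho>" using xy by auto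
      define \<tau>x where "\<tau>x = \<sigma> - {x}"
      define \<tau>y where "\<tau>y = \<sigma> - {y}"
      have \<rho>: "\<rho> = \<tau>y - {x}" "\<rho> = \<tau>x - {y}" using xy(1) sub by (auto simp: \<tau>x_def \<tau>y_def)
      have \<tau>: "\<tau>x \<in> ?I" "\<tau>y \<in> ?I" "\<tau>x \<noteq> \<tau>y" "\<tau>x \<subseteq> \<sigma>" "\<tau>y \<subseteq> \<sigma>"
      proof -
        have "card \<tau>x = k + 2" "card \<tau>y = k + 2" using fin xy' by (auto simp: \<tau>x_def \<tau>y_def)
        moreover from this have "\<tau>x \<noteq> {}" "\<tau>y \<noteq> {}" by auto
        then have "\<tau>x \<in> X" "\<tau>y \<in> X"
          using simplex_face[OF X(2), of \<tau>x] simplex_face[OF X(2), of \<tau>y]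
          by (simp_all add: \<tau>x_def \<tau>y_def Diff_subset)
        ultimately show "\<tau>x \<in> ?I" "\<tau>y \<in> ?I" using \<rho> by (auto simp: simplices_def)
        show "\<tau>x \<noteq> \<tau>y" using xy' by (auto simp: \<tau>x_def \<tau>y_def)
      qed (auto simp: \<tau>x_def \<tau>y_def)
      have only: "\<tau> = \<tau>x \<or> \<tau> = \<tau>y" if t: "\<tau> \<in> ?I" "\<tau> \<subseteq> \<sigma>" for \<tau>
      proof -
        have "card \<tau> = k + 2" using simplicesD(2) t(1) by auto
        then have "card (\<sigma> - \<tau>) = 1"
          using t(2) fin(1,2) finite_subset[OF t(2)] by (simp add: card_Diff_subset)
        then obtain u where u: "\<sigma> - \<tau> = {u}" by (auto simp: card_1_singleton_iff)
        then have "u \<in> {x, y}" using t(1) xy(1) by auto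
        moreover have "\<tau> = \<sigma> - {u}" using u t(2) by auto
        ultimately show ?thesis by (auto simp: \<tau>x_def \<tau>y_def)
      qed
      have rv: "r \<sigma> \<rho> v \<in> carrier (V \<rho>)" using r_hom[OF X(2,1) sub] v by (simp add: hom_in_carrier)
      have f: "?f \<tau> = r \<sigma> \<rho> v [^]\<^bsub>V \<rho>\<^esub> (incidence lab \<sigma> \<tau> * incidence lab \<tau> \<rho>)"
        if "\<tau> \<in> ?I" "\<tau> \<subseteq> \<sigma>" for \<tau>
        using bnd_single[OF \<sigma> v, of \<tau>] face_map_comp[OF X(2) _ X(1) _ that(2) v] that simplicesD(1)
        by auto
      have "gfinprod (V \<rho>) ?f ?I = ?f \<tau>y \<otimes>\<^bsub>V \<rho>\<^esub> ?f \<tau>x"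
      proof (rule gfinprod_pair[OF \<tau>(2,1) \<tau>(3)[symmetric]])
        show "?f \<tau>y \<in> carrier (V \<rho>)" "?f \<tau>x \<in> carrier (V \<rho>)"
          using f \<tau> rv by auto
        show "?f \<tau> = unit \<rho>" if "\<tau> \<in> ?I" "\<tau> \<noteq> \<tau>y" "\<tau> \<noteq> \<tau>x" for \<tau>
          using only[OF that(1)] one[OF that(1)] that(2,3) by blast
      qed
      also have "\<dots> = r \<sigma> \<rho> v [^]\<^bsub>V \<rho>\<^esub> (incidence lab \<sigma> \<tau>y * incidence lab \<tau>y \<rho> +
          incidence lab \<sigma> \<tau>x * incidence lab \<tau>x \<rho>)"
        unfolding f[OF \<tau>(1,4)] f[OF \<tau>(2,5)] using int_pow_mult[OF rv] by simp
      also have "incidence lab \<sigma> \<tau>y * incidence lab \<tau>y \<rho> + incidence lab \<sigma> \<tau>x * incidence lab \<tau>x \<rho> = 0"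
        using incidence_cancel[OF fin(1) xy'(1,2) xy(2)] \<rho> unfolding \<tau>x_def \<tau>y_def by metis
      finally show ?thesis by simp
    qed
    then show ?thesis using True by (simp add: bnd_eq one_chains)
  qed
qed

lemma bnd_bnd:
  assumes "c \<in> carrier (Ch (Suc (Suc k)))"
  shows "bnd k (bnd (Suc k) c) = \<one>\<^bsub>Ch k\<^esub>"
proof -
  let ?S = "simplices X (Suc (Suc k))"
  let ?C = "Ch (Suc (Suc k))"
  interpret C: group ?C by (rule chains_group)
  have hom: "(\<lambda>c. bnd k (bnd (Suc k) c)) \<in> hom ?C (Ch k)"
    using hom_compose[OF bnd_hom bnd_hom, of k] by (simp add: comp_def)
  \<comment> \<open>Induction over a finite set containing the support, splitting off one simplex at
    a time.\<close>
  have "bnd k (bnd (Suc k) c) = \<one>\<^bsub>Ch k\<^esub>"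
    if "finite F" "c \<in> carrier ?C" "\<forall>\<tau>\<in>?S. c \<tau> \<noteq> unit \<tau> \<longrightarrow> \<tau> \<in> F" for F c
    using that
  proof (induction F arbitrary: c rule: finite_induct)
    case empty
    have "c = \<one>\<^bsub>?C\<^esub>"
    proof
      fix \<tau> show "c \<tau> = \<one>\<^bsub>?C\<^esub> \<tau>"
        using empty.prems by (cases "\<tau> \<in> ?S") (auto simp: one_chains carrier_chains PiE_iff extensional_def)
    qed
    then show ?case using hom_one[OF hom chains_group chains_group] by simp
  next
    case (insert \<sigma> F)
    show ?case
    proof (cases "\<sigma> \<in> ?S")
      case False
      then show ?thesis using insert by blast
    next
      case True
      have c: "\<And>\<tau>. \<tau> \<in> ?S \<Longrightarrow> c \<tau> \<in> carrier (V \<tau>)" "c \<in> extensional ?S"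
        "finite (supp ?S c)"
        using insert.prems(1) by (auto simp: carrier_chains PiE_iff)
      define c' where "c' = (\<lambda>\<tau>\<in>?S. if \<tau> = \<sigma> then unit \<tau> else c \<tau>)"
      have one: "unit \<tau> \<in> carrier (V \<tau>)" if "\<tau> \<in> ?S" for \<tau>
        using group.is_monoid[OF V_group[OF simplicesD(1)[OF that]]] by (rule monoid.one_closed)
      have "finite (supp ?S c')"
        by (rule finite_subset[OF _ c(3)]) (auto simp: c'_def)
      then have c': "c' \<in> carrier ?C" using c one by (auto simp: carrier_chains c'_def)
      have s: "single (Suc (Suc k)) \<sigma> (c \<sigma>) \<in> carrier ?C" by (rule single_closed[OF True c(1)[OF True]])
      have "c = single (Suc (Suc k)) \<sigma> (c \<sigma>) \<otimes>\<^bsub>?C\<^esub> c'"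
      proof
        fix \<tau>
        show "c \<tau> = (single (Suc (Suc k)) \<sigma> (c \<sigma>) \<otimes>\<^bsub>?C\<^esub> c') \<tau>"
        proof (cases "\<tau> \<in> ?S")
          case False
          then show ?thesis using c(2) by (simp add: mult_chains extensional_def)
        next
          case t: True
          have "monoid (V \<tau>)" using group.is_monoid[OF V_group[OF simplicesD(1)[OF t]]] .
          then show ?thesis
            using t c(1)[OF t]
            by (cases "\<tau> = \<sigma>") (simp_all add: mult_chains single_def c'_def monoid.l_one monoid.r_one)
        qed
      qed
      then have "bnd k (bnd (Suc k) c) = bnd k (bnd (Suc k) (single (Suc (Suc k)) \<sigma> (c \<sigma>))) \<otimes>\<^bsub>Ch k\<^esub>
          bnd k (bnd (Suc k) c')"
        using hom_mult[OF hom s c'] by simp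
      also have "bnd k (bnd (Suc k) (single (Suc (Suc k)) \<sigma> (c \<sigma>))) = \<one>\<^bsub>Ch k\<^esub>"
        by (rule bnd_bnd_single[OF True c(1)[OF True]])
      also have "bnd k (bnd (Suc k) c') = \<one>\<^bsub>Ch k\<^esub>"
        by (rule insert.IH[OF c']) (use insert.prems(2) in \<open>auto simp: c'_def\<close>)
      finally show ?thesis
        using monoid.l_one[OF group.is_monoid[OF chains_group]] monoid.one_closed[OF group.is_monoid[OF chains_group]]
        by simp
    qed
  qed
  from this[of "supp ?S c" c] show ?thesis
    using assms by (auto simp: carrier_chains)
qed

lemma trivial_homology:
  assumes "\<And>c. c \<in> carrier (Ch (Suc j)) \<Longrightarrow> bnd j c = \<one>\<^bsub>Ch j\<^esub> \<Longrightarrow>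
    c \<in> bnd (Suc j) ` carrier (Ch (Suc (Suc j)))"
  shows "trivial_group (homology_grp X lab V r (Suc j))"
proof -
  let ?Z = "kernel (Ch (Suc j)) (Ch j) (bnd j)"
  have "bnd (Suc j) ` carrier (Ch (Suc (Suc j))) = ?Z"
    using assms bnd_bnd hom_in_carrier[OF bnd_hom] unfolding kernel_def by blast
  moreover have Z: "subgroup ?Z (Ch (Suc j))"
    by (rule group_hom.subgroup_kernel[OF bnd_group_hom])
  moreover have "carrier (subgroup_generated (Ch (Suc j)) ?Z) = ?Z"
    by (rule subgroup.carrier_subgroup_generated_subgroup[OF Z])
  moreover have "group (subgroup_generated (Ch (Suc j)) ?Z)"
    by (rule group.group_subgroup_generated[OF chains_group])
  ultimately show ?thesis
    using trivial_group_Mod_carrier unfolding homology_grp_def cycles_def by fastforce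
qed

section \<open>Lower links, upper faces and weights\<close>

definition lower_link :: "('v \<Rightarrow> nat) \<Rightarrow> 'v set \<Rightarrow> 'v set" where
  "lower_link h \<eta> = {z. insert z \<eta> \<in> X \<and> (\<forall>v\<in>\<eta>. h z < h v)}"

abbreviation star1 :: "('v \<Rightarrow> nat) \<Rightarrow> 'v set \<Rightarrow> 'v set set" where
  "star1 h \<eta> \<equiv> {{z} \<union> \<eta> |z. z \<in> lower_link h \<eta>}"

abbreviation star2 :: "('v \<Rightarrow> nat) \<Rightarrow> 'v set \<Rightarrow> 'v set set" where
  "star2 h \<eta> \<equiv> {{z, z'} \<union> \<eta> |z z'.
     z \<in> lower_link h \<eta> \<and> z' \<in> lower_link h \<eta> \<and> {z, z'} \<in> simplices X 1}"

text \<open>For a height \<open>h\<close> that is injective on simplices, \<open>weight h\<close> compares the height sets of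
  simplices of the same dimension lexicographically, largest heights first.\<close>

definition weight :: "('v \<Rightarrow> nat) \<Rightarrow> 'v set \<Rightarrow> nat" where
  "weight h \<eta> = (\<Sum>v\<in>\<eta>. 2 ^ h v)"

definition lowest :: "('v \<Rightarrow> nat) \<Rightarrow> 'v set \<Rightarrow> 'v" where
  "lowest h \<tau> = arg_min_on h \<tau>"

definition upper_face :: "('v \<Rightarrow> nat) \<Rightarrow> 'v set \<Rightarrow> 'v set" where
  "upper_face h \<tau> = \<tau> - {lowest h \<tau>}"

context
  fixes h :: "'v \<Rightarrow> nat"
  assumes h_inj: "\<And>\<sigma>. \<sigma> \<in> X \<Longrightarrow> inj_on h \<sigma>"
begin

lemma lowest:
  assumes "\<tau> \<in> X"
  shows "lowest h \<tau> \<in> \<tau>" "\<And>v. v \<in> \<tau> \<Longrightarrow> v \<noteq> lowest h \<tau> \<Longrightarrow> h (lowest h \<tau>) < h v"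
proof -
  have ne: "finite \<tau>" "\<tau> \<noteq> {}" using assms simplicial unfolding simplicial_complex_def by auto
  show l: "lowest h \<tau> \<in> \<tau>" unfolding lowest_def by (rule arg_min_if_finite(1)[OF ne])
  fix v assume v: "v \<in> \<tau>" "v \<noteq> lowest h \<tau>"
  have "\<not> h v < h (lowest h \<tau>)" using arg_min_if_finite(2)[OF ne, of h] v(1) unfolding lowest_def by blast
  moreover have "h v \<noteq> h (lowest h \<tau>)" using inj_onD[OF h_inj[OF assms]] v l by blast
  ultimately show "h (lowest h \<tau>) < h v" by simp
qed

lemma weight_exchange:
  assumes "finite \<eta>" "v \<in> \<eta>" "w \<notin> \<eta>"
  shows "weight h (insert w (\<eta> - {v})) + 2 ^ h v = weight h \<eta> + 2 ^ h w"
proof -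
  have "weight h \<eta> = 2 ^ h v + weight h (\<eta> - {v})"
    unfolding weight_def using assms by (simp add: sum.remove)
  moreover have "weight h (insert w (\<eta> - {v})) = 2 ^ h w + weight h (\<eta> - {v})"
    unfolding weight_def using assms by simp
  ultimately show ?thesis by simp
qed

lemma upper_face_simplex:
  assumes "\<tau> \<in> simplices X (Suc j)"
  shows "upper_face h \<tau> \<in> simplices X j" "lowest h \<tau> \<in> lower_link h (upper_face h \<tau>)"
    "insert (lowest h \<tau>) (upper_face h \<tau>) = \<tau>"
proof -
  have \<tau>: "\<tau> \<in> X" "card \<tau> = j + 2" "finite \<tau>" using assms simplicesD simplex_finite by auto
  note l = lowest[OF \<tau>(1)]
  show i: "insert (lowest h \<tau>) (upper_face h \<tau>) = \<tau>" using l(1) by (auto simp: upper_face_def)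
  have "card (upper_face h \<tau>) = j + 1" using \<tau> l(1) by (simp add: upper_face_def)
  moreover from this have "upper_face h \<tau> \<noteq> {}" by auto
  then have "upper_face h \<tau> \<in> X"
    by (intro simplex_face[OF \<tau>(1)]) (simp_all add: upper_face_def Diff_subset)
  ultimately show "upper_face h \<tau> \<in> simplices X j" by (simp add: simplices_def)
  show "lowest h \<tau> \<in> lower_link h (upper_face h \<tau>)"
    using i \<tau>(1) l(2) by (simp add: lower_link_def upper_face_def)
qed

text \<open>The vertex v added to \<eta> is not the lowest one, so the upper face arises from \<eta>
  by trading its lowest vertex for the higher v.\<close>

lemma weight_upper_face_greater:
  assumes "\<tau> \<in> simplices X (Suc j)" "\<eta> \<in> simplices X j" "\<eta> \<subseteq> \<tau>"
    "\<tau> \<notin> star1 h \<eta>"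
  shows "weight h \<eta> < weight h (upper_face h \<tau>)"
proof -
  have \<tau>: "\<tau> \<in> X" "finite \<tau>" using assms(1) simplicesD simplex_finite by auto
  have fin: "finite \<eta>" using assms(3) \<tau>(2) finite_subset by blast
  have "card (\<tau> - \<eta>) = 1"
    using simplicesD(2)[OF assms(1)] simplicesD(2)[OF assms(2)] assms(3) fin by (simp add: card_Diff_subset)
  then obtain v where "\<tau> - \<eta> = {v}" by (auto simp: card_1_singleton_iff)
  then have v: "\<tau> = insert v \<eta>" "v \<notin> \<eta>" using assms(3) by auto
  note l = lowest[OF \<tau>(1)]
  have "lowest h \<tau> \<noteq> v"
  proof
    assume "lowest h \<tau> = v"
    then have "\<forall>u\<in>\<eta>. h v < h u" using l(2) v by auto
    then have "v \<in> lower_link h \<eta>" using \<tau>(1) v by (simp add: lower_link_def)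
    then show False using assms(4) v(1) by blast
  qed
  then have l\<eta>: "lowest h \<tau> \<in> \<eta>" and lt: "h (lowest h \<tau>) < h v" using l v by auto
  have "upper_face h \<tau> = insert v (\<eta> - {lowest h \<tau>})"
    using v \<open>lowest h \<tau> \<noteq> v\<close> by (auto simp: upper_face_def)
  then have "weight h (upper_face h \<tau>) + 2 ^ h (lowest h \<tau>) = weight h \<eta> + 2 ^ h v"
    using weight_exchange[OF fin l\<eta> v(2)] by simp
  moreover have "(2::nat) ^ h (lowest h \<tau>) < 2 ^ h v" using lt by simp
  ultimately show ?thesis by linarith
qed

text \<open>A facet outside the star omits a vertex v of \<eta>. Its lowest vertex is z or z', so
  its upper face is \<eta> with v replaced by the other of the two, which is lower than v.\<close>

lemma weight_upper_face_less:
  assumes \<eta>: "\<eta> \<in> simplices X j" and z: "z \<in> lower_link h \<eta>" "z' \<in> lower_link h \<eta>" "z \<noteq> z'"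
    and \<sigma>: "{z, z'} \<union> \<eta> \<in> simplices X (Suc (Suc j))"
    and \<tau>: "\<tau> \<in> simplices X (Suc j)" "\<tau> \<subseteq> {z, z'} \<union> \<eta>" "\<tau> \<notin> star1 h \<eta>"
  shows "weight h (upper_face h \<tau>) < weight h \<eta>"
proof -
  have fin: "finite ({z, z'} \<union> \<eta>)" using simplex_finite simplicesD(1)[OF \<sigma>] by blast
  have "card (({z, z'} \<union> \<eta>) - \<tau>) = card ({z, z'} \<union> \<eta>) - card \<tau>"
    by (rule card_Diff_subset[OF finite_subset[OF \<tau>(2) fin] \<tau>(2)])
  also have "\<dots> = 1" using simplicesD(2)[OF \<sigma>] simplicesD(2)[OF \<tau>(1)] by simp
  finally obtain v where v: "({z, z'} \<union> \<eta>) - \<tau> = {v}" by (auto simp: card_1_singleton_iff)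
  have zn: "z \<notin> \<eta>" "z' \<notin> \<eta>" using z by (auto simp: lower_link_def)
  have \<tau>v: "\<tau> = ({z, z'} \<union> \<eta>) - {v}" using v \<tau>(2) by blast
  have "v \<noteq> z"
  proof
    assume "v = z"
    then have "\<tau> = insert z' \<eta>" using \<tau>v z(3) zn by auto
    then show False using \<tau>(3) z(2) by blast
  qed
  moreover have "v \<noteq> z'"
  proof
    assume "v = z'"
    then have "\<tau> = insert z \<eta>" using \<tau>v z(3) zn by auto
    then show False using \<tau>(3) z(1) by blast
  qed
  ultimately have v\<eta>: "v \<in> \<eta>" using v by auto
  have \<tau>eq: "\<tau> = insert z (insert z' (\<eta> - {v}))" using \<tau>v v\<eta> zn by auto
  note l = lowest[OF simplicesD(1)[OF \<tau>(1)]]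
  have "lowest h \<tau> \<notin> \<eta>"
  proof
    assume a: "lowest h \<tau> \<in> \<eta>"
    then have "h z < h (lowest h \<tau>)" using z(1) by (simp add: lower_link_def)
    moreover have "z \<in> \<tau>" "z \<noteq> lowest h \<tau>" using \<tau>eq a zn(1) by auto
    then have "h (lowest h \<tau>) < h z" by (rule l(2))
    ultimately show False by simp
  qed
  then obtain w where w: "w \<in> {z, z'}" "upper_face h \<tau> = insert w (\<eta> - {v})"
    using l(1) \<tau>eq zn z(3) unfolding upper_face_def by fastforce
  have "weight h (upper_face h \<tau>) + 2 ^ h v = weight h \<eta> + 2 ^ h w"
    using weight_exchange[of \<eta> v w] fin v\<eta> w zn by auto
  moreover have "h w < h v" using z(1,2) w(1) v\<eta> by (auto simp: lower_link_def)
  then have "(2::nat) ^ h w < 2 ^ h v" by simp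
  ultimately show ?thesis by linarith
qed

text \<open>Subtracting the boundary of \<open>b\<close> removes from the support of \<open>c\<close> all simplices with upper face
  \<open>\<eta>\<close>, at the cost of simplices with lighter upper face.\<close>

lemma eliminate:
  fixes \<eta> :: "'v set" and j :: nat
  defines "S2 \<equiv> star2 h \<eta>" and "S1 \<equiv> star1 h \<eta>"
  assumes \<eta>: "\<eta> \<in> simplices X j"
    and S2: "S2 \<subseteq> simplices X (Suc (Suc j))"
    and exact: "bd lab V r S2 S1 ` carrier (sum_group S2 V) =
      kernel (sum_group S1 V) (sum_group {\<eta>} V) (bd lab V r S1 {\<eta>})"
    and c: "c \<in> carrier (Ch (Suc j))" "bnd j c = \<one>\<^bsub>Ch j\<^esub>"
    and bound: "\<And>\<tau>. \<tau> \<in> simplices X (Suc j) \<Longrightarrow> c \<tau> \<noteq> unit \<tau> \<Longrightarrow> weight h (upper_face h \<tau>) \<le> weight h \<eta>"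
  obtains b where "b \<in> carrier (Ch (Suc (Suc j)))"
    "\<And>\<tau>. \<tau> \<in> S1 \<Longrightarrow> bnd (Suc j) b \<tau> = c \<tau>"
    "\<And>\<tau>. \<tau> \<in> simplices X (Suc j) \<Longrightarrow> \<tau> \<notin> S1 \<Longrightarrow> bnd (Suc j) b \<tau> \<noteq> unit \<tau> \<Longrightarrow>
      weight h (upper_face h \<tau>) < weight h \<eta>"
proof -
  have \<eta>X: "\<eta> \<in> X" "card \<eta> = j + 1" "finite \<eta>" using \<eta> simplicesD simplex_finite by auto
  have S1: "S1 \<subseteq> simplices X (Suc j)"
  proof
    fix \<tau> assume "\<tau> \<in> S1"
    then obtain z where z: "\<tau> = insert z \<eta>" "z \<in> lower_link h \<eta>" by (auto simp: S1_def)
    then have "z \<notin> \<eta>" "\<tau> \<in> X" by (auto simp: lower_link_def)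
    then show "\<tau> \<in> simplices X (Suc j)" using z(1) \<eta>X by (simp add: simplices_def)
  qed
  have S1X: "S1 \<subseteq> X" and S2X: "S2 \<subseteq> X" using S1 S2 simplicesD(1) by blast+
  have cc: "\<And>\<tau>. \<tau> \<in> simplices X (Suc j) \<Longrightarrow> c \<tau> \<in> carrier (V \<tau>)"
    "finite (supp (simplices X (Suc j)) c)"
    using c(1) by (auto simp: carrier_chains)
  define c1 where "c1 = restrict c S1"
  have c1: "c1 \<in> carrier (sum_group S1 V)"
  proof -
    have "finite (supp S1 c1)"
      by (rule finite_subset[OF _ cc(2)]) (use S1 in \<open>auto simp: c1_def\<close>)
    then show ?thesis using cc(1) S1 by (auto simp: carrier_sum[OF S1X] c1_def)
  qed
  \<comment> \<open>Simplices containing \<eta> outside \<open>S1\<close> have a heavier upper face,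
    so \<open>c\<close> is trivial there. The boundary of \<open>c\<close> at \<eta> therefore sees
    \<open>c1\<close> only.\<close>
  have "bd lab V r S1 {\<eta>} c1 = \<one>\<^bsub>sum_group {\<eta>} V\<^esub>"
  proof
    fix \<rho>
    interpret comm_group "V \<eta>" by (rule V_comm[OF \<eta>X(1)])
    have "gfinprod (V \<eta>) (\<lambda>\<tau>. face_map \<tau> \<eta> (c1 \<tau>)) {\<tau> \<in> S1. \<eta> \<subseteq> \<tau>} =
        gfinprod (V \<eta>) (\<lambda>\<tau>. face_map \<tau> \<eta> (c \<tau>)) {\<tau> \<in> simplices X (Suc j). \<eta> \<subseteq> \<tau>}"
    proof (rule gfinprod_mono_neutral_cong_left)
      show "{\<tau> \<in> S1. \<eta> \<subseteq> \<tau>} \<subseteq> {\<tau> \<in> simplices X (Suc j). \<eta> \<subseteq> \<tau>}" using S1 by auto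
      show "face_map \<tau> \<eta> (c1 \<tau>) = face_map \<tau> \<eta> (c \<tau>)" if "\<tau> \<in> {\<tau> \<in> S1. \<eta> \<subseteq> \<tau>}" for \<tau>
        using that by (simp add: c1_def)
      show "(\<lambda>\<tau>. face_map \<tau> \<eta> (c \<tau>)) \<in> {\<tau> \<in> simplices X (Suc j). \<eta> \<subseteq> \<tau>} \<rightarrow> carrier (V \<eta>)"
        using face_map_closed cc(1) simplicesD(1) \<eta>X(1) by blast
      fix \<tau> assume t: "\<tau> \<in> {\<tau> \<in> simplices X (Suc j). \<eta> \<subseteq> \<tau>} - {\<tau> \<in> S1. \<eta> \<subseteq> \<tau>}"
      then have "weight h \<eta> < weight h (upper_face h \<tau>)"
        using weight_upper_face_greater[OF _ \<eta>, of \<tau>] unfolding S1_def by auto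
      then have "c \<tau> = unit \<tau>" using bound[of \<tau>] t by force
      then show "face_map \<tau> \<eta> (c \<tau>) = unit \<eta>"
        using face_map_one[OF simplicesD(1) \<eta>X(1)] t by auto
    qed
    also have "\<dots> = bnd j c \<eta>" by (rule bnd_eq[OF \<eta>, symmetric])
    also have "\<dots> = unit \<eta>" using c(2) \<eta> by (simp add: one_chains)
    finally show "bd lab V r S1 {\<eta>} c1 \<rho> = \<one>\<^bsub>sum_group {\<eta>} V\<^esub> \<rho>"
      using bd_eq[of \<eta> "{\<eta>}" S1 c1] by (cases "\<rho> = \<eta>") (auto simp: bd_def)
  qed
  then have "c1 \<in> bd lab V r S2 S1 ` carrier (sum_group S2 V)"
    unfolding exact using c1 by (simp add: kernel_def)
  then obtain b0 where b0: "b0 \<in> carrier (sum_group S2 V)" "bd lab V r S2 S1 b0 = c1" by blast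
  then have b0': "\<And>\<sigma>. \<sigma> \<in> S2 \<Longrightarrow> b0 \<sigma> \<in> carrier (V \<sigma>)" "finite (supp S2 b0)"
    by (auto simp: carrier_sum[OF S2X])
  let ?S = "simplices X (Suc (Suc j))"
  \<comment> \<open>Extension by units to a chain of the whole complex; at facets outside
    \<open>S1\<close> its boundary may be nontrivial, but these have lighter upper faces.\<close>
  define b where "b = (\<lambda>\<sigma>\<in>?S. if \<sigma> \<in> S2 then b0 \<sigma> else unit \<sigma>)"
  have one: "unit \<sigma> \<in> carrier (V \<sigma>)" if "\<sigma> \<in> ?S" for \<sigma>
    using group.is_monoid[OF V_group[OF simplicesD(1)[OF that]]] by (rule monoid.one_closed)
  have bv: "b \<sigma> \<in> carrier (V \<sigma>)" if "\<sigma> \<in> ?S" for \<sigma> using that one b0'(1) by (simp add: b_def)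
  show thesis
  proof (rule that[of b])
    have "finite (supp ?S b)"
      by (rule finite_subset[OF _ b0'(2)]) (auto simp: b_def)
    then show "b \<in> carrier (Ch (Suc (Suc j)))" using bv by (auto simp: carrier_chains b_def)
  next
    fix \<tau> assume t: "\<tau> \<in> S1"
    then have \<tau>: "\<tau> \<in> simplices X (Suc j)" "\<tau> \<in> X" using S1 S1X by auto
    interpret comm_group "V \<tau>" by (rule V_comm[OF \<tau>(2)])
    have "gfinprod (V \<tau>) (\<lambda>\<sigma>. face_map \<sigma> \<tau> (b0 \<sigma>)) {\<sigma> \<in> S2. \<tau> \<subseteq> \<sigma>} =
        gfinprod (V \<tau>) (\<lambda>\<sigma>. face_map \<sigma> \<tau> (b \<sigma>)) {\<sigma> \<in> ?S. \<tau> \<subseteq> \<sigma>}"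
    proof (rule gfinprod_mono_neutral_cong_left)
      show "{\<sigma> \<in> S2. \<tau> \<subseteq> \<sigma>} \<subseteq> {\<sigma> \<in> ?S. \<tau> \<subseteq> \<sigma>}" using S2 by auto
      show "face_map \<sigma> \<tau> (b0 \<sigma>) = face_map \<sigma> \<tau> (b \<sigma>)" if "\<sigma> \<in> {\<sigma> \<in> S2. \<tau> \<subseteq> \<sigma>}" for \<sigma>
        using that S2 by (auto simp: b_def)
      show "(\<lambda>\<sigma>. face_map \<sigma> \<tau> (b \<sigma>)) \<in> {\<sigma> \<in> ?S. \<tau> \<subseteq> \<sigma>} \<rightarrow> carrier (V \<tau>)"
        using face_map_closed bv simplicesD(1) \<tau>(2) by blast
      show "face_map \<sigma> \<tau> (b \<sigma>) = unit \<tau>" if "\<sigma> \<in> {\<sigma> \<in> ?S. \<tau> \<subseteq> \<sigma>} - {\<sigma> \<in> S2. \<tau> \<subseteq> \<sigma>}" for \<sigma>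
        using that face_map_one[OF simplicesD(1) \<tau>(2)] by (auto simp: b_def)
    qed
    then have "bnd (Suc j) b \<tau> = bd lab V r S2 S1 b0 \<tau>"
      using bnd_eq[OF \<tau>(1)] bd_eq[OF t] by simp
    then show "bnd (Suc j) b \<tau> = c \<tau>" using b0(2) t by (simp add: c1_def)
  next
    fix \<tau> assume \<tau>: "\<tau> \<in> simplices X (Suc j)" "\<tau> \<notin> S1" "bnd (Suc j) b \<tau> \<noteq> unit \<tau>"
    have \<tau>X: "\<tau> \<in> X" using \<tau>(1) simplicesD by blast
    have "\<exists>\<sigma>. \<sigma> \<in> ?S \<and> \<tau> \<subseteq> \<sigma> \<and> face_map \<sigma> \<tau> (b \<sigma>) \<noteq> unit \<tau>"
    proof (rule ccontr)
      assume "\<not> ?thesis"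
      then have "gfinprod (V \<tau>) (\<lambda>\<sigma>. face_map \<sigma> \<tau> (b \<sigma>)) {\<sigma> \<in> ?S. \<tau> \<subseteq> \<sigma>} = unit \<tau>"
        by (intro comm_monoid.gfinprod_one[OF V_monoid[OF \<tau>X]]) blast
      then show False using \<tau>(3) bnd_eq[OF \<tau>(1)] by simp
    qed
    then obtain \<sigma> where \<sigma>: "\<sigma> \<in> ?S" "\<tau> \<subseteq> \<sigma>" "face_map \<sigma> \<tau> (b \<sigma>) \<noteq> unit \<tau>" by blast
    have "\<sigma> \<in> S2"
      using \<sigma> face_map_one[OF simplicesD(1)[OF \<sigma>(1)] \<tau>X \<sigma>(2)] by (auto simp: b_def split: if_splits)
    then obtain z z' where z: "\<sigma> = {z, z'} \<union> \<eta>" "z \<in> lower_link h \<eta>" "z' \<in> lower_link h \<eta>"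
      "{z, z'} \<in> simplices X 1"
      unfolding S2_def by blast
    have "z \<noteq> z'" using simplicesD(2)[OF z(4)] by auto
    then show "weight h (upper_face h \<tau>) < weight h \<eta>"
      using weight_upper_face_less[OF \<eta> z(2,3)] \<sigma>(1,2) z(1) \<tau>(1,2) unfolding S1_def by blast
  qed
qed

text \<open>One elimination may bring in many new simplices, all with lighter upper face, so the
  size of the support is no measure of progress. The induction is nested instead: on a bound for the
  weights and, inside, on the finite set of upper faces of maximal weight.\<close>

lemma cycle_is_boundary:
  assumes acyclic: "\<And>\<eta>. \<eta> \<in> simplices X j \<Longrightarrow>
      star2 h \<eta> \<subseteq> simplices X (Suc (Suc j)) \<and>
      bd lab V r (star2 h \<eta>) (star1 h \<eta>) ` carrier (sum_group (star2 h \<eta>) V) =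
        kernel (sum_group (star1 h \<eta>) V) (sum_group {\<eta>} V) (bd lab V r (star1 h \<eta>) {\<eta>})"
    and c: "c \<in> carrier (Ch (Suc j))" "bnd j c = \<one>\<^bsub>Ch j\<^esub>"
  shows "c \<in> bnd (Suc j) ` carrier (Ch (Suc (Suc j)))"
proof -
  let ?S = "simplices X (Suc j)"
  let ?B = "bnd (Suc j) ` carrier (Ch (Suc (Suc j)))"
  interpret C: group "Ch (Suc j)" by (rule chains_group)
  interpret B: group_hom "Ch (Suc (Suc j))" "Ch (Suc j)" "bnd (Suc j)" by (rule bnd_group_hom)
  interpret Z: group_hom "Ch (Suc j)" "Ch j" "bnd j" by (rule bnd_group_hom)
  \<comment> \<open>\<open>F\<close> lists the upper faces that are still allowed at weight exactly
    n.\<close>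
  define low where "low = (\<lambda>n F c. \<forall>\<tau>\<in>?S. c \<tau> \<noteq> unit \<tau> \<longrightarrow>
    weight h (upper_face h \<tau>) < n \<or> weight h (upper_face h \<tau>) = n \<and> upper_face h \<tau> \<in> F)"
  define Z where "Z = kernel (Ch (Suc j)) (Ch j) (bnd j)"
  have inner: "\<forall>c. c \<in> Z \<longrightarrow> low n F c \<longrightarrow> c \<in> ?B"
    if "finite F" "\<forall>c. c \<in> Z \<longrightarrow> low n {} c \<longrightarrow> c \<in> ?B" for n F
    using that(1)
  proof (induction F rule: finite_induct)
    case empty
    show ?case by (rule that(2))
  next
    case (insert \<eta> F)
    show ?case
    proof (intro allI impI)
      fix c assume cZ: "c \<in> Z" and lo: "low n (insert \<eta> F) c"
      then have c: "c \<in> carrier (Ch (Suc j))" "bnd j c = \<one>\<^bsub>Ch j\<^esub>" by (auto simp: Z_def kernel_def)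
      show "c \<in> ?B"
      proof (cases "\<eta> \<in> simplices X j \<and> weight h \<eta> = n")
        \<comment> \<open>No simplex of the support has \<eta> as upper face of weight n, so \<eta>
          may be dropped from the list.\<close>
        case False
        then have "low n F c" using lo upper_face_simplex(1) unfolding low_def by blast
        then show ?thesis using insert.IH cZ by blast
      next
        case True
        then have \<eta>: "\<eta> \<in> simplices X j" "weight h \<eta> = n" by auto
        let ?S1 = "star1 h \<eta>"
        have bound: "weight h (upper_face h \<tau>) \<le> weight h \<eta>" if "\<tau> \<in> ?S" "c \<tau> \<noteq> unit \<tau>" for \<tau>
          using lo[unfolded low_def, rule_format, OF that] \<eta>(2) by auto
        obtain b where b: "b \<in> carrier (Ch (Suc (Suc j)))"
          "\<And>\<tau>. \<tau> \<in> ?S1 \<Longrightarrow> bnd (Suc j) b \<tau> = c \<tau>"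
          "\<And>\<tau>. \<tau> \<in> ?S \<Longrightarrow> \<tau> \<notin> ?S1 \<Longrightarrow> bnd (Suc j) b \<tau> \<noteq> unit \<tau> \<Longrightarrow>
            weight h (upper_face h \<tau>) < weight h \<eta>"
          using eliminate[OF \<eta>(1) conjunct1[OF acyclic[OF \<eta>(1)]] conjunct2[OF acyclic[OF \<eta>(1)]] c bound]
          by blast
        let ?e = "inv\<^bsub>Ch (Suc j)\<^esub> (bnd (Suc j) b)"
        define c' where "c' = c \<otimes>\<^bsub>Ch (Suc j)\<^esub> ?e"
        have bb: "bnd (Suc j) b \<in> carrier (Ch (Suc j))" using b(1) by simp
        have e: "?e \<tau> = inv\<^bsub>V \<tau>\<^esub> (bnd (Suc j) b \<tau>)" if "\<tau> \<in> ?S" for \<tau>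
          using inv_sum_group[of ?S V "bnd (Suc j) b"] V_group simplicesD(1) bb that
          unfolding chain_grp_def by auto
        have "bnd j c' = \<one>\<^bsub>Ch j\<^esub>"
          using c bb bnd_bnd[OF b(1)] by (simp add: c'_def)
        then have "c' \<in> Z" using c(1) bb by (simp add: Z_def kernel_def c'_def)
        moreover have "low n F c'"
          unfolding low_def
        proof (intro ballI impI)
          fix \<tau> assume \<tau>: "\<tau> \<in> ?S" "c' \<tau> \<noteq> unit \<tau>"
          interpret V: group "V \<tau>" using V_group simplicesD(1)[OF \<tau>(1)] by blast
          have c\<tau>: "c \<tau> \<in> carrier (V \<tau>)" using c(1) \<tau>(1) by (auto simp: carrier_chains)
          have c': "c' \<tau> = c \<tau> \<otimes>\<^bsub>V \<tau>\<^esub> inv\<^bsub>V \<tau>\<^esub> (bnd (Suc j) b \<tau>)"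
            using e[OF \<tau>(1)] \<tau>(1) by (simp add: c'_def mult_chains)
          have notS1: "\<tau> \<notin> ?S1"
          proof
            assume "\<tau> \<in> ?S1"
            from b(2)[OF this] show False using c' \<tau>(2) V.r_inv[OF c\<tau>] by simp
          qed
          show "weight h (upper_face h \<tau>) < n \<or> weight h (upper_face h \<tau>) = n \<and> upper_face h \<tau> \<in> F"
          proof (cases "bnd (Suc j) b \<tau> = unit \<tau>")
            case True
            then have "c \<tau> \<noteq> unit \<tau>" using c' \<tau>(2) by auto
            \<comment> \<open>A simplex with upper face \<eta> would lie in the star of \<eta>,
              where the new cycle has become trivial.\<close>
            moreover have "upper_face h \<tau> \<noteq> \<eta>"
              using upper_face_simplex(2,3)[OF \<tau>(1)] notS1 by auto
            ultimately show ?thesis using lo \<tau>(1) unfolding low_def by blast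
          next
            case False
            then show ?thesis using b(3)[OF \<tau>(1) notS1] \<eta>(2) by simp
          qed
        qed
        ultimately obtain f where f: "f \<in> carrier (Ch (Suc (Suc j)))" "c' = bnd (Suc j) f"
          using insert.IH by blast
        have "c = c' \<otimes>\<^bsub>Ch (Suc j)\<^esub> bnd (Suc j) b"
          using c(1) bb by (simp add: c'_def C.m_assoc)
        also have "\<dots> = bnd (Suc j) (f \<otimes>\<^bsub>Ch (Suc (Suc j))\<^esub> b)" using f b(1) by simp
        finally show ?thesis using B.G.m_closed[OF f(1) b(1)] by blast
      qed
    qed
  qed
  have outer: "\<forall>c. c \<in> Z \<longrightarrow> low n {} c \<longrightarrow> c \<in> ?B" for n
  proof (induction n)
    case 0
    show ?case
    proof (intro allI impI)
      fix c assume "c \<in> Z" "low 0 {} c"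
      then have "c = \<one>\<^bsub>Ch (Suc j)\<^esub>"
        by (auto simp: Z_def kernel_def carrier_chains one_chains low_def PiE_iff extensional_def)
      then have "c = bnd (Suc j) \<one>\<^bsub>Ch (Suc (Suc j))\<^esub>" by simp
      then show "c \<in> ?B" using B.G.one_closed by blast
    qed
  next
    case (Suc n)
    show ?case
    proof (intro allI impI)
      fix c assume c: "c \<in> Z" "low (Suc n) {} c"
      \<comment> \<open>Weights below \<open>Suc n\<close> are at most n; the finite support of
        \<open>c\<close> yields the finite list for the inner induction.\<close>
      let ?F = "upper_face h ` (supp ?S c)"
      have "finite ?F" using c(1) by (auto simp: Z_def kernel_def carrier_chains)
      moreover have "low n ?F c" using c(2) unfolding low_def by (auto simp: less_Suc_eq)
      ultimately show "c \<in> ?B" using inner[OF _ Suc.IH] c(1) by blast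
    qed
  qed
  have fin: "finite (supp ?S c)" using c(1) by (auto simp: carrier_chains)
  \<comment> \<open>A sum of natural numbers dominates each summand, so this exceeds all weights on
    the support.\<close>
  define n where "n = Suc (\<Sum>\<tau>\<in>supp ?S c. weight h (upper_face h \<tau>))"
  have "low n {} c"
    unfolding low_def
  proof (intro ballI impI disjI1)
    fix \<tau> assume "\<tau> \<in> ?S" "c \<tau> \<noteq> unit \<tau>"
    then show "weight h (upper_face h \<tau>) < n"
      unfolding n_def less_Suc_eq_le by (intro member_le_sum[OF _ _ fin]) auto
  qed
  moreover have "c \<in> Z" using c by (simp add: Z_def kernel_def)
  ultimately show ?thesis using outer by blast
qed

end

end

section \<open>Vanishing of the homology\<close>

lemma (in oriented_building) height_inj:
  assumes "{b} \<in> X" "\<sigma> \<in> X"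
  shows "inj_on (height b) \<sigma>"
proof -
  obtain xs where xs: "set xs = \<sigma>" "height_sorted b xs"
    using height_sorted_enumeration[OF assms] by blast
  then have "sorted_wrt (<) (map (height b) xs)" by (simp add: sorted_wrt_map)
  then have "distinct (map (height b) xs)" by (simp add: strict_sorted_iff)
  then show ?thesis using xs(1) by (simp add: distinct_map)
qed

lemma (in oriented_building) vertex_exists: "\<exists>b. {b} \<in> X"
proof -
  obtain A where A: "A \<in> \<A>" using bld unfolding affine_A_building_def building_def by blast
  obtain \<sigma> where "\<sigma> \<in> A" "card \<sigma> = d + 1" using apartment_chambers(1)[OF A] by blast
  then have "\<sigma> \<in> X" "\<sigma> \<noteq> {}" using apartment_subcomplex(1)[OF A] by auto
  then show ?thesis using simplex_face[of \<sigma>] by (meson bot.extremum ex_in_conv insert_not_empty insert_subset)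
qed

theorem theorem1p7:
  fixes d k :: nat
    and X :: "'v set set" and \<A> :: "'v set set set"
    and ori :: "'v set \<Rightarrow> 'v list set" and lab :: "'v \<Rightarrow> nat"
    and V :: "'v set \<Rightarrow> ('a, 'm) monoid_scheme" and r :: "'v set \<Rightarrow> 'v set \<Rightarrow> 'a \<Rightarrow> 'a"
  assumes "1 \<le> d"
    and "affine_A_building d X \<A>"
    and "orientation d X \<A> ori"
    and "type_labelling d X lab"
    and "hcs X V r"
    and "1 \<le> k" and "k \<le> d"
    and "condition_S_star X lab V r ori k"
  shows "trivial_group (homology_grp X lab V r k)"
proof -
  interpret B: oriented_building d X \<A> ori using assms(1-3) by unfold_locales
  interpret C: coefficient_system X lab V r
    using assms(4,5) B.simplicial by unfold_locales (auto simp: type_labelling_def)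
  obtain b where b: "{b} \<in> X" using B.vertex_exists by blast
  obtain j where k: "k = Suc j" using assms(6) by (cases k) auto
  let ?M = "C.lower_link (B.height b)"
  let ?S2 = "C.star2 (B.height b)" and ?S1 = "C.star1 (B.height b)"
  have M: "?M \<eta> = B.lower_vertices b \<eta>" for \<eta>
    by (simp add: C.lower_link_def B.lower_vertices_def)
  \<comment> \<open>The condition is applied to the enumeration of \<eta> by increasing height and
    to the stable set of its lower vertices.\<close>
  have acyclic: "?S2 \<eta> \<subseteq> simplices X (Suc (Suc j)) \<and>
      bd lab V r (?S2 \<eta>) (?S1 \<eta>) ` carrier (sum_group (?S2 \<eta>) V) =
        kernel (sum_group (?S1 \<eta>) V) (sum_group {\<eta>} V) (bd lab V r (?S1 \<eta>) {\<eta>})"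
    if \<eta>: "\<eta> \<in> simplices X j" for \<eta>
  proof -
    have \<eta>X: "\<eta> \<in> X" "card \<eta> = j + 1" using C.simplicesD[OF \<eta>] by auto
    obtain xs where xs: "pointed X ori (card \<eta> - 1) xs" "set xs = \<eta>" "B.height_sorted b xs"
      using B.height_sorted_enumeration[OF b \<eta>X(1)] by blast
    have len: "length xs = j + 1" using B.pointedD(3)[OF xs(1)] \<eta>X(2) by simp
    then have "xs \<noteq> []" by auto
    then obtain ys x where ysx: "xs = ys @ [x]" by (metis append_butlast_last_id)
    have ptd: "pointed X ori (length ys) xs" using xs(1) \<eta>X(2) len ysx by simp
    have "stable X ori xs (?M \<eta>)"
      using B.lower_vertices_stable[OF b ysx ptd xs(3)] xs(2) M by simp
    moreover have "pointed X ori (k - 1) xs" using xs(1) \<eta>X(2) k by simp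
    ultimately have "bd lab V r (?S2 \<eta>) (?S1 \<eta>) ` carrier (sum_group (?S2 \<eta>) V) =
        kernel (sum_group (?S1 \<eta>) V) (sum_group {\<eta>} V) (bd lab V r (?S1 \<eta>) {\<eta>})"
      using assms(8) unfolding condition_S_star_def Let_def xs(2)[symmetric] by blast
    moreover have "?S2 \<eta> \<subseteq> simplices X (Suc (Suc j))"
      using B.lower_vertices_flag[OF b ysx ptd xs(3)] xs(2) len M by auto
    ultimately show ?thesis by blast
  qed
  show ?thesis
    unfolding k
    by (rule C.trivial_homology, rule C.cycle_is_boundary[OF B.height_inj[OF b] acyclic])
qed

end
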